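(* For every $k\ge1$: $\rho_k(t)\le\rho_{k-1}(t)$ for every $t\ge0$, with strict inequality whenever $\rho_{k-1}(t)>0$. Furthermore, $\sigma_k\ge\sigma_{k-1}+1$.
   Context: Model: vertex set $[n]$. For each unordered pair of distinct vertices, edges arrive at the points of a Poisson process of rate $1/n$ on $(0,\infty)$, independently over pairs. $G_1(t)$ is the multigraph of edges arrived by time $t$; recursively, $F_k(t)$ is the subgraph of $G_k(t)$ of those edges which at their arrival time $s\le t$ joined two different components of $G_k(s)$, and $G_{k+1}(t):=G_k(t)\setminus F_k(t)$. $C_1(G)$ is the number of vertices in the largest component of $G$. For $k\ge1$, $\rho_k:[0,\infty)\to[0,1]$ is the continuous increasing function with $C_1(G_k(t))/n\to\rho_k(t)$ in probability uniformly in $t$, and $\sigma_k>0$ is the threshold such that $\rho_k(t)=0$ for $t\le\sigma_k$ and $\rho_k(t)>0$ for $t>\sigma_k$ (existence of both is a result of the same paper). Conventions: $\rho_0(t):=1$ for all $t\ge0$ and $\sigma_0:=0$. *)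

theory Defs
  imports "HOL-Probability.Probability" "HOL-Library.Nat_Bijection"
begin

type_synonym edge = "nat \<times> nat \<times> nat"   (* (u, v, j): j-th arrival on pair {u,v}, u < v *)
type_synonym sample = "edge \<Rightarrow> real"

text \<open>Underlying probability space: i.i.d. Exp(1) variables indexed by (u,v,j).
  For the graph on vertex set {0..<n} the inter-arrival times on the pair {u,v}
  are n times these, i.e. Exp(1/n): a Poisson process of rate 1/n.\<close>
definition Omega :: "sample measure" where
  "Omega = PiM UNIV (\<lambda>_. density lborel (exponential_density 1))"

definition arrival :: "nat \<Rightarrow> sample \<Rightarrow> edge \<Rightarrow> real" where
  "arrival n \<omega> x = real n * (\<Sum>i\<le>snd (snd x). \<omega> (fst x, fst (snd x), i))"

text \<open>Edges of the multigraph G_1(t) on vertex set {0..<n}.\<close>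
definition edges_upto :: "nat \<Rightarrow> sample \<Rightarrow> real \<Rightarrow> edge set" where
  "edges_upto n \<omega> t = {x. fst x < fst (snd x) \<and> fst (snd x) < n \<and> arrival n \<omega> x \<le> t}"

text \<open>Graph relation (symmetric) of those labelled edges whose label is at least k.\<close>
definition level_rel :: "(edge \<times> nat) list \<Rightarrow> nat \<Rightarrow> (nat \<times> nat) set" where
  "level_rel L k = {(a, b). \<exists>x l. (x, l) \<in> set L \<and> k \<le> l \<and>
       ((a, b) = (fst x, fst (snd x)) \<or> (b, a) = (fst x, fst (snd x)))}"

text \<open>Level of a new edge given the (labelled) earlier edges: the edge lies in F_k
  for the least k \<ge> 1 such that its endpoints are in different components of
  G_k just before its arrival (G_k = earlier edges of level \<ge> k).\<close>
definition new_level :: "(edge \<times> nat) list \<Rightarrow> edge \<Rightarrow> nat" where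
  "new_level L x = (LEAST k. 1 \<le> k \<and> (fst x, fst (snd x)) \<notin> (level_rel L k)\<^sup>*)"

definition add_edge :: "(edge \<times> nat) list \<Rightarrow> edge \<Rightarrow> (edge \<times> nat) list" where
  "add_edge L x = L @ [(x, new_level L x)]"

text \<open>Injective coding of edges as natural numbers (only used to list a finite edge set).\<close>
definition edge_code :: "edge \<Rightarrow> nat" where
  "edge_code x = prod_encode (fst x, prod_encode (snd x))"

definition edge_decode :: "nat \<Rightarrow> edge" where
  "edge_decode m = (fst (prod_decode m), prod_decode (snd (prod_decode m)))"

text \<open>All edges arrived by time t, processed in order of arrival, with their levels.\<close>
definition labelled_edges :: "nat \<Rightarrow> sample \<Rightarrow> real \<Rightarrow> (edge \<times> nat) list" where
  "labelled_edges n \<omega> t =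
     foldl add_edge [] (sort_key (arrival n \<omega>) (map edge_decode (sorted_list_of_set (edge_code ` edges_upto n \<omega> t))))"

text \<open>Edge relation of G_k(t).\<close>
definition G_rel :: "nat \<Rightarrow> sample \<Rightarrow> real \<Rightarrow> nat \<Rightarrow> (nat \<times> nat) set" where
  "G_rel n \<omega> t k = level_rel (labelled_edges n \<omega> t) k"

text \<open>Number of vertices of the largest component of the graph on {0..<n} with edge relation R.\<close>
definition C1 :: "nat \<Rightarrow> (nat \<times> nat) set \<Rightarrow> nat" where
  "C1 n R = Max ((\<lambda>v. card {w. w < n \<and> (v, w) \<in> R\<^sup>*}) ` {..<n})"

text \<open>C_1(G_k(t))/n \<longrightarrow> f(t) in probability, uniformly in t \<ge> 0 (outer-probability form).\<close>
definition conv_unif_prob :: "nat \<Rightarrow> (real \<Rightarrow> real) \<Rightarrow> bool" where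
  "conv_unif_prob k f \<longleftrightarrow>
     (\<forall>\<epsilon>>0. \<forall>\<delta>>0. \<exists>N. \<forall>n\<ge>N. \<exists>A\<in>sets Omega. measure Omega A < \<delta> \<and>
        {\<omega>\<in>space Omega. \<exists>t\<ge>0. \<bar>real (C1 n (G_rel n \<omega> t k)) / real n - f t\<bar> > \<epsilon>} \<subseteq> A)"

end

theory Submission
  imports Defs
begin

text \<open>
  An edge crossing between two vertex sets that are connected in \<open>G\<^sub>k\<close> joins them in the level that
  it receives, so consecutive crossing edges receive strictly increasing levels until the sets are
  joined in \<open>G\<^sub>k\<close>; on the other hand a vertex of degree \<open>d\<close> in \<open>G\<^sub>1\<close> is isolated in \<open>G\<^sub>j\<close> for \<open>j > d\<close>.

  Strictness: let \<open>s < t\<close> with \<open>\<rho>\<^sub>k(s) > 0\<close>. With probability bounded below, a vertex has exactly \<open>k\<close>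
  edges at time \<open>t\<close>, all of them arriving after \<open>s\<close> and leading to the giant component of \<open>G\<^sub>k(s)\<close>.
  Such a vertex is isolated in \<open>G\<^sub>k\<^sub>+\<^sub>1(t)\<close> but belongs to the giant component of \<open>G\<^sub>k(t)\<close>. The latter
  needs uniqueness of the giant: two components of linear size at time \<open>t\<close> merge before any later
  time \<open>t'\<close> (only boundedly many edges can arrive between vertices of components that stay apart,
  so the expected number of such pairs of vertices is \<open>O(n)\<close>, not quadratic), which would make \<open>\<rho>\<^sub>k\<close> jump at \<open>t\<close>.

  Thresholds: put \<open>a = \<sigma>\<^sub>k\<close> and \<open>t < a + 1\<close>. At time \<open>a\<close> all components of \<open>G\<^sub>k\<close> are sublinear, so only
  \<open>o(n)\<close> edges of \<open>G\<^sub>k\<^sub>+\<^sub>1\<close> have arrived. The later edges form a subcritical random graph with mean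
  degree below \<open>t - a < 1\<close>, and adding \<open>o(n)\<close> arbitrary edges to it creates no linear component.

  Independence enters by resampling: the process without a given pair (or vertex) is independent of
  the clocks of that pair (or vertex).
\<close>

subsection \<open>Levels of a sequence of edges\<close>

text \<open>Deleting an edge may change the levels of all later edges. The killed graph is therefore
  compared with the true one in two situations: when the deleted pairs have no arrival by the time
  considered, so that nothing is deleted, and on the prefix before a single arrival, which deletion
  leaves intact. The second suffices because the prefix alone determines the level of the arriving
  edge.

  The O(n) bound in the uniqueness argument is a double count. Whether a pair stays apart when its
  own clocks are ignored is independent of whether it receives a single arrival, which has
  probability of order 1/n. Yet in a good sample at most k / d^2 pairs with large components do
  both: each of the at most 1 / d^2 ordered pairs of components with at least d n vertices sees each
  level from 1 to k at most once. Two giants kept apart would need at least d^2 n^2 / 2 such pairs.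

  Each claim on the limits is refuted at one sample outside finitely many bad events of total
  probability below 1. In the strictness part the favourable event is only known to have probability
  at least c / 2, so the errors there are taken small compared with c.\<close>

definition epair :: "edge \<Rightarrow> nat \<times> nat" where
  "epair x = (fst x, fst (snd x))"

definition lab :: "edge list \<Rightarrow> (edge \<times> nat) list" where
  "lab es = foldl add_edge [] es"

lemma lab_Nil [simp]: "lab [] = []"
  by (simp add: lab_def)

lemma lab_snoc: "lab (es @ [x]) = lab es @ [(x, new_level (lab es) x)]"
  by (simp add: lab_def add_edge_def)

lemma map_fst_lab [simp]: "map fst (lab es) = es"
  by (induction es rule: rev_induct) (auto simp: lab_snoc)

lemma lab_append_mono: "set (lab es) \<subseteq> set (lab (es @ fs))"
proof (induction fs rule: rev_induct)
  case (snoc x xs)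
  then show ?case
    using lab_snoc[of "es @ xs" x] by auto
qed simp

lemma lab_split: "(x, new_level (lab pre) x) \<in> set (lab (pre @ x # post))"
  using lab_append_mono[of "pre @ [x]" post] by (simp add: lab_snoc)

lemma level_rel_iff:
  "(a, b) \<in> level_rel L k \<longleftrightarrow> (\<exists>x l. (x, l) \<in> set L \<and> k \<le> l \<and> (epair x = (a, b) \<or> epair x = (b, a)))"
  by (auto simp: level_rel_def epair_def)

lemma level_relI:
  assumes "(x, l) \<in> set L" "k \<le> l"
  shows "(fst x, fst (snd x)) \<in> level_rel L k" "(fst (snd x), fst x) \<in> level_rel L k"
  using assms unfolding level_rel_iff epair_def by blast+

lemma level_rel_mono: "set L \<subseteq> set M \<Longrightarrow> j \<le> k \<Longrightarrow> level_rel L k \<subseteq> level_rel M j"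
  by (meson level_rel_iff order_trans subrelI subsetD)

lemma sym_level_rel: "sym (level_rel L k)"
  by (auto simp: sym_def level_rel_iff)

lemma rtrancl_level_sym: "(a, b) \<in> (level_rel L k)\<^sup>* \<Longrightarrow> (b, a) \<in> (level_rel L k)\<^sup>*"
  by (meson sym_level_rel sym_rtrancl symE)

lemma level_rel_lab_mono: "level_rel (lab es) k \<subseteq> level_rel (lab (es @ fs)) k"
  by (intro level_rel_mono lab_append_mono) simp

lemma rtrancl_level_lab_mono:
  "(a, b) \<in> (level_rel (lab es) k)\<^sup>* \<Longrightarrow> j \<le> k \<Longrightarrow> (a, b) \<in> (level_rel (lab (es @ fs)) j)\<^sup>*"
  using rtrancl_mono[OF level_rel_mono[OF lab_append_mono]] by blast

lemma new_level_exists: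
  assumes "fst x \<noteq> fst (snd x)"
  shows "\<exists>k\<ge>1. epair x \<notin> (level_rel L k)\<^sup>*"
proof -
  \<comment> \<open>Exceeds every label, so no edge survives at this level and the reflexive closure
    relates only equal vertices.\<close>
  define k where "k = Suc (sum_list (map snd L))"
  have "l < k" if "(y, l) \<in> set L" for y l
    using member_le_sum_list[of l "map snd L"] that by (force simp: k_def)
  then have "level_rel L k = {}"
    by (force simp: level_rel_def)
  then show ?thesis
    using assms by (intro exI[of _ k]) (auto simp: epair_def k_def)
qed

lemma new_level_notin:
  assumes "fst x \<noteq> fst (snd x)"
  shows "1 \<le> new_level L x" "epair x \<notin> (level_rel L (new_level L x))\<^sup>*"
proof -
  obtain k where k: "1 \<le> k \<and> epair x \<notin> (level_rel L k)\<^sup>*"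
    using new_level_exists[OF assms] by blast
  have "1 \<le> new_level L x \<and> epair x \<notin> (level_rel L (new_level L x))\<^sup>*"
    using LeastI[where P = "\<lambda>k. 1 \<le> k \<and> epair x \<notin> (level_rel L k)\<^sup>*", OF k]
    by (simp add: new_level_def epair_def)
  then show "1 \<le> new_level L x" "epair x \<notin> (level_rel L (new_level L x))\<^sup>*"
    by auto
qed

text \<open>The graphs shrink as the level grows, so connectivity holds below the
  \<open>LEAST\<close> level and fails from there on. This replaces the \<open>LEAST\<close> by a
  test at one level.\<close>

lemma less_new_level_iff:
  assumes "fst x \<noteq> fst (snd x)" "1 \<le> j"
  shows "j < new_level L x \<longleftrightarrow> epair x \<in> (level_rel L j)\<^sup>*"
proof
  assume "j < new_level L x"
  then show "epair x \<in> (level_rel L j)\<^sup>*"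
    using not_less_Least[of j "\<lambda>k. 1 \<le> k \<and> epair x \<notin> (level_rel L k)\<^sup>*"] assms(2)
    by (simp add: new_level_def epair_def)
next
  assume *: "epair x \<in> (level_rel L j)\<^sup>*"
  show "j < new_level L x"
  proof (rule ccontr)
    assume "\<not> ?thesis"
    then have "level_rel L j \<subseteq> level_rel L (new_level L x)"
      by (intro level_rel_mono) auto
    then show False
      using * new_level_notin(2)[OF assms(1), of L] rtrancl_mono by blast
  qed
qed

text \<open>Having level \<open>l\<close>, the edge \<open>x\<close> joins its own end points in
  level \<open>l\<close>; the two side connections carry this over to the end points of
  \<open>y\<close>.\<close>

lemma crossing_level_less:
  assumes "fst y \<noteq> fst (snd y)" "(x, l) \<in> set (lab es)" "1 \<le> l"
    and "(fst x, fst y) \<in> (level_rel (lab es) l)\<^sup>*"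
    and "(fst (snd x), fst (snd y)) \<in> (level_rel (lab es) l)\<^sup>*"
  shows "l < new_level (lab es) y"
proof -
  have "(fst x, fst (snd x)) \<in> (level_rel (lab es) l)\<^sup>*"
    using assms(2) level_relI by blast
  then have "epair y \<in> (level_rel (lab es) l)\<^sup>*"
    using assms(4,5) unfolding epair_def by (meson rtrancl_level_sym rtrancl_trans)
  then show ?thesis
    using less_new_level_iff assms by blast
qed

definition crossing :: "nat set \<Rightarrow> nat set \<Rightarrow> edge \<Rightarrow> bool" where
  "crossing A B x \<longleftrightarrow> fst x \<in> A \<and> fst (snd x) \<in> B \<or> fst x \<in> B \<and> fst (snd x) \<in> A"

text \<open>Once an edge of level \<open>j \<le> k\<close> crosses between two vertex sets that are connected in \<open>G\<^sub>k\<close>,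
  these sets are joined in \<open>G\<^sub>j\<close>, so that the next crossing edge has a larger level.\<close>

lemma crossing_level_ge:
  assumes A: "\<And>a a'. a \<in> A \<Longrightarrow> a' \<in> A \<Longrightarrow> (a, a') \<in> (level_rel (lab base) k)\<^sup>*"
    and B: "\<And>b b'. b \<in> B \<Longrightarrow> b' \<in> B \<Longrightarrow> (b, b') \<in> (level_rel (lab base) k)\<^sup>*"
    and "\<forall>x\<in>set rest. fst x \<noteq> fst (snd x)"
    and "1 \<le> j" "j \<le> k" "j \<le> length (filter (crossing A B) rest)"
  shows "\<exists>x l. (x, l) \<in> set (lab (base @ rest)) \<and> crossing A B x \<and> j \<le> l"
  using assms(3-6)
proof (induction rest arbitrary: j rule: rev_induct)
  case (snoc y ys)
  let ?L = "lab (base @ ys)"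
  have lab: "lab (base @ ys @ [y]) = ?L @ [(y, new_level ?L y)]"
    using lab_snoc[of "base @ ys" y] by simp
  show ?case
  proof (cases "j \<le> length (filter (crossing A B) ys)")
    case True
    then obtain x l where "(x, l) \<in> set ?L" "crossing A B x" "j \<le> l"
      using snoc.IH[of j] snoc.prems by auto
    then show ?thesis
      using lab by (metis Un_iff set_append)
  next
    case False
    then have y: "crossing A B y" and j: "j = Suc (length (filter (crossing A B) ys))"
      using snoc.prems by (auto split: if_splits)
    have ne: "fst y \<noteq> fst (snd y)"
      using snoc.prems by simp
    have "j \<le> new_level ?L y"
    proof (cases "j = 1")
      case True
      then show ?thesis using new_level_notin(1)[OF ne] by simp
    next
      case False
      \<comment> \<open>The induction hypothesis at \<open>j - 1\<close> supplies an earlier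
        crossing edge that joins \<open>A\<close> and \<open>B\<close> in level
        \<open>j - 1\<close>; this pushes \<open>y\<close> past that level.\<close>
      define i where "i = j - 1"
      have i: "1 \<le> i" "i \<le> k" "i \<le> length (filter (crossing A B) ys)" "j = Suc i"
        using False snoc.prems(2,3) j unfolding i_def by linarith+
      then obtain x l where x: "(x, l) \<in> set ?L" "crossing A B x" "i \<le> l"
        using snoc.IH[of i] snoc.prems by auto
      have AB: "(c, d) \<in> (level_rel ?L i)\<^sup>*" if "c \<in> A \<and> d \<in> A \<or> c \<in> B \<and> d \<in> B" for c d
        using that A B rtrancl_level_lab_mono i(2) by blast
      have "(fst x, fst (snd x)) \<in> (level_rel ?L i)\<^sup>*" "(fst (snd x), fst x) \<in> (level_rel ?L i)\<^sup>*"
        using x level_relI by blast+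
      then have "(fst y, fst (snd y)) \<in> (level_rel ?L i)\<^sup>*"
        using x(2) y AB unfolding crossing_def by (meson rtrancl_trans)
      then show ?thesis
        using less_new_level_iff[OF ne i(1), of ?L] i(4) by (simp add: epair_def)
    qed
    then show ?thesis
      using lab y by (metis UnI2 list.set_intros(1) set_append)
  qed
qed simp

text \<open>After \<open>k\<close> crossings some crossing edge has reached level \<open>k\<close>
  and hence lies in G_k. With \<open>A\<close> a single vertex this attaches a vertex of degree
  \<open>k\<close> to the giant.\<close>

lemma crossing_connected:
  assumes A: "\<And>a a'. a \<in> A \<Longrightarrow> a' \<in> A \<Longrightarrow> (a, a') \<in> (level_rel (lab base) k)\<^sup>*"
    and B: "\<And>b b'. b \<in> B \<Longrightarrow> b' \<in> B \<Longrightarrow> (b, b') \<in> (level_rel (lab base) k)\<^sup>*"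
    and "\<forall>x\<in>set rest. fst x \<noteq> fst (snd x)"
    and "1 \<le> k" "k \<le> length (filter (crossing A B) rest)"
    and "a \<in> A" "b \<in> B"
  shows "(a, b) \<in> (level_rel (lab (base @ rest)) k)\<^sup>*"
proof -
  let ?R = "level_rel (lab (base @ rest)) k"
  obtain x l where x: "(x, l) \<in> set (lab (base @ rest))" "crossing A B x" "k \<le> l"
    using crossing_level_ge[of A base k B rest k] assms by blast
  then have "(fst x, fst (snd x)) \<in> ?R\<^sup>*" "(fst (snd x), fst x) \<in> ?R\<^sup>*"
    using level_relI by blast+
  moreover have "(c, d) \<in> ?R\<^sup>*" if "c \<in> A \<and> d \<in> A \<or> c \<in> B \<and> d \<in> B" for c d
    using that A B rtrancl_level_lab_mono by blast
  ultimately show ?thesis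
    using x(2) assms(6,7) unfolding crossing_def by (meson rtrancl_trans)
qed

definition incident :: "nat \<Rightarrow> edge \<Rightarrow> bool" where
  "incident v x \<longleftrightarrow> fst x = v \<or> fst (snd x) = v"

lemma isolated_rtrancl:
  assumes "\<And>w. (v, w) \<notin> R" "(v, w) \<in> R\<^sup>*"
  shows "w = v"
  using assms(2,1) by (metis converse_rtranclE)

text \<open>Before the next edge at \<open>v\<close> arrives, the levels at \<open>v\<close> are at
  most its degree \<open>d\<close> so far. Hence \<open>v\<close> is isolated in level
  \<open>d + 1\<close>, and the new edge cannot get beyond that level.\<close>

lemma level_le_degree:
  assumes "\<forall>x\<in>set es. fst x \<noteq> fst (snd x)" "(x, l) \<in> set (lab es)" "incident v x"
  shows "l \<le> length (filter (incident v) es)"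
  using assms
proof (induction es arbitrary: x l rule: rev_induct)
  case (snoc y ys)
  let ?d = "length (filter (incident v) ys)"
  have IH: "l \<le> ?d" if "(x, l) \<in> set (lab ys)" "incident v x" for x l
    using snoc.IH[of x l] that snoc.prems(1) by simp
  show ?case
  proof (cases "(x, l) \<in> set (lab ys)")
    case True
    then show ?thesis using IH[OF True snoc.prems(3)] by simp
  next
    case False
    then have xl: "x = y" "l = new_level (lab ys) y"
      using snoc.prems(2) by (auto simp: lab_snoc)
    have ne: "fst y \<noteq> fst (snd y)"
      using snoc.prems by simp
    have iso: "(v, w) \<notin> level_rel (lab ys) (Suc ?d)" for w
    proof
      assume "(v, w) \<in> level_rel (lab ys) (Suc ?d)"
      then obtain x l where "(x, l) \<in> set (lab ys)" "Suc ?d \<le> l" "incident v x"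
        by (auto simp: level_rel_iff incident_def epair_def)
      then show False
        using IH by fastforce
    qed
    have "epair y \<notin> (level_rel (lab ys) (Suc ?d))\<^sup>*"
    proof
      assume "epair y \<in> (level_rel (lab ys) (Suc ?d))\<^sup>*"
      then have "(fst y, fst (snd y)) \<in> (level_rel (lab ys) (Suc ?d))\<^sup>*"
        "(fst (snd y), fst y) \<in> (level_rel (lab ys) (Suc ?d))\<^sup>*"
        using rtrancl_level_sym by (auto simp: epair_def)
      moreover have "v = fst y \<or> v = fst (snd y)"
        using snoc.prems(3) xl by (auto simp: incident_def)
      ultimately show False
        using isolated_rtrancl[OF iso, of "fst y"] isolated_rtrancl[OF iso, of "fst (snd y)"] ne by auto
    qed
    then have "l \<le> Suc ?d"
      using less_new_level_iff[OF ne, of "Suc ?d" "lab ys"] xl by simp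
    then show ?thesis using snoc.prems(3) xl by simp
  qed
qed simp

lemma isolated_above_degree:
  assumes "\<forall>x\<in>set es. fst x \<noteq> fst (snd x)" "length (filter (incident v) es) < k"
  shows "(v, w) \<notin> level_rel (lab es) k"
proof
  assume "(v, w) \<in> level_rel (lab es) k"
  then obtain x l where "(x, l) \<in> set (lab es)" "k \<le> l" "incident v x"
    by (auto simp: level_rel_iff incident_def epair_def)
  then show False
    using level_le_degree[OF assms(1)] assms(2) by fastforce
qed

subsection \<open>Arrival order and deletion of pairs\<close>

definition elist :: "nat \<Rightarrow> sample \<Rightarrow> real \<Rightarrow> edge list" where
  "elist n \<omega> t = sort_key (arrival n \<omega>)
     (map edge_decode (sorted_list_of_set (edge_code ` edges_upto n \<omega> t)))"

lemma G_rel_eq: "G_rel n \<omega> t k = level_rel (lab (elist n \<omega> t)) k"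
  by (simp add: G_rel_def labelled_edges_def elist_def lab_def)

lemma edge_decode_code [simp]: "edge_decode (edge_code x) = x"
  by (simp add: edge_decode_def edge_code_def)

lemma inj_edge_code: "inj edge_code"
  by (metis edge_decode_code injI)

text \<open>Outside this almost sure event, \<open>edges_upto\<close> may be infinite, in which case \<open>labelled_edges\<close> is
  the junk value \<open>[]\<close>.\<close>

definition good :: "sample \<Rightarrow> bool" where
  "good \<omega> \<longleftrightarrow> (\<forall>e. 0 < \<omega> e) \<and> (\<forall>u v. \<forall>c::nat. \<exists>j. real c < (\<Sum>i\<le>j. \<omega> (u, v, i)))"

lemma good_pos: "good \<omega> \<Longrightarrow> 0 < \<omega> e"
  unfolding good_def by blast

text \<open>Setting the clocks of the pairs in \<open>P\<close> to a large constant removes these pairs from the graph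
  while keeping the vertex set.\<close>

definition kill :: "real \<Rightarrow> (nat \<times> nat) set \<Rightarrow> sample \<Rightarrow> sample" where
  "kill b P \<omega> = (\<lambda>e. if epair e \<in> P then b else \<omega> e)"

lemma epair_simp [simp]: "epair (u, v, j) = (u, v)"
  by (simp add: epair_def)

lemma arrival_mono:
  assumes "\<And>e. 0 < \<omega> e" "i \<le> j"
  shows "arrival n \<omega> (u, v, i) \<le> arrival n \<omega> (u, v, j)"
  unfolding arrival_def using assms
  by (auto intro!: mult_left_mono sum_mono2 simp: less_imp_le)

lemma arrival_0: "arrival n \<omega> (u, v, 0) = real n * \<omega> (u, v, 0)"
  by (simp add: arrival_def)

lemma arrival_1: "arrival n \<omega> (u, v, Suc 0) = real n * (\<omega> (u, v, 0) + \<omega> (u, v, Suc 0))"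
  by (simp add: arrival_def)

lemma finite_edges_upto:
  assumes "good \<omega>"
  shows "finite (edges_upto n \<omega> t)"
proof (cases "n = 0")
  case False
  have pos: "\<And>e. 0 < \<omega> e" using assms by (rule good_pos)
  obtain c :: nat where c: "t / real n \<le> real c"
    using real_arch_simple by blast
  have "\<forall>u v. \<exists>j. real c < (\<Sum>i\<le>j. \<omega> (u, v, i))"
    using assms unfolding good_def by blast
  then obtain J where J: "\<And>u v. real c < (\<Sum>i\<le>J u v. \<omega> (u, v, i))"
    by metis
  have "edges_upto n \<omega> t \<subseteq> (\<Union>u<n. \<Union>v<n. \<Union>j<J u v. {(u, v, j)})"
  proof
    fix x assume x: "x \<in> edges_upto n \<omega> t"
    obtain u v j where xe: "x = (u, v, j)" by (cases x) auto
    have "j < J u v"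
    proof (rule ccontr)
      assume "\<not> j < J u v"
      then have "arrival n \<omega> (u, v, J u v) \<le> arrival n \<omega> x"
        unfolding xe by (intro arrival_mono pos) simp
      moreover have "t < arrival n \<omega> (u, v, J u v)"
      proof -
        have "t / real n < (\<Sum>i\<le>J u v. \<omega> (u, v, i))"
          using J[of u v] c by linarith
        then show ?thesis
          using False by (simp add: arrival_def field_simps)
      qed
      ultimately show False
        using x by (simp add: edges_upto_def)
    qed
    then show "x \<in> (\<Union>u<n. \<Union>v<n. \<Union>j<J u v. {(u, v, j)})"
      using x xe by (auto simp: edges_upto_def)
  qed
  then show ?thesis
    by (rule finite_subset) auto
qed (simp add: edges_upto_def)

lemma
  assumes "finite (edges_upto n \<omega> t)"
  shows set_elist: "set (elist n \<omega> t) = edges_upto n \<omega> t"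
    and distinct_elist: "distinct (elist n \<omega> t)"
proof -
  show "set (elist n \<omega> t) = edges_upto n \<omega> t"
    using assms by (simp add: elist_def image_image)
  show "distinct (elist n \<omega> t)"
    using assms by (simp add: elist_def distinct_map) (auto intro!: inj_onI)
qed

lemma elist_infinite: "infinite (edges_upto n \<omega> t) \<Longrightarrow> elist n \<omega> t = []"
  using finite_image_iff[OF inj_on_subset[OF inj_edge_code], of "edges_upto n \<omega> t"]
  by (simp add: elist_def)

lemma sorted_elist: "sorted (map (arrival n \<omega>) (elist n \<omega> t))"
  by (simp add: elist_def)

lemma set_elist_subset: "set (elist n \<omega> t) \<subseteq> edges_upto n \<omega> t"
  by (cases "finite (edges_upto n \<omega> t)") (auto simp: set_elist elist_infinite)

lemma elist_ends:
  "x \<in> set (elist n \<omega> t) \<Longrightarrow> fst x < fst (snd x) \<and> fst (snd x) < n"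
  using set_elist_subset by (fastforce simp: edges_upto_def)

lemma elist_ne: "\<forall>x\<in>set (elist n \<omega> t). fst x \<noteq> fst (snd x)"
  using elist_ends by fastforce

lemma sort_key_cong_on:
  fixes f g :: "'a \<Rightarrow> 'b::linorder"
  assumes "\<And>x. x \<in> set xs \<Longrightarrow> f x = g x"
  shows "sort_key f xs = sort_key g xs"
proof -
  have ins: "insort_key f x ys = insort_key g x ys" if "\<forall>y\<in>insert x (set ys). f y = g y" for x ys
    using that by (induction ys) auto
  show ?thesis
    using assms by (induction xs) (auto intro!: ins)
qed

text \<open>Simultaneous arrivals cause no trouble: \<open>sort_key\<close> is stable and both lists
  start from the order of the codes, so ties are resolved alike.\<close>

lemma elist_filter:
  assumes fin: "finite (edges_upto n \<omega> t)"
    and sub: "edges_upto n \<omega>' s = {x \<in> edges_upto n \<omega> t. Q x}"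
    and eq: "\<And>x. x \<in> edges_upto n \<omega>' s \<Longrightarrow> arrival n \<omega>' x = arrival n \<omega> x"
  shows "elist n \<omega>' s = filter Q (elist n \<omega> t)"
proof -
  let ?E = "edges_upto n \<omega> t" and ?E' = "edges_upto n \<omega>' s"
  have fin': "finite ?E'" using fin sub by simp
  have "sorted_list_of_set (edge_code ` ?E') =
    filter (\<lambda>m. Q (edge_decode m)) (sorted_list_of_set (edge_code ` ?E))"
  proof (rule sorted_distinct_set_unique)
    show "sorted (filter (\<lambda>m. Q (edge_decode m)) (sorted_list_of_set (edge_code ` ?E)))"
      using sorted_filter[of "\<lambda>x. x" "sorted_list_of_set (edge_code ` ?E)"] by simp
    show "set (sorted_list_of_set (edge_code ` ?E')) =
      set (filter (\<lambda>m. Q (edge_decode m)) (sorted_list_of_set (edge_code ` ?E)))"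
      using fin fin' by (auto simp: sub)
  qed auto
  then have map: "map edge_decode (sorted_list_of_set (edge_code ` ?E')) =
    filter Q (map edge_decode (sorted_list_of_set (edge_code ` ?E)))"
    by (simp add: filter_map o_def)
  have set: "set (map edge_decode (sorted_list_of_set (edge_code ` ?E'))) = ?E'"
    using fin' by (simp add: image_image)
  have "elist n \<omega>' s = sort_key (arrival n \<omega>) (map edge_decode (sorted_list_of_set (edge_code ` ?E')))"
    unfolding elist_def using set eq by (intro sort_key_cong_on) auto
  then show ?thesis
    unfolding map elist_def filter_sort by simp
qed

lemma elist_prefix:
  assumes "good \<omega>" "s \<le> t"
  obtains rest where "elist n \<omega> t = elist n \<omega> s @ rest" "\<And>x. x \<in> set rest \<Longrightarrow> s < arrival n \<omega> x"
proof -
  let ?P = "\<lambda>x. arrival n \<omega> x \<le> s"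
  have eq: "elist n \<omega> s = filter ?P (elist n \<omega> t)"
    using assms by (intro elist_filter finite_edges_upto) (auto simp: edges_upto_def)
  have "\<forall>x\<in>set (dropWhile ?P xs). s < arrival n \<omega> x"
    if "sorted (map (arrival n \<omega>) xs)" for xs
    using that by (induction xs) auto
  then have late: "\<And>x. x \<in> set (dropWhile ?P (elist n \<omega> t)) \<Longrightarrow> s < arrival n \<omega> x"
    using sorted_elist by blast
  then have "takeWhile ?P (elist n \<omega> t) = elist n \<omega> s"
    unfolding eq by (intro takeWhile_eq_filter) (simp add: not_le)
  then show thesis
    using that[of "dropWhile ?P (elist n \<omega> t)"] late takeWhile_dropWhile_id[of ?P "elist n \<omega> t"] by simp
qed

section \<open>Effect of killing pairs on the arrival list and the graphs\<close>

lemma arrival_kill: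
  "arrival n (kill b P \<omega>) x =
    (if epair x \<in> P then real n * (real (Suc (snd (snd x))) * b) else arrival n \<omega> x)"
  by (simp add: arrival_def kill_def epair_def)

text \<open>A killed pair has its arrival with index \<open>j\<close> at time
  \<open>n (j + 1) b\<close>, which is beyond \<open>t\<close> already for
  \<open>j = 0\<close>.\<close>

lemma edges_upto_kill:
  assumes "0 < b" "t < real n * b"
  shows "edges_upto n (kill b P \<omega>) t = {x \<in> edges_upto n \<omega> t. epair x \<notin> P}"
proof -
  have "t < real n * (real (Suc j) * b)" for j
  proof -
    have "real n * b \<le> real n * (real (Suc j) * b)"
      using assms(1) by (intro mult_left_mono) auto
    then show ?thesis using assms(2) by linarith
  qed
  then show ?thesis
    by (auto simp: edges_upto_def arrival_kill not_le[symmetric] simp del: of_nat_Suc split: if_splits)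
qed

lemma elist_kill:
  assumes "good \<omega>" "0 < b" "t < real n * b"
  shows "elist n (kill b P \<omega>) t = filter (\<lambda>x. epair x \<notin> P) (elist n \<omega> t)"
  using assms edges_upto_kill[OF assms(2,3)]
  by (intro elist_filter finite_edges_upto) (auto simp: arrival_kill)

text \<open>With no arrival by time \<open>t\<close> on the pairs in \<open>P\<close> there is
  nothing to delete. This carries events of the killed sample, which are independent of the clocks
  of \<open>P\<close>, back to the true sample.\<close>

lemma G_rel_kill_eq:
  assumes "good \<omega>" "0 < b" "t < real n * b"
    and "\<And>u v. (u, v) \<in> P \<Longrightarrow> u < v \<Longrightarrow> v < n \<Longrightarrow> t < real n * \<omega> (u, v, 0)"
  shows "G_rel n (kill b P \<omega>) t k = G_rel n \<omega> t k"
proof -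
  have "epair x \<notin> P" if x: "x \<in> edges_upto n \<omega> t" for x
  proof
    assume P: "epair x \<in> P"
    obtain u v j where xe: "x = (u, v, j)" by (cases x) auto
    have "arrival n \<omega> (u, v, 0) \<le> arrival n \<omega> x"
      unfolding xe using assms(1) by (intro arrival_mono good_pos) auto
    then show False
      using assms(4)[of u v] P x xe by (auto simp: edges_upto_def arrival_0)
  qed
  then have "filter (\<lambda>x. epair x \<notin> P) (elist n \<omega> t) = elist n \<omega> t"
    using set_elist_subset by (intro filter_True) blast
  then show ?thesis
    by (simp add: G_rel_eq elist_kill[OF assms(1-3)])
qed

text \<open>The pair contributes one edge by time \<open>t\<close>, so killing it removes one entry
  and keeps \<open>pre\<close>. Levels in \<open>post\<close> may change; later arguments compare
  labels on \<open>pre\<close>.\<close>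

lemma elist_split_single:
  assumes g: "good \<omega>" and b: "0 < b" "t < real n * b" and uv: "u < v" "v < n"
    and a0: "arrival n \<omega> (u, v, 0) \<le> t" and a1: "t < arrival n \<omega> (u, v, Suc 0)"
  obtains pre post where "elist n \<omega> t = pre @ (u, v, 0) # post"
    "elist n (kill b {(u, v)} \<omega>) t = pre @ post"
proof -
  let ?x = "(u, v, 0)"
  have "?x \<in> set (elist n \<omega> t)"
    using set_elist[OF finite_edges_upto[OF g]] uv a0 by (simp add: edges_upto_def)
  then obtain pre post where split: "elist n \<omega> t = pre @ ?x # post"
    by (meson split_list)
  have only: "x = ?x" if x: "x \<in> set (elist n \<omega> t)" "epair x = (u, v)" for x
  proof -
    obtain j where j: "x = (u, v, j)" using x(2) by (cases x) auto
    have "j < Suc 0"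
    proof (rule ccontr)
      assume "\<not> j < Suc 0"
      then have "arrival n \<omega> (u, v, Suc 0) \<le> arrival n \<omega> x"
        unfolding j using g by (intro arrival_mono good_pos) auto
      moreover have "arrival n \<omega> x \<le> t"
        using x(1) set_elist_subset by (fastforce simp: edges_upto_def)
      ultimately show False using a1 by simp
    qed
    then show ?thesis using j by simp
  qed
  have "?x \<notin> set pre \<union> set post"
    using distinct_elist[OF finite_edges_upto[OF g], of n t] split by auto
  then have ne: "epair x \<noteq> (u, v)" if "x \<in> set pre \<union> set post" for x
    using only[of x] that split by auto
  then have "filter (\<lambda>x. epair x \<notin> {(u, v)}) (elist n \<omega> t) = pre @ post"
    unfolding split by (simp add: filter_id_conv)
  then show thesis
    using that[OF split] elist_kill[OF g b] by simp
qed

lemma G_rel_mono_time: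
  assumes "good \<omega>" "s \<le> t"
  shows "G_rel n \<omega> s k \<subseteq> G_rel n \<omega> t k"
proof -
  obtain rest where "elist n \<omega> t = elist n \<omega> s @ rest"
    using elist_prefix[OF assms] by blast
  then show ?thesis
    by (metis G_rel_eq level_rel_lab_mono)
qed

lemma G_rel_antimono_level: "j \<le> k \<Longrightarrow> G_rel n \<omega> t k \<subseteq> G_rel n \<omega> t j"
  unfolding G_rel_eq by (intro level_rel_mono) auto

lemma sym_G_rel: "sym (G_rel n \<omega> t k)"
  by (simp add: G_rel_eq sym_level_rel)

subsection \<open>The probability space\<close>

lemma prob_space_Omega: "prob_space Omega"
  unfolding Omega_def by (intro prob_space_PiM prob_space_exponential_density) simp

interpretation Om: prob_space Omega
  by (rule prob_space_Omega)

lemma space_Omega [simp]: "space Omega = UNIV"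
  by (simp add: Omega_def space_PiM)

lemma coord_measurable [measurable]: "(\<lambda>\<omega>. \<omega> e) \<in> borel_measurable Omega"
proof -
  have "(\<lambda>\<omega>. \<omega> e) \<in> measurable Omega (density lborel (exponential_density 1))"
    unfolding Omega_def by (rule measurable_component_singleton) simp
  then show ?thesis by simp
qed

lemma measurable_OmegaI:
  assumes "\<And>e. (\<lambda>x. f x e) \<in> borel_measurable M"
  shows "f \<in> measurable M Omega"
  unfolding Omega_def
  using measurable_PiM_single'[of UNIV "\<lambda>e x. f x e" M "\<lambda>_. density lborel (exponential_density 1)"] assms
  by simp

lemma kill_measurable [measurable]: "kill b P \<in> measurable Omega Omega"
  by (rule measurable_OmegaI) (simp add: kill_def)

lemma arrival_measurable [measurable]: "(\<lambda>\<omega>. arrival n \<omega> x) \<in> borel_measurable Omega"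
  unfolding arrival_def by measurable

section \<open>Measurability of the labelled graph\<close>

lemma measurable_sort_key:
  fixes f :: "'a \<Rightarrow> 'b::countable \<Rightarrow> real"
  assumes [measurable]: "\<And>x. (\<lambda>\<omega>. f \<omega> x) \<in> borel_measurable M"
  shows "(\<lambda>\<omega>. sort_key (f \<omega>) xs) \<in> measurable M (count_space UNIV)"
proof (induction xs)
  case (Cons x xs)
  have ins: "(\<lambda>\<omega>. insort_key (f \<omega>) x ys) \<in> measurable M (count_space UNIV)" for ys
  proof (induction ys)
    case (Cons y ys)
    have [measurable]: "(\<lambda>\<omega>. y # insort_key (f \<omega>) x ys) \<in> measurable M (count_space UNIV)"
      by (rule measurable_compose[OF Cons.IH]) simp
    show ?case by simp
  qed simp
  show ?case
    using measurable_compose_countable[OF ins Cons.IH] by simp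
qed simp

lemma measurable_sorted_list_of_set:
  fixes S :: "'a \<Rightarrow> nat set"
  assumes [measurable]: "\<And>m. Measurable.pred M (\<lambda>\<omega>. m \<in> S \<omega>)"
  shows "(\<lambda>\<omega>. sorted_list_of_set (S \<omega>)) \<in> measurable M (count_space UNIV)"
proof -
  have fin: "finite A \<longleftrightarrow> (\<exists>k. \<forall>m. m \<in> A \<longrightarrow> m \<le> k)" for A :: "nat set"
    by (simp add: finite_nat_set_iff_bounded_le Ball_def)
  \<comment> \<open>Only countable quantifiers occur on the right, which gives measurability. The
    \<open>else\<close> branch is the default value \<open>[]\<close> on infinite sets.\<close>
  have eq: "sorted_list_of_set A = l \<longleftrightarrow> (if \<exists>k. \<forall>m. m \<in> A \<longrightarrow> m \<le> k
      then (sorted l \<and> distinct l) \<and> (\<forall>m. m \<in> A \<longleftrightarrow> m \<in> set l) else l = [])" for A :: "nat set" and l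
  proof (cases "finite A")
    case True
    have "sorted_list_of_set A = l \<longleftrightarrow> sorted l \<and> distinct l \<and> A = set l"
      using sorted_distinct_set_unique[of "sorted_list_of_set A" l] True by auto
    then show ?thesis
      using True by (simp only: fin[symmetric] if_True set_eq_iff conj_assoc)
  next
    case False
    then have "sorted_list_of_set A = []"
      by simp
    then show ?thesis
      using False by (simp only: fin[symmetric] if_False) blast
  qed
  have "(\<lambda>\<omega>. sorted_list_of_set (S \<omega>)) -` {l} \<inter> space M \<in> sets M" for l
  proof -
    have "{\<omega> \<in> space M. sorted_list_of_set (S \<omega>) = l} \<in> sets M"
      unfolding eq by measurable
    moreover have "(\<lambda>\<omega>. sorted_list_of_set (S \<omega>)) -` {l} \<inter> space M =
        {\<omega> \<in> space M. sorted_list_of_set (S \<omega>) = l}" by auto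
    ultimately show ?thesis by simp
  qed
  then show ?thesis
    by (simp add: measurable_count_space_eq2_countable)
qed

lemma labelled_edges_measurable [measurable]:
  "(\<lambda>\<omega>. labelled_edges n \<omega> t) \<in> measurable Omega (count_space UNIV)"
proof -
  have mem: "m \<in> edge_code ` edges_upto n \<omega> t \<longleftrightarrow>
      edge_code (edge_decode m) = m \<and> fst (edge_decode m) < fst (snd (edge_decode m)) \<and>
      fst (snd (edge_decode m)) < n \<and> arrival n \<omega> (edge_decode m) \<le> t" for m \<omega>
  proof
    assume "m \<in> edge_code ` edges_upto n \<omega> t"
    then show "edge_code (edge_decode m) = m \<and> fst (edge_decode m) < fst (snd (edge_decode m)) \<and>
      fst (snd (edge_decode m)) < n \<and> arrival n \<omega> (edge_decode m) \<le> t"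
      by (auto simp: edges_upto_def)
  next
    assume "edge_code (edge_decode m) = m \<and> fst (edge_decode m) < fst (snd (edge_decode m)) \<and>
      fst (snd (edge_decode m)) < n \<and> arrival n \<omega> (edge_decode m) \<le> t"
    then show "m \<in> edge_code ` edges_upto n \<omega> t"
      unfolding edges_upto_def by (intro image_eqI[of _ _ "edge_decode m"]) auto
  qed
  have "(\<lambda>\<omega>. sorted_list_of_set (edge_code ` edges_upto n \<omega> t)) \<in> measurable Omega (count_space UNIV)"
    by (rule measurable_sorted_list_of_set) (unfold mem, measurable)
  then have "(\<lambda>\<omega>. sort_key (arrival n \<omega>)
      (map edge_decode (sorted_list_of_set (edge_code ` edges_upto n \<omega> t)))) \<in> measurable Omega (count_space UNIV)"
    by (rule measurable_compose_countable[rotated])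
       (intro measurable_sort_key arrival_measurable)
  then show ?thesis
    unfolding labelled_edges_def by (rule measurable_compose) simp
qed

text \<open>The labelled list is a random variable with values in a countable discrete space, so
  every property \<open>Q\<close> of the graph is measurable.\<close>

lemma G_rel_pred: "Measurable.pred Omega (\<lambda>\<omega>. Q (G_rel n \<omega> t k))"
proof -
  have "Measurable.pred Omega (\<lambda>\<omega>. (\<lambda>L. Q (level_rel L k)) (labelled_edges n \<omega> t))"
    by (rule measurable_compose[OF labelled_edges_measurable]) simp
  then show ?thesis by (simp add: G_rel_def)
qed

lemma G_rel_kill_pred: "Measurable.pred Omega (\<lambda>\<omega>. Q (G_rel n (kill b P \<omega>) t k))"
  using measurable_compose[OF kill_measurable G_rel_pred] by simp

lemma pred_Omega_sets: "Measurable.pred Omega Q \<Longrightarrow> {\<omega>. Q \<omega>} \<in> sets Omega"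
  by (simp add: pred_def)

text \<open>A pointwise form of being determined by the coordinates in \<open>K\<close>. Together
  with measurability on \<open>Omega\<close> it takes the place of sub-sigma-algebras in the
  independence lemmas.\<close>

definition depends_on :: "edge set \<Rightarrow> (sample \<Rightarrow> bool) \<Rightarrow> bool" where
  "depends_on K Q \<longleftrightarrow> (\<forall>\<omega> \<omega>'. (\<forall>e\<in>K. \<omega> e = \<omega>' e) \<longrightarrow> Q \<omega> = Q \<omega>')"

lemma indep_vars_coord: "Om.indep_vars (\<lambda>_. borel) (\<lambda>e \<omega>. \<omega> e) UNIV"
proof -
  have D: "distr Omega borel (\<lambda>\<omega>. \<omega> e) = density lborel (exponential_density 1)" for e
  proof -
    have "distr Omega (density lborel (exponential_density 1)) (\<lambda>\<omega>. \<omega> e) = density lborel (exponential_density 1)"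
      unfolding Omega_def by (rule distr_PiM_component) (auto intro: prob_space_exponential_density)
    moreover have "distr Omega borel (\<lambda>\<omega>. \<omega> e) = distr Omega (density lborel (exponential_density 1)) (\<lambda>\<omega>. \<omega> e)"
      by (rule distr_cong) auto
    ultimately show ?thesis by simp
  qed
  have "distr Omega (Pi\<^sub>M UNIV (\<lambda>_. borel)) (\<lambda>x. \<lambda>i\<in>UNIV. x i) = distr Omega Omega (\<lambda>x. x)"
  proof (rule distr_cong)
    show "sets (Pi\<^sub>M UNIV (\<lambda>_. borel)) = sets Omega"
      unfolding Omega_def by (rule sets_PiM_cong) auto
  qed auto
  also have "\<dots> = Omega" by (rule distr_id)
  also have "\<dots> = (\<Pi>\<^sub>M e\<in>UNIV. distr Omega borel (\<lambda>\<omega>. \<omega> e))"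
    unfolding D by (simp add: Omega_def)
  finally show ?thesis
    by (subst Om.indep_vars_iff_distr_eq_PiM) auto
qed

lemma prob_indep_blocks:
  assumes fin: "finite L" and disj: "disjoint_family_on K L"
    and meas: "\<And>j. j \<in> L \<Longrightarrow> Measurable.pred Omega (Q j)"
    and dep: "\<And>j. j \<in> L \<Longrightarrow> depends_on (K j) (Q j)"
  shows "Om.prob {\<omega>. \<forall>j\<in>L. Q j \<omega>} = (\<Prod>j\<in>L. Om.prob {\<omega>. Q j \<omega>})"
proof (cases "L = {}")
  case True
  then show ?thesis using Om.prob_space by simp
next
  case False
  let ?X = "\<lambda>j \<omega>. restrict (\<lambda>i. \<omega> i) (K j)"
  \<comment> \<open>Filling in 0 outside \<open>K j\<close> is an arbitrary choice, as
    \<open>Q j\<close> depends only on \<open>K j\<close>; it turns \<open>Q j\<close> into an event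
    of the restricted product space.\<close>
  let ?ext = "\<lambda>j \<eta> i. if i \<in> K j then \<eta> i else (0::real)"
  have ind: "Om.indep_vars (\<lambda>j. PiM (K j) (\<lambda>_. borel)) ?X L"
    using Om.indep_vars_restrict[OF indep_vars_coord _ disj] by simp
  define A where "A j = {\<eta> \<in> space (PiM (K j) (\<lambda>_. borel)). Q j (?ext j \<eta>)}" for j
  have A: "A j \<in> sets (PiM (K j) (\<lambda>_. borel))" if "j \<in> L" for j
  proof -
    have "?ext j \<in> measurable (PiM (K j) (\<lambda>_. borel)) Omega"
    proof (rule measurable_OmegaI)
      fix e show "(\<lambda>\<eta>. ?ext j \<eta> e) \<in> borel_measurable (PiM (K j) (\<lambda>_. borel))"
        by (cases "e \<in> K j") auto
    qed
    from measurable_compose[OF this meas[OF that]] show ?thesis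
      by (simp add: A_def pred_def)
  qed
  have eq: "?X j -` A j \<inter> space Omega = {\<omega>. Q j \<omega>}" if "j \<in> L" for j
  proof -
    have "Q j (?ext j (?X j \<omega>)) = Q j \<omega>" for \<omega>
      by (rule dep[OF that, unfolded depends_on_def, rule_format]) simp
    then show ?thesis by (auto simp: A_def space_PiM)
  qed
  have "{\<omega>. \<forall>j\<in>L. Q j \<omega>} = (\<Inter>j\<in>L. {\<omega>. Q j \<omega>})" by auto
  also have "\<dots> = (\<Inter>j\<in>L. ?X j -` A j \<inter> space Omega)"
    using eq by auto
  also have "Om.prob \<dots> = (\<Prod>j\<in>L. Om.prob (?X j -` A j \<inter> space Omega))"
    by (rule Om.indep_varsD[OF ind False fin]) (auto intro: A)
  also have "\<dots> = (\<Prod>j\<in>L. Om.prob {\<omega>. Q j \<omega>})"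
    using eq by (intro prod.cong) auto
  finally show ?thesis .
qed

lemma prob_indep2:
  assumes "Measurable.pred Omega Q1" "Measurable.pred Omega Q2"
    and "depends_on K1 Q1" "depends_on K2 Q2" "K1 \<inter> K2 = {}"
  shows "Om.prob {\<omega>. Q1 \<omega> \<and> Q2 \<omega>} = Om.prob {\<omega>. Q1 \<omega>} * Om.prob {\<omega>. Q2 \<omega>}"
proof -
  have "Om.prob {\<omega>. \<forall>j\<in>UNIV. (if j then Q1 else Q2) \<omega>} = (\<Prod>j\<in>UNIV. Om.prob {\<omega>. (if j then Q1 else Q2) \<omega>})"
    by (rule prob_indep_blocks[where K = "\<lambda>j. if j then K1 else K2"])
       (use assms in \<open>auto simp: disjoint_family_on_def\<close>)
  moreover have "{\<omega>. \<forall>j\<in>UNIV. (if j then Q1 else Q2) \<omega>} = {\<omega>. Q1 \<omega> \<and> Q2 \<omega>}"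
    by (auto simp: UNIV_bool)
  ultimately show ?thesis
    by (simp add: UNIV_bool mult.commute)
qed

section \<open>Exponential laws of the clocks and almost sure goodness\<close>

lemma coord_distributed: "distributed Omega lborel (\<lambda>\<omega>. \<omega> e) (exponential_density 1)"
proof -
  have "distr Omega lborel (\<lambda>\<omega>. \<omega> e) = distr Omega (density lborel (exponential_density 1)) (\<lambda>\<omega>. \<omega> e)"
    by (rule distr_cong) auto
  also have "\<dots> = density lborel (exponential_density 1)"
    unfolding Omega_def by (rule distr_PiM_component) (auto intro: prob_space_exponential_density)
  finally show ?thesis
    by (simp add: distributed_def)
qed

lemma prob_coord_gt: "0 \<le> c \<Longrightarrow> Om.prob {\<omega>. c < \<omega> e} = exp (- c)"
  using Om.exponential_distributedD_gt[OF coord_distributed, of c e] by simp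

lemma prob_coord_le: "0 \<le> c \<Longrightarrow> Om.prob {\<omega>. \<omega> e \<le> c} = 1 - exp (- c)"
  using Om.exponential_distributedD_le[OF coord_distributed, of c e] by simp

lemma prob_coord_between:
  assumes "0 \<le> c" "c \<le> d"
  shows "Om.prob {\<omega>. c < \<omega> e \<and> \<omega> e \<le> d} = exp (- c) - exp (- d)"
proof -
  have "{\<omega>. c < \<omega> e \<and> \<omega> e \<le> d} = {\<omega>. c < \<omega> e} - {\<omega>. d < \<omega> e}"
    by auto
  moreover have "Om.prob ({\<omega>. c < \<omega> e} - {\<omega>. d < \<omega> e}) = Om.prob {\<omega>. c < \<omega> e} - Om.prob {\<omega>. d < \<omega> e}"
    using assms by (intro Om.finite_measure_Diff pred_Omega_sets) auto
  ultimately show ?thesis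
    using assms prob_coord_gt by simp
qed

lemma AE_good: "AE \<omega> in Omega. good \<omega>"
proof -
  have "AE \<omega> in Omega. 0 < \<omega> e" for e
  proof -
    have "Om.prob {\<omega>. \<omega> e \<le> 0} = 0" by (simp add: prob_coord_le)
    then have "AE \<omega> in Omega. \<omega> \<notin> {\<omega>. \<omega> e \<le> 0}"
      by (subst Om.prob_eq_0[symmetric]) (auto intro: pred_Omega_sets)
    then show ?thesis by (rule AE_mp) auto
  qed
  then have pos: "AE \<omega> in Omega. \<forall>e. 0 < \<omega> e"
    by (simp add: AE_all_countable)
  have "AE \<omega> in Omega. \<exists>j. real c < (\<Sum>i\<le>j. \<omega> (u, v, i))" for u v and c :: nat
  proof -
    \<comment> \<open>Positive terms with partial sums bounded by \<open>c\<close> are each at most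
      \<open>c\<close>. The first \<open>m\<close> clocks satisfy this with probability (1 - exp (-
      c))^m, which tends to 0.\<close>
    let ?B = "{\<omega>. (\<forall>e. 0 < \<omega> e) \<and> (\<forall>j. (\<Sum>i\<le>j. \<omega> (u, v, i)) \<le> real c)}"
    have B: "?B \<in> sets Omega" by (rule pred_Omega_sets) measurable
    have le: "Om.prob ?B \<le> (1 - exp (- real c)) ^ m" for m
    proof -
      have "Om.prob ?B \<le> Om.prob {\<omega>. \<forall>i\<in>{..<m}. \<omega> (u, v, i) \<le> real c}"
      proof (rule Om.finite_measure_mono)
        show "?B \<subseteq> {\<omega>. \<forall>i\<in>{..<m}. \<omega> (u, v, i) \<le> real c}"
        proof clarify
          fix \<omega> :: sample and i :: nat assume pos: "\<forall>e. 0 < \<omega> e" and le: "\<forall>j. (\<Sum>i\<le>j. \<omega> (u, v, i)) \<le> real c"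
          have "\<omega> (u, v, i) \<le> (\<Sum>i\<le>i. \<omega> (u, v, i))"
            using pos by (intro member_le_sum) (auto simp: less_imp_le)
          then show "\<omega> (u, v, i) \<le> real c"
            using le order_trans by blast
        qed
      qed (rule pred_Omega_sets, measurable)
      also have "\<dots> = (\<Prod>i<m. Om.prob {\<omega>. \<omega> (u, v, i) \<le> real c})"
        by (rule prob_indep_blocks[where K = "\<lambda>i. {(u, v, i)}"])
           (auto simp: disjoint_family_on_def depends_on_def)
      also have "\<dots> = (1 - exp (- real c)) ^ m"
        by (simp add: prob_coord_le)
      finally show ?thesis .
    qed
    have "(\<lambda>m. (1 - exp (- real c)) ^ m) \<longlonglongrightarrow> 0"
      by (rule LIMSEQ_power_zero) simp
    then have "Om.prob ?B \<le> 0"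
      using le by (intro LIMSEQ_le_const) auto
    then have "Om.prob ?B = 0"
      using measure_nonneg[of Omega ?B] by linarith
    then have "AE \<omega> in Omega. \<omega> \<notin> ?B"
      by (subst Om.prob_eq_0[symmetric, OF B])
    with pos show ?thesis
      by eventually_elim (auto simp: not_le)
  qed
  then have "AE \<omega> in Omega. \<forall>u v. \<forall>c::nat. \<exists>j. real c < (\<Sum>i\<le>j. \<omega> (u, v, i))"
    by (simp add: AE_all_countable)
  with pos show ?thesis
    by eventually_elim (simp add: good_def)
qed

subsection \<open>Components and counting\<close>

definition component :: "nat \<Rightarrow> (nat \<times> nat) set \<Rightarrow> nat \<Rightarrow> nat set" where
  "component n R v = {w. w < n \<and> (v, w) \<in> R\<^sup>*}"

lemma finite_comp [simp]: "finite (component n R v)"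
  by (simp add: component_def)

lemma C1_eq: "C1 n R = Max ((\<lambda>v. card (component n R v)) ` {..<n})"
  by (simp add: C1_def component_def)

lemma card_comp_le_C1: "v < n \<Longrightarrow> card (component n R v) \<le> C1 n R"
  by (simp add: C1_eq)

lemma C1_attained:
  assumes "0 < n"
  obtains v where "v < n" "card (component n R v) = C1 n R"
proof -
  have "C1 n R \<in> (\<lambda>v. card (component n R v)) ` {..<n}"
    unfolding C1_eq using assms by (intro Max_in) auto
  then show thesis using that by auto
qed

lemma comp_mono: "R \<subseteq> S \<Longrightarrow> component n R v \<subseteq> component n S v"
  using rtrancl_mono by (auto simp: component_def)

lemma C1_mono:
  assumes "R \<subseteq> S" "0 < n"
  shows "C1 n R \<le> C1 n S"
proof -
  obtain v where v: "v < n" "card (component n R v) = C1 n R"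
    using C1_attained[OF assms(2)] by blast
  have "card (component n R v) \<le> card (component n S v)"
    using comp_mono[OF assms(1)] by (intro card_mono) auto
  then show ?thesis using v card_comp_le_C1[of v n S] by simp
qed

lemma comp_eq:
  assumes "sym R" "(v, w) \<in> R\<^sup>*"
  shows "component n R v = component n R w"
  using assms sym_rtrancl[OF assms(1)] unfolding component_def
  by (auto intro: rtrancl_trans dest: symD)

section \<open>Counts of events and their expectations\<close>

lemma integrable_card:
  assumes "finite I" "\<And>i. i \<in> I \<Longrightarrow> Measurable.pred Omega (Q i)"
  shows "integrable Omega (\<lambda>\<omega>. real (card {i \<in> I. Q i \<omega>}))"
    and "Om.expectation (\<lambda>\<omega>. real (card {i \<in> I. Q i \<omega>})) = (\<Sum>i\<in>I. Om.prob {\<omega>. Q i \<omega>})"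
proof -
  have eq: "real (card {i \<in> I. Q i \<omega>}) = (\<Sum>i\<in>I. indicator {\<omega>. Q i \<omega>} \<omega>)" for \<omega>
    using assms(1) by (simp add: indicator_def sum.If_cases Int_def)
  have *: "{\<omega>. Q i \<omega>} \<in> sets Omega" if "i \<in> I" for i
    using pred_Omega_sets[OF assms(2)[OF that]] .
  show "integrable Omega (\<lambda>\<omega>. real (card {i \<in> I. Q i \<omega>}))"
    unfolding eq using * by (intro Bochner_Integration.integrable_sum integrable_real_indicator) (auto simp: Om.emeasure_eq_measure)
  show "Om.expectation (\<lambda>\<omega>. real (card {i \<in> I. Q i \<omega>})) = (\<Sum>i\<in>I. Om.prob {\<omega>. Q i \<omega>})"
    unfolding eq using *
    by (subst Bochner_Integration.integral_sum) (auto simp: Om.emeasure_eq_measure intro!: integrable_real_indicator)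
qed

lemma card_pred [measurable]:
  assumes "finite I" "\<And>i. i \<in> I \<Longrightarrow> Measurable.pred Omega (Q i)"
  shows "(\<lambda>\<omega>. real (card {i \<in> I. Q i \<omega>})) \<in> borel_measurable Omega"
  using integrable_card(1)[OF assms] by simp

text \<open>The sum of the probabilities is the expected count. In this way structural facts about a
  single sample become estimates of probabilities.\<close>

lemma sum_prob_le_bound:
  assumes "finite I" "\<And>i. i \<in> I \<Longrightarrow> Measurable.pred Omega (Q i)"
    and "AE \<omega> in Omega. real (card {i \<in> I. Q i \<omega>}) \<le> M"
  shows "(\<Sum>i\<in>I. Om.prob {\<omega>. Q i \<omega>}) \<le> M"
proof -
  have "Om.expectation (\<lambda>\<omega>. real (card {i \<in> I. Q i \<omega>})) \<le> Om.expectation (\<lambda>\<omega>. M)"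
    by (rule integral_mono_AE[OF integrable_card(1)[OF assms(1,2)] _ assms(3)]) auto
  then show ?thesis
    using integrable_card(2)[OF assms(1,2)] Om.prob_space by simp
qed

lemma sum_prob_mono:
  assumes "finite I" "\<And>i. i \<in> I \<Longrightarrow> Measurable.pred Omega (Q i)"
    and "finite J" "\<And>j. j \<in> J \<Longrightarrow> Measurable.pred Omega (Q' j)"
    and "AE \<omega> in Omega. card {i \<in> I. Q i \<omega>} \<le> card {j \<in> J. Q' j \<omega>}"
  shows "(\<Sum>i\<in>I. Om.prob {\<omega>. Q i \<omega>}) \<le> (\<Sum>j\<in>J. Om.prob {\<omega>. Q' j \<omega>})"
proof -
  have "Om.expectation (\<lambda>\<omega>. real (card {i \<in> I. Q i \<omega>})) \<le> Om.expectation (\<lambda>\<omega>. real (card {j \<in> J. Q' j \<omega>}))"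
    using assms(5) by (intro integral_mono_AE integrable_card(1) assms) simp_all
  then show ?thesis
    using integrable_card(2)[OF assms(1,2)] integrable_card(2)[OF assms(3,4)] by simp
qed

lemma prob_card_ge_le:
  assumes "finite I" "\<And>i. i \<in> I \<Longrightarrow> Measurable.pred Omega (Q i)" "0 < c"
  shows "Om.prob {\<omega>. c \<le> real (card {i \<in> I. Q i \<omega>})} \<le> (\<Sum>i\<in>I. Om.prob {\<omega>. Q i \<omega>}) / c"
proof -
  have "Om.prob {\<omega> \<in> space Omega. c \<le> real (card {i \<in> I. Q i \<omega>})}
      \<le> Om.expectation (\<lambda>\<omega>. real (card {i \<in> I. Q i \<omega>})) / c"
    by (rule integral_Markov_inequality_measure[where A = "{}", OF integrable_card(1)[OF assms(1,2)]])
       (use assms(3) in auto)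
  then show ?thesis
    using integrable_card(2)[OF assms(1,2)] by simp
qed

text \<open>Reverse Markov inequality: the count is at most \<open>card I\<close> on the event and
  below half of \<open>c * card I\<close> off it, while its mean is at least
  \<open>c * card I\<close>.\<close>

lemma prob_card_ge:
  assumes "finite I" "I \<noteq> {}" "\<And>i. i \<in> I \<Longrightarrow> Measurable.pred Omega (Q i)"
    and c: "0 \<le> c" "\<And>i. i \<in> I \<Longrightarrow> c \<le> Om.prob {\<omega>. Q i \<omega>}"
  shows "c / 2 \<le> Om.prob {\<omega>. c / 2 * real (card I) \<le> real (card {i \<in> I. Q i \<omega>})}"
proof -
  let ?N = "\<lambda>\<omega>. real (card {i \<in> I. Q i \<omega>})" and ?m = "real (card I)"
  let ?E = "{\<omega>. c / 2 * ?m \<le> ?N \<omega>}"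
  have m: "0 < ?m" using assms(1,2) by (simp add: card_gt_0_iff)
  have [measurable]: "?N \<in> borel_measurable Omega"
    by (intro card_pred assms)
  have E: "?E \<in> sets Omega" by (rule pred_Omega_sets) measurable
  have le: "?N \<omega> \<le> ?m * indicator ?E \<omega> + c / 2 * ?m" for \<omega>
  proof (cases "\<omega> \<in> ?E")
    case True
    have "card {i \<in> I. Q i \<omega>} \<le> card I"
      using assms(1) by (intro card_mono) auto
    moreover have "0 \<le> c / 2 * ?m" using c(1) by simp
    ultimately show ?thesis using True by simp
  next
    case False
    then have "?N \<omega> < c / 2 * ?m" by simp
    then show ?thesis using False by (simp add: indicator_def)
  qed
  have "c * ?m = (\<Sum>i\<in>I. c)" by simp
  also have "\<dots> \<le> (\<Sum>i\<in>I. Om.prob {\<omega>. Q i \<omega>})"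
    using c(2) by (intro sum_mono) auto
  also have "\<dots> = Om.expectation ?N"
    using integrable_card(2)[OF assms(1,3)] by simp
  also have "\<dots> \<le> Om.expectation (\<lambda>\<omega>. ?m * indicator ?E \<omega> + c / 2 * ?m)"
    using E le by (intro integral_mono integrable_card(1) assms)
      (auto intro!: integrable_real_indicator simp: Om.emeasure_eq_measure)
  also have "\<dots> = ?m * Om.prob ?E + c / 2 * ?m"
    using E Om.prob_space
    by (subst Bochner_Integration.integral_add)
       (auto intro!: integrable_real_indicator simp: Om.emeasure_eq_measure)
  finally have "?m * (c / 2) \<le> ?m * Om.prob ?E"
    by (simp add: algebra_simps)
  then show ?thesis
    using m by simp
qed

text \<open>Lets a contradiction be derived at one sample that avoids all bad events and has finite,
  well-ordered arrivals.\<close>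

lemma exists_good:
  assumes "B \<in> sets Omega" "Om.prob B < 1"
  obtains \<omega> where "good \<omega>" "\<omega> \<notin> B"
proof (rule ccontr)
  assume "\<not> thesis"
  then have "\<And>\<omega>. good \<omega> \<Longrightarrow> \<omega> \<in> B" using that by blast
  then have "AE \<omega> in Omega. \<omega> \<in> B"
    using AE_good by (auto elim: eventually_mono)
  then show False
    using Om.prob_eq_1[OF assms(1)] assms(2) by simp
qed

lemma prob_mono_AE:
  assumes "Measurable.pred Omega Q1" "Measurable.pred Omega Q2"
    and "\<And>\<omega>. good \<omega> \<Longrightarrow> Q1 \<omega> \<Longrightarrow> Q2 \<omega>"
  shows "Om.prob {\<omega>. Q1 \<omega>} \<le> Om.prob {\<omega>. Q2 \<omega>}"
proof (rule Om.finite_measure_mono_AE)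
  show "AE \<omega> in Omega. \<omega> \<in> {\<omega>. Q1 \<omega>} \<longrightarrow> \<omega> \<in> {\<omega>. Q2 \<omega>}"
    using AE_good by eventually_elim (use assms(3) in auto)
qed (rule pred_Omega_sets[OF assms(2)])

lemma conv_unif_probD:
  assumes "conv_unif_prob k f" "0 \<le> t" "0 < \<epsilon>" "0 < \<delta>"
  obtains N where "\<And>n. N \<le> n \<Longrightarrow>
    Om.prob {\<omega>. \<epsilon> < \<bar>real (C1 n (G_rel n \<omega> t k)) / real n - f t\<bar>} < \<delta>"
proof -
  obtain N where N: "\<forall>n\<ge>N. \<exists>A\<in>sets Omega. Om.prob A < \<delta> \<and>
        {\<omega>\<in>space Omega. \<exists>t\<ge>0. \<bar>real (C1 n (G_rel n \<omega> t k)) / real n - f t\<bar> > \<epsilon>} \<subseteq> A"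
    using assms unfolding conv_unif_prob_def by blast
  have "Om.prob {\<omega>. \<epsilon> < \<bar>real (C1 n (G_rel n \<omega> t k)) / real n - f t\<bar>} < \<delta>" if n: "N \<le> n" for n
  proof -
    obtain A where A: "A \<in> sets Omega" "Om.prob A < \<delta>"
      "{\<omega>\<in>space Omega. \<exists>t\<ge>0. \<bar>real (C1 n (G_rel n \<omega> t k)) / real n - f t\<bar> > \<epsilon>} \<subseteq> A"
      using N n by blast
    have "Om.prob {\<omega>. \<epsilon> < \<bar>real (C1 n (G_rel n \<omega> t k)) / real n - f t\<bar>} \<le> Om.prob A"
      using A assms(2) by (intro Om.finite_measure_mono) auto
    then show ?thesis using A(2) by simp
  qed
  then show thesis using that by blast
qed

definition pairs :: "nat \<Rightarrow> (nat \<times> nat) set" where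
  "pairs n = {(u, v). u < v \<and> v < n}"

lemma pairs_subset: "pairs n \<subseteq> {..<n} \<times> {..<n}"
  by (auto simp: pairs_def)

lemma finite_pairs [simp]: "finite (pairs n)"
  using finite_subset[OF pairs_subset] by blast

lemma card_pairs_le: "card (pairs n) \<le> n * n"
  using card_mono[OF _ pairs_subset, of n] by (simp add: card_cartesian_product)

text \<open>The source of independence: an event about the killed sample ignores the clocks of
  \<open>P\<close>, so it is independent of every event about those clocks.\<close>

lemma depends_on_kill: "depends_on {e. epair e \<notin> P} (\<lambda>\<omega>. Q (kill b P \<omega>))"
proof -
  have "kill b P \<omega> = kill b P \<omega>'" if "\<forall>e\<in>{e. epair e \<notin> P}. \<omega> e = \<omega>' e" for \<omega> \<omega>'
    using that by (auto simp: kill_def fun_eq_iff)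
  then show ?thesis unfolding depends_on_def by metis
qed

lemma exp_diff_le:
  fixes c d :: real
  assumes "0 \<le> c" "c \<le> d"
  shows "exp (- c) - exp (- d) \<le> d - c"
proof -
  have "exp (- c) - exp (- d) = exp (- c) * (1 - exp (- (d - c)))"
    by (simp add: right_diff_distrib mult_exp_exp)
  also have "\<dots> \<le> 1 * (1 - exp (- (d - c)))"
    using assms by (intro mult_right_mono) auto
  also have "\<dots> \<le> d - c"
  proof -
    have "1 * (1 - y) \<le> - x" if "1 + x \<le> y" for x y :: real
      using that by simp
    from this[OF exp_ge_add_one_self, of "- (d - c)"] show ?thesis by simp
  qed
  finally show ?thesis .
qed

lemma prob_first_le:
  assumes "0 \<le> t" "0 < n"
  shows "Om.prob {\<omega>. real n * \<omega> e \<le> t} \<le> t / real n"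
proof -
  have "{\<omega>. real n * \<omega> e \<le> t} = {\<omega>. \<omega> e \<le> t / real n}"
    using assms by (auto simp: field_simps)
  then show ?thesis
    using prob_coord_le[of "t / real n" e] exp_diff_le[of 0 "t / real n"] assms by simp
qed

lemma prob_first_gt:
  assumes "0 \<le> t" "0 < n"
  shows "Om.prob {\<omega>. t < real n * \<omega> e} = exp (- (t / real n))"
proof -
  have "{\<omega>. t < real n * \<omega> e} = {\<omega>. t / real n < \<omega> e}"
    using assms by (auto simp: field_simps)
  then show ?thesis
    using prob_coord_gt[of "t / real n" e] assms by simp
qed

lemma prob_first_between:
  assumes "0 \<le> a" "a \<le> t" "0 < n"
  shows "Om.prob {\<omega>. a < real n * \<omega> e \<and> real n * \<omega> e \<le> t} = exp (- (a / real n)) - exp (- (t / real n))"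
proof -
  have "{\<omega>. a < real n * \<omega> e \<and> real n * \<omega> e \<le> t} = {\<omega>. a / real n < \<omega> e \<and> \<omega> e \<le> t / real n}"
    using assms by (auto simp: field_simps)
  then show ?thesis
    using prob_coord_between[of "a / real n" "t / real n" e] assms by (simp add: divide_right_mono)
qed

text \<open>The first clock of the pair is independent of the killed event and makes the pair empty
  up to \<open>t\<close> with probability exp (- t / n), which is at least exp (- t). The crude
  factor \<open>exp t\<close> is uniform in \<open>n\<close>.\<close>

lemma prob_kill_le:
  assumes [measurable]: "Measurable.pred Omega Q" "Measurable.pred Omega Q'"
    and t: "0 \<le> t" "0 < n"
    and Q': "\<And>\<omega>. good \<omega> \<Longrightarrow> t < real n * \<omega> (u, v, 0) \<Longrightarrow> Q (kill b {(u, v)} \<omega>) \<Longrightarrow> Q' \<omega>"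
  shows "Om.prob {\<omega>. Q (kill b {(u, v)} \<omega>)} \<le> exp t * Om.prob {\<omega>. Q' \<omega>}"
proof -
  let ?Qk = "\<lambda>\<omega>. Q (kill b {(u, v)} \<omega>)"
  have [measurable]: "Measurable.pred Omega ?Qk"
    by (rule measurable_compose[OF kill_measurable assms(1)])
  have "Om.prob {\<omega>. ?Qk \<omega> \<and> t < real n * \<omega> (u, v, 0)} = Om.prob {\<omega>. ?Qk \<omega>} * exp (- (t / real n))"
    using prob_indep2[OF _ _ depends_on_kill[of "{(u, v)}" Q b],
        of "\<lambda>\<omega>. t < real n * \<omega> (u, v, 0)" "{(u, v, 0)}"] prob_first_gt[OF t]
    by (simp add: depends_on_def)
  moreover have "Om.prob {\<omega>. ?Qk \<omega> \<and> t < real n * \<omega> (u, v, 0)} \<le> Om.prob {\<omega>. Q' \<omega>}"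
    by (rule prob_mono_AE) (use Q' in auto)
  ultimately have "Om.prob {\<omega>. ?Qk \<omega>} * exp (- (t / real n)) * exp t \<le> Om.prob {\<omega>. Q' \<omega>} * exp t"
    by simp
  moreover have "1 \<le> exp (- (t / real n)) * exp t"
    using t mult_left_mono[of 1 "real n" t] by (simp add: mult_exp_exp field_simps)
  then have "Om.prob {\<omega>. ?Qk \<omega>} * 1 \<le> Om.prob {\<omega>. ?Qk \<omega>} * (exp (- (t / real n)) * exp t)"
    by (intro mult_left_mono) auto
  ultimately have "Om.prob {\<omega>. ?Qk \<omega>} \<le> Om.prob {\<omega>. Q' \<omega>} * exp t"
    unfolding mult.assoc mult_1_right by (rule order_trans[rotated])
  then show ?thesis
    by (subst mult.commute)
qed

subsection \<open>Subcritical edges\<close>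

definition simple_paths :: "nat \<Rightarrow> nat \<Rightarrow> nat list set" where
  "simple_paths n x = {xs. distinct xs \<and> set xs \<subseteq> {..<n} \<and> xs \<noteq> [] \<and> hd xs = x}"

lemma finite_simple_paths: "finite (simple_paths n x)"
proof -
  have "simple_paths n x \<subseteq> {xs. set xs \<subseteq> {..<n} \<and> length xs \<le> n}"
    using card_mono[of "{..<n}" "set _"] by (auto simp: simple_paths_def distinct_card[symmetric])
  then show ?thesis
    by (rule finite_subset) (simp add: finite_lists_length_le)
qed

lemma rtrancl_imp_simple_path:
  assumes "R \<subseteq> {..<n} \<times> {..<n}" "x < n" "(x, w) \<in> R\<^sup>*"
  shows "\<exists>xs\<in>simple_paths n x. last xs = w \<and> successively (\<lambda>a b. (a, b) \<in> R) xs"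
  using assms(3)
proof induction
  case base
  then show ?case
    using assms(2) by (intro bexI[of _ "[x]"]) (auto simp: simple_paths_def)
next
  case (step y z)
  then obtain xs where xs: "xs \<in> simple_paths n x" "last xs = y" "successively (\<lambda>a b. (a, b) \<in> R) xs"
    by blast
  show ?case
  proof (cases "z \<in> set xs")
    case True
    then obtain ys zs where ys: "xs = ys @ z # zs" by (meson split_list)
    have "ys @ [z] \<in> simple_paths n x"
      using xs(1) ys by (auto simp: simple_paths_def hd_append split: if_splits)
    moreover have "successively (\<lambda>a b. (a, b) \<in> R) (ys @ [z])"
      using xs(3) ys by (auto simp: successively_append_iff)
    ultimately show ?thesis by force
  next
    case False
    have "z < n" using step(2) assms(1) by auto
    then have "xs @ [z] \<in> simple_paths n x"
      using xs(1) False by (auto simp: simple_paths_def)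
    moreover have "successively (\<lambda>a b. (a, b) \<in> R) (xs @ [z])"
      using xs step(2) by (auto simp: successively_append_iff)
    ultimately show ?thesis by force
  qed
qed

lemma successively_imp_rtrancl:
  "successively (\<lambda>a b. (a, b) \<in> R) xs \<Longrightarrow> xs \<noteq> [] \<Longrightarrow> (hd xs, last xs) \<in> R\<^sup>*"
proof (induction xs)
  case (Cons a xs)
  then show ?case
    by (cases xs) (auto intro: converse_rtrancl_into_rtrancl)
qed simp

text \<open>Only the first clock of the unordered pair enters, so different pairs are independent
  and late with probability at most (t - a) / n: \<open>late_rel\<close> is a subcritical
  Erdos-Renyi graph. It may contain loops, which do not affect connectivity.\<close>

definition late_pair :: "nat \<Rightarrow> real \<Rightarrow> real \<Rightarrow> sample \<Rightarrow> nat \<Rightarrow> nat \<Rightarrow> bool" where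
  "late_pair n a t \<omega> x y \<longleftrightarrow> a < real n * \<omega> (min x y, max x y, 0) \<and> real n * \<omega> (min x y, max x y, 0) \<le> t"

definition late_rel :: "nat \<Rightarrow> real \<Rightarrow> real \<Rightarrow> sample \<Rightarrow> (nat \<times> nat) set" where
  "late_rel n a t \<omega> = {(x, y). x < n \<and> y < n \<and> late_pair n a t \<omega> x y}"

lemma late_pair_measurable [measurable]: "Measurable.pred Omega (\<lambda>\<omega>. late_pair n a t \<omega> x y)"
  unfolding late_pair_def by measurable

lemma sym_late_rel: "sym (late_rel n a t \<omega>)"
  by (auto simp: sym_def late_rel_def late_pair_def min.commute max.commute)

definition late_path :: "nat \<Rightarrow> real \<Rightarrow> real \<Rightarrow> nat list \<Rightarrow> sample \<Rightarrow> bool" where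
  "late_path n a t xs \<omega> \<longleftrightarrow> (\<forall>i\<in>{..<length xs - 1}. late_pair n a t \<omega> (xs ! i) (xs ! Suc i))"

lemma late_path_measurable [measurable]: "Measurable.pred Omega (late_path n a t xs)"
proof -
  have "Measurable.pred Omega (\<lambda>\<omega>. \<forall>i\<in>{..<length xs - 1}. late_pair n a t \<omega> (xs ! i) (xs ! Suc i))"
    by measurable
  then show ?thesis by (simp add: late_path_def[abs_def])
qed

lemma successively_late:
  assumes "set xs \<subseteq> {..<n}"
  shows "successively (\<lambda>x y. (x, y) \<in> late_rel n a t \<omega>) xs \<longleftrightarrow> late_path n a t xs \<omega>"
proof -
  have "xs ! i < n" if "i < length xs" for i
    using assms nth_mem[OF that] by auto
  then show ?thesis
    by (auto simp: successively_conv_nth late_path_def late_rel_def less_diff_conv)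
qed

text \<open>Simple paths are finite in number, which gives measurability, and never repeat a pair,
  which gives independence along a path.\<close>

lemma late_conn_iff:
  assumes "x < n"
  shows "(x, w) \<in> (late_rel n a t \<omega>)\<^sup>* \<longleftrightarrow> (\<exists>xs\<in>simple_paths n x. last xs = w \<and> late_path n a t xs \<omega>)"
proof -
  have sub: "late_rel n a t \<omega> \<subseteq> {..<n} \<times> {..<n}"
    by (auto simp: late_rel_def)
  have "(x, w) \<in> (late_rel n a t \<omega>)\<^sup>* \<longleftrightarrow> (\<exists>xs\<in>simple_paths n x. last xs = w \<and>
      successively (\<lambda>x y. (x, y) \<in> late_rel n a t \<omega>) xs)"
    using rtrancl_imp_simple_path[OF sub assms] successively_imp_rtrancl[of "late_rel n a t \<omega>"]
    by (auto simp: simple_paths_def)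
  also have "\<dots> \<longleftrightarrow> (\<exists>xs\<in>simple_paths n x. last xs = w \<and> late_path n a t xs \<omega>)"
    by (intro bex_cong refl conj_cong successively_late) (simp add: simple_paths_def)
  finally show ?thesis .
qed

lemma late_conn_measurable:
  assumes "x < n"
  shows "Measurable.pred Omega (\<lambda>\<omega>. (x, w) \<in> (late_rel n a t \<omega>)\<^sup>*)"
  unfolding late_conn_iff[OF assms]
  by (intro pred_intros_finite finite_simple_paths pred_intros_logic late_path_measurable) simp

lemma prob_late_path:
  assumes "0 \<le> a" "a \<le> t" "0 < n" "distinct xs"
  shows "Om.prob {\<omega>. late_path n a t xs \<omega>} \<le> ((t - a) / real n) ^ (length xs - 1)"
proof -
  let ?e = "\<lambda>i. (min (xs ! i) (xs ! Suc i), max (xs ! i) (xs ! Suc i), 0)"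
  have inj: "i = j" if ij: "i < length xs - 1" "j < length xs - 1" "?e i = ?e j" for i j
  proof -
    have "{xs ! i, xs ! Suc i} = {xs ! j, xs ! Suc j}"
      using ij(3) by (auto simp: min_def max_def split: if_splits)
    \<comment> \<open>As the vertices are distinct, a pair could recur only reversed, which would
      need \<open>i = Suc j\<close> and \<open>j = Suc i\<close> at once.\<close>
    then have "i = j \<or> i = Suc j \<and> j = Suc i"
      using ij(1,2) assms(4) by (auto simp: doubleton_eq_iff nth_eq_iff_index_eq)
    then show ?thesis by auto
  qed
  have "Om.prob {\<omega>. late_path n a t xs \<omega>} = (\<Prod>i<length xs - 1. Om.prob {\<omega>. late_pair n a t \<omega> (xs ! i) (xs ! Suc i)})"
    unfolding late_path_def
    by (rule prob_indep_blocks[where K = "\<lambda>i. {?e i}"])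
       (use inj in \<open>auto simp: disjoint_family_on_def depends_on_def late_pair_def\<close>)
  also have "\<dots> \<le> (\<Prod>i<length xs - 1. (t - a) / real n)"
  proof (rule prod_mono, safe)
    fix i
    show "Om.prob {\<omega>. late_pair n a t \<omega> (xs ! i) (xs ! Suc i)} \<le> (t - a) / real n"
      unfolding late_pair_def
      using prob_first_between[OF assms(1-3)] exp_diff_le[of "a / real n" "t / real n"] assms(1-3)
      by (simp add: divide_right_mono diff_divide_distrib)
  qed simp
  finally show ?thesis by simp
qed

text \<open>First moment over simple paths: there are at most n^l with \<open>l\<close> edges, each
  present with probability at most ((t - a) / n)^l. The powers of \<open>n\<close> cancel and leave
  a geometric series of ratio t - a < 1.\<close>

lemma sum_prob_late_conn:
  assumes "0 \<le> a" "a \<le> t" "t < a + 1" "x < n"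
  shows "(\<Sum>w<n. Om.prob {\<omega>. (x, w) \<in> (late_rel n a t \<omega>)\<^sup>*}) \<le> 1 / (1 - (t - a))"
proof -
  let ?P = "simple_paths n x" and ?lam = "t - a"
  have n: "0 < n" using assms(4) by simp
  have "(\<Sum>w<n. Om.prob {\<omega>. (x, w) \<in> (late_rel n a t \<omega>)\<^sup>*}) \<le> (\<Sum>xs\<in>?P. Om.prob {\<omega>. late_path n a t xs \<omega>})"
  proof (rule sum_prob_mono)
    show "AE \<omega> in Omega. card {w \<in> {..<n}. (x, w) \<in> (late_rel n a t \<omega>)\<^sup>*} \<le> card {xs \<in> ?P. late_path n a t xs \<omega>}"
    proof (rule AE_I2)
      fix \<omega>
      have "{w \<in> {..<n}. (x, w) \<in> (late_rel n a t \<omega>)\<^sup>*} \<subseteq> last ` {xs \<in> ?P. late_path n a t xs \<omega>}"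
        unfolding late_conn_iff[OF assms(4)] by auto
      then show "card {w \<in> {..<n}. (x, w) \<in> (late_rel n a t \<omega>)\<^sup>*} \<le> card {xs \<in> ?P. late_path n a t xs \<omega>}"
        by (intro surj_card_le) (auto simp: finite_simple_paths)
    qed
  qed (auto intro: late_conn_measurable[OF assms(4)] finite_simple_paths)
  also have "\<dots> \<le> (\<Sum>xs\<in>?P. (?lam / real n) ^ (length xs - 1))"
    by (intro sum_mono prob_late_path assms n) (simp add: simple_paths_def)
  also have "\<dots> \<le> (\<Sum>xs\<in>(\<Union>l<n. (#) x ` {ys. set ys \<subseteq> {..<n} \<and> length ys = l}). (?lam / real n) ^ (length xs - 1))"
  proof (rule sum_mono2)
    show "?P \<subseteq> (\<Union>l<n. (#) x ` {ys. set ys \<subseteq> {..<n} \<and> length ys = l})"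
    proof
      fix xs assume xs: "xs \<in> ?P"
      then obtain ys where ys: "xs = x # ys"
        by (cases xs) (auto simp: simple_paths_def)
      have "length xs \<le> n"
        using xs card_mono[of "{..<n}" "set xs"] by (auto simp: simple_paths_def distinct_card)
      then show "xs \<in> (\<Union>l<n. (#) x ` {ys. set ys \<subseteq> {..<n} \<and> length ys = l})"
        using xs ys by (auto simp: simple_paths_def)
    qed
  qed (use assms in \<open>auto intro!: finite_imageI finite_lists_length_eq\<close>)
  also have "\<dots> = (\<Sum>l<n. \<Sum>xs\<in>(#) x ` {ys. set ys \<subseteq> {..<n} \<and> length ys = l}. (?lam / real n) ^ (length xs - 1))"
    by (intro sum.UNION_disjoint) (auto intro!: finite_imageI finite_lists_length_eq)
  also have "\<dots> = (\<Sum>l<n. ?lam ^ l)"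
  proof (rule sum.cong)
    fix l
    have "(\<Sum>xs\<in>(#) x ` {ys. set ys \<subseteq> {..<n} \<and> length ys = l}. (?lam / real n) ^ (length xs - 1)) =
        (\<Sum>ys\<in>{ys. set ys \<subseteq> {..<n} \<and> length ys = l}. (?lam / real n) ^ l)"
      by (subst sum.reindex) (auto intro!: inj_onI sum.cong)
    also have "\<dots> = ?lam ^ l"
      using n by (simp add: card_lists_length_eq power_divide)
    finally show "(\<Sum>xs\<in>(#) x ` {ys. set ys \<subseteq> {..<n} \<and> length ys = l}. (?lam / real n) ^ (length xs - 1)) = ?lam ^ l" .
  qed simp
  also have "\<dots> \<le> (\<Sum>l. ?lam ^ l)"
    using assms by (intro sum_le_suminf summable_geometric) auto
  also have "\<dots> = 1 / (1 - ?lam)"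
    using assms by (intro suminf_geometric) auto
  finally show ?thesis .
qed

text \<open>Adding edges that touch only the vertex set \<open>X\<close> glues at most \<open>|X| + 1\<close> components of \<open>H\<close>
  to a component. Those of size at least \<open>m\<close> contain at most \<open>Z / m\<close> vertices in total,
  \<open>Z\<close> being the number of connected pairs of \<open>H\<close>.\<close>

lemma C1_glue_bound:
  assumes "0 < n" "sym H" "R \<subseteq> H \<union> UNIV \<times> X" "finite X"
  shows "m * C1 n R \<le> card {(x, w). x < n \<and> w < n \<and> (x, w) \<in> H\<^sup>*} + m * (m * (card X + 1))"
proof -
  obtain v where v: "v < n" "card (component n R v) = C1 n R"
    using C1_attained[OF assms(1)] by blast
  \<comment> \<open>Each step of \<open>R\<close> uses \<open>H\<close> or lands in
    \<open>X\<close>. So \<open>w\<close> is reached through \<open>H\<close> from the last landing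
    point, or from \<open>v\<close> if there is none.\<close>
  have reach: "\<exists>x\<in>insert v X. (x, w) \<in> H\<^sup>*" if "(v, w) \<in> R\<^sup>*" for w
    using that
  proof induction
    case (step y z)
    then obtain x where x: "x \<in> insert v X" "(x, y) \<in> H\<^sup>*" by blast
    have "(y, z) \<in> H \<or> z \<in> X"
      using step(2) assms(3) by auto
    then show ?case
      using x rtrancl_into_rtrancl[OF x(2)] by blast
  qed auto
  let ?big = "{w. w < n \<and> m \<le> card (component n H w)}"
  have "component n R v \<subseteq> ?big \<union> (\<Union>x\<in>{x \<in> insert v X. card (component n H x) < m}. component n H x)"
  proof
    fix w assume w: "w \<in> component n R v"
    then obtain x where x: "x \<in> insert v X" "(x, w) \<in> H\<^sup>*"
      using reach by (auto simp: component_def)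
    have "component n H x = component n H w" by (rule comp_eq[OF assms(2) x(2)])
    then show "w \<in> ?big \<union> (\<Union>x\<in>{x \<in> insert v X. card (component n H x) < m}. component n H x)"
      using x w by (auto simp: component_def not_le)
  qed
  then have "C1 n R \<le> card (?big \<union> (\<Union>x\<in>{x \<in> insert v X. card (component n H x) < m}. component n H x))"
    unfolding v(2)[symmetric] using assms(4) by (intro card_mono) auto
  also have "\<dots> \<le> card ?big + card (\<Union>x\<in>{x \<in> insert v X. card (component n H x) < m}. component n H x)"
    by (rule card_Un_le)
  also have "card (\<Union>x\<in>{x \<in> insert v X. card (component n H x) < m}. component n H x)
      \<le> (\<Sum>x\<in>{x \<in> insert v X. card (component n H x) < m}. card (component n H x))"
    using assms(4) by (intro card_UN_le) auto
  also have "\<dots> \<le> card {x \<in> insert v X. card (component n H x) < m} * m"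
    using sum_bounded_above[of "{x \<in> insert v X. card (component n H x) < m}" "\<lambda>x. card (component n H x)" m] by auto
  also have "\<dots> \<le> card (insert v X) * m"
    using assms(4) by (intro mult_right_mono card_mono) auto
  also have "\<dots> \<le> (card X + 1) * m"
    using assms(4) by (intro mult_right_mono) (auto simp: card_insert_if)
  finally have le: "C1 n R \<le> card ?big + (card X + 1) * m" by simp
  have "m * card ?big = (\<Sum>w\<in>?big. m)" by simp
  also have "\<dots> \<le> (\<Sum>w\<in>?big. card (component n H w))"
    by (intro sum_mono) auto
  also have "\<dots> \<le> (\<Sum>w<n. card (component n H w))"
    by (intro sum_mono2) auto
  also have "\<dots> = card (SIGMA w:{..<n}. component n H w)"
    by simp
  also have "(SIGMA w:{..<n}. component n H w) = {(x, w). x < n \<and> w < n \<and> (x, w) \<in> H\<^sup>*}"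
    by (auto simp: component_def)
  finally have big: "m * card ?big \<le> card {(x, w). x < n \<and> w < n \<and> (x, w) \<in> H\<^sup>*}" .
  have "m * C1 n R \<le> m * (card ?big + (card X + 1) * m)"
    using le by (intro mult_left_mono) auto
  also have "\<dots> = m * card ?big + m * (m * (card X + 1))"
    by (simp add: algebra_simps)
  finally show ?thesis using big by linarith
qed

subsection \<open>Early edges and the threshold\<close>

lemma level_unique:
  assumes "distinct (pre @ x # post)" "(x, l) \<in> set (lab (pre @ x # post))"
  shows "l = new_level (lab pre) x"
proof -
  have "distinct (map fst (lab (pre @ x # post)))" using assms(1) by simp
  then show ?thesis
    using eq_key_imp_eq_value assms(2) lab_split by metis
qed

text \<open>Makes \<open>a + 1\<close> a valid constant for killing pairs up to time
  \<open>a\<close>, for every \<open>n > 0\<close>.\<close>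

lemma less_times_Suc:
  fixes a :: real
  assumes "0 < n" "0 \<le> a"
  shows "a < real n * (a + 1)"
proof -
  have "a < 1 * (a + 1)" by simp
  also have "\<dots> \<le> real n * (a + 1)" using assms by (intro mult_right_mono) auto
  finally show ?thesis .
qed

text \<open>The pairs that may contribute an edge of \<open>G\<^sub>k(t)\<close> other than a single arrival after time \<open>a\<close>.\<close>

definition bad_pair :: "nat \<Rightarrow> real \<Rightarrow> real \<Rightarrow> nat \<Rightarrow> nat \<times> nat \<Rightarrow> sample \<Rightarrow> bool" where
  "bad_pair n a t k p \<omega> \<longleftrightarrow>
     (real n * \<omega> (fst p, snd p, 0) \<le> t \<and> real n * \<omega> (fst p, snd p, Suc 0) \<le> t) \<or>
     (real n * \<omega> (fst p, snd p, 0) \<le> a \<and>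
       (2 \<le> k \<longrightarrow> (fst p, snd p) \<in> (G_rel n (kill (a + 1) {(fst p, snd p)} \<omega>) a (k - 1))\<^sup>*))"

lemma killed_conn_measurable [measurable]:
  "Measurable.pred Omega (\<lambda>\<omega>. (u, v) \<in> (G_rel n (kill b P \<omega>) t k)\<^sup>*)"
  using G_rel_kill_pred[of "\<lambda>R. (u, v) \<in> R\<^sup>*"] .

lemma conn_measurable [measurable]:
  "Measurable.pred Omega (\<lambda>\<omega>. (u, v) \<in> (G_rel n \<omega> t k)\<^sup>*)"
  using G_rel_pred[of "\<lambda>R. (u, v) \<in> R\<^sup>*"] .

lemma bad_pair_measurable [measurable]: "Measurable.pred Omega (bad_pair n a t k p)"
  unfolding bad_pair_def[abs_def] by measurable

text \<open>If the pair has a single arrival, level at least \<open>k\<close> means that its ends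
  were already connected in G_{k-1} on the prefix before it. That prefix survives killing the pair,
  so the connection is visible in the killed graph at time \<open>a\<close>.\<close>

lemma bad_pair_early:
  assumes g: "good \<omega>" and n: "0 < n" and a: "0 \<le> a" "a \<le> t" and uv: "u < v" "v < n"
    and e: "((u, v, j), l) \<in> set (lab (elist n \<omega> t))" "k \<le> l"
    and first: "real n * \<omega> (u, v, 0) \<le> a"
  shows "bad_pair n a t k (u, v) \<omega>"
proof (cases "real n * \<omega> (u, v, Suc 0) \<le> t \<or> k < 2")
  case True
  then show ?thesis using first a by (auto simp: bad_pair_def)
next
  case False
  then have k: "2 \<le> k" by simp
  \<comment> \<open>\<open>bad_pair\<close> tests the second inter-arrival time, not the second
    arrival, to keep the two clocks independent. If that interval alone exceeds \<open>t\<close>, so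
    does the second arrival.\<close>
  have second: "t < arrival n \<omega> (u, v, Suc 0)"
    using False n good_pos[OF g, of "(u, v, 0)"] by (simp add: arrival_1 distrib_left add_pos_pos not_le add_strict_increasing)
  have j: "j = 0"
  proof (rule ccontr)
    assume "j \<noteq> 0"
    then have "arrival n \<omega> (u, v, Suc 0) \<le> arrival n \<omega> (u, v, j)"
      using g by (intro arrival_mono good_pos) auto
    moreover have "(u, v, j) \<in> set (elist n \<omega> t)"
      using e(1) by (metis fst_conv image_eqI list.set_map map_fst_lab)
    then have "arrival n \<omega> (u, v, j) \<le> t"
      using set_elist_subset by (fastforce simp: edges_upto_def)
    ultimately show False using second by simp
  qed
  have b: "0 < a + 1" "a < real n * (a + 1)"
    using less_times_Suc[OF n a(1)] a by auto
  have "arrival n \<omega> (u, v, 0) \<le> a" "a < arrival n \<omega> (u, v, Suc 0)"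
    using first second a by (auto simp: arrival_0)
  then obtain pre post where split: "elist n \<omega> a = pre @ (u, v, 0) # post"
    and kill: "elist n (kill (a + 1) {(u, v)} \<omega>) a = pre @ post"
    by (rule elist_split_single[OF g b uv])
  obtain rest where rest: "elist n \<omega> t = elist n \<omega> a @ rest"
    using elist_prefix[OF g a(2)] by blast
  have "distinct (elist n \<omega> t)" by (rule distinct_elist[OF finite_edges_upto[OF g]])
  then have "l = new_level (lab pre) (u, v, 0)"
    using e(1) unfolding rest split j append_assoc append_Cons by (rule level_unique)
  then have "k - 1 < new_level (lab pre) (u, v, 0)"
    using e(2) k by simp
  then have "(u, v) \<in> (level_rel (lab pre) (k - 1))\<^sup>*"
    using less_new_level_iff[of "(u, v, 0)" "k - 1" "lab pre"] uv k by simp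
  then have "(u, v) \<in> (level_rel (lab (pre @ post)) (k - 1))\<^sup>*"
    by (rule rtrancl_level_lab_mono) simp
  then show ?thesis
    using first kill by (simp add: bad_pair_def G_rel_eq)
qed

text \<open>What matters is the first arrival on the pair of the edge: after \<open>a\<close> the
  pair is late, even if the edge itself is a repetition; otherwise the pair is bad. The product form
  of the second part is what \<open>C1_glue_bound\<close> expects.\<close>

lemma G_rel_cover:
  assumes g: "good \<omega>" and n: "0 < n" and a: "0 \<le> a" "a \<le> t"
  shows "G_rel n \<omega> t k \<subseteq> late_rel n a t \<omega> \<union>
    UNIV \<times> (\<Union>p\<in>{p \<in> pairs n. bad_pair n a t k p \<omega>}. {fst p, snd p})"
proof
  fix e assume e: "e \<in> G_rel n \<omega> t k"
  obtain x y where xy: "e = (x, y)" by (cases e)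
  obtain u v j l where f: "((u, v, j), l) \<in> set (lab (elist n \<omega> t))" "k \<le> l"
    "(x, y) = (u, v) \<or> (x, y) = (v, u)"
    using e xy by (auto simp: G_rel_eq level_rel_iff)
  have mem: "(u, v, j) \<in> set (elist n \<omega> t)"
    using f(1) by (metis fst_conv image_eqI list.set_map map_fst_lab)
  have uv: "u < v" "v < n" using elist_ends[OF mem] by auto
  have "arrival n \<omega> (u, v, 0) \<le> arrival n \<omega> (u, v, j)"
    using g by (intro arrival_mono good_pos) auto
  also have "\<dots> \<le> t"
    using mem set_elist_subset by (fastforce simp: edges_upto_def)
  finally have first: "real n * \<omega> (u, v, 0) \<le> t" by (simp add: arrival_0)
  show "e \<in> late_rel n a t \<omega> \<union> UNIV \<times> (\<Union>p\<in>{p \<in> pairs n. bad_pair n a t k p \<omega>}. {fst p, snd p})"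
  proof (cases "a < real n * \<omega> (u, v, 0)")
    case True
    then have "e \<in> late_rel n a t \<omega>"
      using first f(3) uv xy by (auto simp: late_rel_def late_pair_def min_def max_def)
    then show ?thesis by simp
  next
    case False
    then have "bad_pair n a t k (u, v) \<omega>"
      using bad_pair_early[OF g n a uv f(1,2)] by simp
    then have "(u, v) \<in> {p \<in> pairs n. bad_pair n a t k p \<omega>}"
      using uv by (simp add: pairs_def)
    then show ?thesis
      using f(3) xy by force
  qed
qed

text \<open>The square bounds a double arrival. For an early arrival, the connection in the killed
  graph is independent of the clock, and \<open>prob_kill_le\<close> replaces it by a connection in
  the true graph at the cost of \<open>exp a\<close>.\<close>

lemma prob_bad_pair:
  assumes n: "0 < n" and a: "0 \<le> a" "a \<le> t"
  shows "Om.prob {\<omega>. bad_pair n a t k p \<omega>} \<le> (t / real n)\<^sup>2 +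
     a / real n * (if 2 \<le> k then exp a * Om.prob {\<omega>. p \<in> (G_rel n \<omega> a (k - 1))\<^sup>*} else 1)"
proof -
  obtain u v where p: "p = (u, v)" by (cases p)
  let ?A = "\<lambda>\<omega>. real n * \<omega> (u, v, 0) \<le> t \<and> real n * \<omega> (u, v, Suc 0) \<le> t"
  let ?F = "\<lambda>\<omega>. real n * \<omega> (u, v, 0) \<le> a"
  let ?C = "\<lambda>\<omega>. 2 \<le> k \<longrightarrow> (u, v) \<in> (G_rel n (kill (a + 1) {(u, v)} \<omega>) a (k - 1))\<^sup>*"
  have "Om.prob {\<omega>. bad_pair n a t k p \<omega>} = Om.prob ({\<omega>. ?A \<omega>} \<union> {\<omega>. ?C \<omega> \<and> ?F \<omega>})"
    by (rule arg_cong[where f = Om.prob]) (auto simp: bad_pair_def p)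
  also have "\<dots> \<le> Om.prob {\<omega>. ?A \<omega>} + Om.prob {\<omega>. ?C \<omega> \<and> ?F \<omega>}"
    by (intro measure_Un_le pred_Omega_sets; measurable)
  also have "Om.prob {\<omega>. ?A \<omega>} = Om.prob {\<omega>. real n * \<omega> (u, v, 0) \<le> t} * Om.prob {\<omega>. real n * \<omega> (u, v, Suc 0) \<le> t}"
    by (rule prob_indep2[where ?K1.0 = "{(u, v, 0)}" and ?K2.0 = "{(u, v, Suc 0)}"]) (auto simp: depends_on_def)
  also have "\<dots> \<le> t / real n * (t / real n)"
    using a n by (intro mult_mono prob_first_le) auto
  also have "Om.prob {\<omega>. ?C \<omega> \<and> ?F \<omega>} = Om.prob {\<omega>. ?C \<omega>} * Om.prob {\<omega>. ?F \<omega>}"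
  proof (rule prob_indep2)
    show "depends_on {e. epair e \<notin> {(u, v)}} ?C"
      using depends_on_kill[of "{(u, v)}" "\<lambda>\<omega>'. 2 \<le> k \<longrightarrow> (u, v) \<in> (G_rel n \<omega>' a (k - 1))\<^sup>*" "a + 1"] .
    show "depends_on {(u, v, 0)} ?F" by (simp add: depends_on_def)
  qed auto
  also have "\<dots> \<le> (if 2 \<le> k then exp a * Om.prob {\<omega>. p \<in> (G_rel n \<omega> a (k - 1))\<^sup>*} else 1) * (a / real n)"
  proof (rule mult_mono)
    show "Om.prob {\<omega>. ?C \<omega>} \<le> (if 2 \<le> k then exp a * Om.prob {\<omega>. p \<in> (G_rel n \<omega> a (k - 1))\<^sup>*} else 1)"
    proof (cases "2 \<le> k")
      case True
      have "Om.prob {\<omega>. (u, v) \<in> (G_rel n (kill (a + 1) {(u, v)} \<omega>) a (k - 1))\<^sup>*} \<le>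
          exp a * Om.prob {\<omega>. (u, v) \<in> (G_rel n \<omega> a (k - 1))\<^sup>*}"
      proof (rule prob_kill_le[where Q = "\<lambda>\<omega>. (u, v) \<in> (G_rel n \<omega> a (k - 1))\<^sup>*", OF _ _ a(1) n])
        fix \<omega> assume g: "good \<omega>" and late: "a < real n * \<omega> (u, v, 0)"
          and c: "(u, v) \<in> (G_rel n (kill (a + 1) {(u, v)} \<omega>) a (k - 1))\<^sup>*"
        have "G_rel n (kill (a + 1) {(u, v)} \<omega>) a (k - 1) = G_rel n \<omega> a (k - 1)"
          using late a less_times_Suc[OF n a(1)] by (intro G_rel_kill_eq[OF g]) auto
        then show "(u, v) \<in> (G_rel n \<omega> a (k - 1))\<^sup>*" using c by simp
      qed measurable
      then show ?thesis using True p by simp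
    next
      case False
      then show ?thesis using Om.prob_space by simp
    qed
  qed (use a n prob_first_le in auto)
  finally show ?thesis
    by (simp add: power2_eq_square mult.commute)
qed

text \<open>At most \<open>n * C1\<close> pairs are connected. One \<epsilon> comes from samples
  where \<open>C1\<close> is at most \<epsilon> n, the other from the exceptional event.\<close>

lemma sum_prob_conn:
  assumes n: "0 < n" and eps: "0 \<le> \<epsilon>"
    and conv: "Om.prob {\<omega>. \<epsilon> < real (C1 n (G_rel n \<omega> a k)) / real n} \<le> \<epsilon>"
  shows "(\<Sum>p\<in>pairs n. Om.prob {\<omega>. p \<in> (G_rel n \<omega> a k)\<^sup>*}) \<le> 2 * \<epsilon> * (real n)\<^sup>2"
proof -
  let ?S = "\<lambda>\<omega>. real (C1 n (G_rel n \<omega> a k)) / real n \<le> \<epsilon>"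
  have large: "{\<omega>. \<epsilon> < real (C1 n (G_rel n \<omega> a k)) / real n} \<in> sets Omega"
    using pred_Omega_sets[OF G_rel_pred[of "\<lambda>R. \<epsilon> < real (C1 n R) / real n"]] .
  have small: "Measurable.pred Omega (\<lambda>\<omega>. p \<in> (G_rel n \<omega> a k)\<^sup>* \<and> ?S \<omega>)" for p
    using G_rel_pred[of "\<lambda>R. p \<in> R\<^sup>* \<and> real (C1 n R) / real n \<le> \<epsilon>"] .
  have "(\<Sum>p\<in>pairs n. Om.prob {\<omega>. p \<in> (G_rel n \<omega> a k)\<^sup>*}) \<le>
     (\<Sum>p\<in>pairs n. Om.prob {\<omega>. p \<in> (G_rel n \<omega> a k)\<^sup>* \<and> ?S \<omega>} + \<epsilon>)"
  proof (rule sum_mono)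
    fix p
    have "Om.prob {\<omega>. p \<in> (G_rel n \<omega> a k)\<^sup>*} \<le>
        Om.prob ({\<omega>. p \<in> (G_rel n \<omega> a k)\<^sup>* \<and> ?S \<omega>} \<union> {\<omega>. \<epsilon> < real (C1 n (G_rel n \<omega> a k)) / real n})"
      by (intro Om.finite_measure_mono sets.Un large pred_Omega_sets[OF small]) auto
    also have "\<dots> \<le> Om.prob {\<omega>. p \<in> (G_rel n \<omega> a k)\<^sup>* \<and> ?S \<omega>} + Om.prob {\<omega>. \<epsilon> < real (C1 n (G_rel n \<omega> a k)) / real n}"
      by (intro measure_Un_le large pred_Omega_sets[OF small])
    finally show "Om.prob {\<omega>. p \<in> (G_rel n \<omega> a k)\<^sup>*} \<le> Om.prob {\<omega>. p \<in> (G_rel n \<omega> a k)\<^sup>* \<and> ?S \<omega>} + \<epsilon>"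
      using conv by simp
  qed
  also have "\<dots> = (\<Sum>p\<in>pairs n. Om.prob {\<omega>. p \<in> (G_rel n \<omega> a k)\<^sup>* \<and> ?S \<omega>}) + real (card (pairs n)) * \<epsilon>"
    by (simp add: sum.distrib)
  also have "(\<Sum>p\<in>pairs n. Om.prob {\<omega>. p \<in> (G_rel n \<omega> a k)\<^sup>* \<and> ?S \<omega>}) \<le> \<epsilon> * (real n)\<^sup>2"
  proof (rule sum_prob_le_bound)
    show "AE \<omega> in Omega. real (card {p \<in> pairs n. p \<in> (G_rel n \<omega> a k)\<^sup>* \<and> ?S \<omega>}) \<le> \<epsilon> * (real n)\<^sup>2"
    proof (rule AE_I2)
      fix \<omega>
      let ?R = "G_rel n \<omega> a k"
      show "real (card {p \<in> pairs n. p \<in> ?R\<^sup>* \<and> ?S \<omega>}) \<le> \<epsilon> * (real n)\<^sup>2"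
      proof (cases "?S \<omega>")
        case True
        have "card {p \<in> pairs n. p \<in> ?R\<^sup>* \<and> ?S \<omega>} \<le> card (SIGMA u:{..<n}. component n ?R u)"
          by (rule card_mono) (auto simp: component_def pairs_def)
        also have "\<dots> = (\<Sum>u<n. card (component n ?R u))" by simp
        also have "\<dots> \<le> (\<Sum>u<n. C1 n ?R)"
          by (intro sum_mono card_comp_le_C1) auto
        finally have "real (card {p \<in> pairs n. p \<in> ?R\<^sup>* \<and> ?S \<omega>}) \<le> real (n * C1 n ?R)"
          by (simp only: of_nat_le_iff sum_constant card_lessThan of_nat_id)
        also have "\<dots> \<le> real n * (\<epsilon> * real n)"
          using True n by (simp add: field_simps)
        finally show ?thesis by (simp add: power2_eq_square mult_ac)
      next
        case False
        then show ?thesis using eps by simp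
      qed
    qed
  qed (simp_all add: small)
  also have "real (card (pairs n)) * \<epsilon> \<le> real (n * n) * \<epsilon>"
    using card_pairs_le[of n] eps by (intro mult_right_mono) (auto simp del: of_nat_mult)
  finally show ?thesis
    by (simp add: power2_eq_square mult_ac)
qed

text \<open>Double arrivals contribute at most t^2 in total. Early arrivals contribute a / n times
  an expected number o(n^2) of pairs connected in G_{k-1}(a); for \<open>k = 1\<close> this term
  vanishes as \<open>a = 0\<close>.\<close>

lemma sum_prob_bad_pairs:
  assumes a: "0 \<le> a" "a \<le> t" and \<eta>: "0 < \<eta>"
    and start: "(k = 1 \<and> a = 0) \<or> (2 \<le> k \<and> conv_unif_prob (k - 1) f \<and> f a = 0)"
  obtains N where "\<And>n. N \<le> n \<Longrightarrow> 0 < n \<Longrightarrow> (\<Sum>p\<in>pairs n. Om.prob {\<omega>. bad_pair n a t k p \<omega>}) \<le> \<eta> * real n"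
proof -
  \<comment> \<open>Makes a / n * exp a * 2 \<epsilon> n^2 at most \<eta> n / 2; writing
    \<open>a + 1\<close> avoids a zero denominator.\<close>
  define \<epsilon> where "\<epsilon> = \<eta> / (4 * (a + 1) * exp a)"
  have eps: "0 < \<epsilon>" using \<eta> a by (simp add: \<epsilon>_def)
  have "\<exists>N. \<forall>n\<ge>N. 2 \<le> k \<longrightarrow> Om.prob {\<omega>. \<epsilon> < real (C1 n (G_rel n \<omega> a (k - 1))) / real n} \<le> \<epsilon>"
  proof (cases "2 \<le> k")
    case True
    then have f: "conv_unif_prob (k - 1) f" "f a = 0" using start by auto
    obtain N where "\<And>n. N \<le> n \<Longrightarrow>
      Om.prob {\<omega>. \<epsilon> < \<bar>real (C1 n (G_rel n \<omega> a (k - 1))) / real n - f a\<bar>} < \<epsilon>"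
      using conv_unif_probD[OF f(1) a(1) eps eps] by blast
    then show ?thesis using f(2) by (intro exI[of _ N]) (auto simp: less_imp_le)
  qed auto
  then obtain N where N: "\<And>n. N \<le> n \<Longrightarrow> 2 \<le> k \<Longrightarrow>
    Om.prob {\<omega>. \<epsilon> < real (C1 n (G_rel n \<omega> a (k - 1))) / real n} \<le> \<epsilon>" by blast
  obtain N' :: nat where N': "2 * t\<^sup>2 / \<eta> \<le> real N'" using real_arch_simple by blast
  show thesis
  proof (rule that[of "max N N'"])
    fix n :: nat assume n': "max N N' \<le> n" and n: "0 < n"
    let ?c = "\<lambda>p. if 2 \<le> k then exp a * Om.prob {\<omega>. p \<in> (G_rel n \<omega> a (k - 1))\<^sup>*} else 1"
    have t2: "t\<^sup>2 \<le> \<eta> / 2 * real n"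
    proof -
      have "2 * t\<^sup>2 / \<eta> \<le> real n" using N' n' by (meson max.boundedE of_nat_mono order_trans)
      then show ?thesis using \<eta> by (simp add: field_simps)
    qed
    have "(\<Sum>p\<in>pairs n. Om.prob {\<omega>. bad_pair n a t k p \<omega>}) \<le> (\<Sum>p\<in>pairs n. (t / real n)\<^sup>2 + a / real n * ?c p)"
      by (intro sum_mono prob_bad_pair n a)
    also have "\<dots> = real (card (pairs n)) * (t / real n)\<^sup>2 + a / real n * (\<Sum>p\<in>pairs n. ?c p)"
      by (simp add: sum.distrib sum_distrib_left)
    also have "real (card (pairs n)) * (t / real n)\<^sup>2 \<le> real (n * n) * (t / real n)\<^sup>2"
      using card_pairs_le[of n] by (intro mult_right_mono) (auto simp del: of_nat_mult)
    also have "\<dots> = t\<^sup>2" using n by (simp add: power2_eq_square field_simps)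
    also have "a / real n * (\<Sum>p\<in>pairs n. ?c p) \<le> \<eta> / 2 * real n"
    proof (cases "2 \<le> k")
      case True
      have "(\<Sum>p\<in>pairs n. ?c p) = exp a * (\<Sum>p\<in>pairs n. Om.prob {\<omega>. p \<in> (G_rel n \<omega> a (k - 1))\<^sup>*})"
        using True by (simp add: sum_distrib_left)
      also have "\<dots> \<le> exp a * (2 * \<epsilon> * (real n)\<^sup>2)"
        using N[of n] n' True eps by (intro mult_left_mono sum_prob_conn n) auto
      finally have "a / real n * (\<Sum>p\<in>pairs n. ?c p) \<le> a / real n * (exp a * (2 * \<epsilon> * (real n)\<^sup>2))"
        using a by (intro mult_left_mono) auto
      also have "\<dots> = 2 * exp a * \<epsilon> * real n * a"
        using n by (simp add: power2_eq_square field_simps)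
      also have "\<dots> \<le> 2 * exp a * \<epsilon> * real n * (a + 1)"
        using eps by (intro mult_left_mono) auto
      also have "\<dots> = \<epsilon> * (4 * (a + 1) * exp a) / 2 * real n"
        by (simp add: algebra_simps)
      also have "\<epsilon> * (4 * (a + 1) * exp a) = \<eta>"
      proof -
        have "x / w * w = x" if "w \<noteq> 0" for x w :: real using that by simp
        then show ?thesis unfolding \<epsilon>_def by this (use a in simp)
      qed
      finally show ?thesis by simp
    next
      case False
      then have "a = 0" using start by auto
      then show ?thesis using \<eta> by simp
    qed
    finally show "(\<Sum>p\<in>pairs n. Om.prob {\<omega>. bad_pair n a t k p \<omega>}) \<le> \<eta> * real n"
      using t2 by (simp add: algebra_simps)
  qed
qed

text \<open>Glue the subcritical graph along the few vertices of bad pairs. With truncation size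
  \<open>L\<close> in \<open>C1_glue_bound\<close>, the large late components, the glued small ones
  and the additive term each cost at most c n / 8, in total less than the c n / 2 that convergence
  guarantees.\<close>

lemma subcritical_limit_le_0:
  assumes a: "0 \<le> a" "a \<le> t" "t < a + 1"
    and start: "(k = 1 \<and> a = 0) \<or> (2 \<le> k \<and> conv_unif_prob (k - 1) f \<and> f a = 0)"
    and conv: "conv_unif_prob k g"
  shows "g t \<le> 0"
proof (rule ccontr)
  assume "\<not> g t \<le> 0"
  define c where "c = g t"
  have c: "0 < c" using \<open>\<not> g t \<le> 0\<close> by (simp add: c_def)
  define D where "D = 1 / (1 - (t - a))"
  have D: "0 < D" using a by (simp add: D_def)
  \<comment> \<open>\<open>D\<close> bounds the mean size of a late component. Markov allows 4 D n
    connected pairs, and this \<open>L\<close> makes 4 D n at most L c n / 8.\<close>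
  obtain L :: nat where L: "32 * D / c < real L" using reals_Archimedean2 by blast
  have L0: "0 < real L"
    by (rule le_less_trans[OF _ L]) (use D c in simp)
  have LD: "4 * D \<le> real L * c / 8" using L c by (simp add: field_simps)
  \<comment> \<open>There are at most 2 \<eta> n vertices in bad pairs, and each glues in fewer than
    \<open>L\<close> vertices: 2 \<eta> n L = c n / 8.\<close>
  define \<eta> where "\<eta> = c / (16 * real L)"
  have \<eta>: "0 < \<eta> / 4" using c L0 by (simp add: \<eta>_def)
  obtain N1 where N1: "\<And>n. N1 \<le> n \<Longrightarrow> 0 < n \<Longrightarrow>
      (\<Sum>p\<in>pairs n. Om.prob {\<omega>. bad_pair n a t k p \<omega>}) \<le> \<eta> / 4 * real n"
    using sum_prob_bad_pairs[OF a(1,2) \<eta> start] by blast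
  have t: "0 \<le> t" using a by simp
  obtain N2 where N2: "\<And>n. N2 \<le> n \<Longrightarrow>
      Om.prob {\<omega>. c / 2 < \<bar>real (C1 n (G_rel n \<omega> t k)) / real n - g t\<bar>} < 1 / 4"
    using conv_unif_probD[OF conv t, of "c / 2" "1 / 4"] c by auto
  obtain N3 :: nat where N3: "8 * real L / c \<le> real N3" using real_arch_simple by blast
  define n where "n = Suc (max N1 (max N2 N3))"
  have n: "0 < n" "N1 \<le> n" "N2 \<le> n" "N3 \<le> n" by (auto simp: n_def)
  have Ln: "real L \<le> c * real n / 8"
  proof -
    have "8 * real L / c \<le> real n" using N3 n(4) by (meson of_nat_mono order_trans)
    then show ?thesis using c by (simp add: field_simps)
  qed
  define B1 where "B1 = {\<omega>. \<eta> * real n \<le> real (card {p \<in> pairs n. bad_pair n a t k p \<omega>})}"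
  define B2 where "B2 = {\<omega>. 4 * D * real n \<le>
      real (card {p \<in> {..<n} \<times> {..<n}. p \<in> (late_rel n a t \<omega>)\<^sup>*})}"
  define B3 where "B3 = {\<omega>. c / 2 < \<bar>real (C1 n (G_rel n \<omega> t k)) / real n - g t\<bar>}"
  have m2: "Measurable.pred Omega (\<lambda>\<omega>. p \<in> (late_rel n a t \<omega>)\<^sup>*)" if "p \<in> {..<n} \<times> {..<n}" for p
    using that late_conn_measurable[of "fst p" n "snd p"] by auto
  have [measurable]: "(\<lambda>\<omega>. real (card {p \<in> pairs n. bad_pair n a t k p \<omega>})) \<in> borel_measurable Omega"
    by (intro card_pred) auto
  have [measurable]: "(\<lambda>\<omega>. real (card {p \<in> {..<n} \<times> {..<n}. p \<in> (late_rel n a t \<omega>)\<^sup>*})) \<in> borel_measurable Omega"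
    by (intro card_pred m2) auto
  have B1: "B1 \<in> sets Omega" unfolding B1_def by (rule pred_Omega_sets) measurable
  have B2: "B2 \<in> sets Omega" unfolding B2_def by (rule pred_Omega_sets) measurable
  have B3: "B3 \<in> sets Omega" unfolding B3_def
    using pred_Omega_sets[OF G_rel_pred[of "\<lambda>R. c / 2 < \<bar>real (C1 n R) / real n - g t\<bar>"]] .
  have "Om.prob B1 \<le> (\<Sum>p\<in>pairs n. Om.prob {\<omega>. bad_pair n a t k p \<omega>}) / (\<eta> * real n)"
    unfolding B1_def using \<eta> n by (intro prob_card_ge_le) auto
  also have "\<dots> \<le> (\<eta> / 4 * real n) / (\<eta> * real n)"
    using N1[OF n(2,1)] \<eta> by (intro divide_right_mono) auto
  also have "\<dots> = 1 / 4" using \<eta> n by simp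
  finally have p1: "Om.prob B1 \<le> 1 / 4" .
  have "Om.prob B2 \<le> (\<Sum>p\<in>{..<n} \<times> {..<n}. Om.prob {\<omega>. p \<in> (late_rel n a t \<omega>)\<^sup>*}) / (4 * D * real n)"
    unfolding B2_def using D n by (intro prob_card_ge_le m2) auto
  also have "(\<Sum>p\<in>{..<n} \<times> {..<n}. Om.prob {\<omega>. p \<in> (late_rel n a t \<omega>)\<^sup>*}) =
      (\<Sum>x<n. \<Sum>w<n. Om.prob {\<omega>. (x, w) \<in> (late_rel n a t \<omega>)\<^sup>*})"
    by (simp add: sum.cartesian_product case_prod_unfold)
  also have "\<dots> / (4 * D * real n) \<le> (\<Sum>x<n. D) / (4 * D * real n)"
    unfolding D_def using a by (intro divide_right_mono sum_mono sum_prob_late_conn) auto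
  also have "\<dots> = 1 / 4" using D n by simp
  finally have p2: "Om.prob B2 \<le> 1 / 4" .
  have "Om.prob (B1 \<union> (B2 \<union> B3)) \<le> Om.prob B1 + (Om.prob B2 + Om.prob B3)"
    using measure_Un_le[OF B1 sets.Un[OF B2 B3]] measure_Un_le[OF B2 B3] by simp
  also have "\<dots> < 1" using p1 p2 N2[OF n(3)] by (simp add: B3_def)
  finally obtain \<omega> where \<omega>: "good \<omega>" "\<omega> \<notin> B1 \<union> (B2 \<union> B3)"
    using exists_good[of "B1 \<union> (B2 \<union> B3)"] B1 B2 B3 by blast
  let ?P = "{p \<in> pairs n. bad_pair n a t k p \<omega>}"
  let ?X = "\<Union>p\<in>?P. {fst p, snd p}"
  let ?Z = "card {(x, w). x < n \<and> w < n \<and> (x, w) \<in> (late_rel n a t \<omega>)\<^sup>*}"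
  have "{(x, w). x < n \<and> w < n \<and> (x, w) \<in> (late_rel n a t \<omega>)\<^sup>*} =
      {p \<in> {..<n} \<times> {..<n}. p \<in> (late_rel n a t \<omega>)\<^sup>*}" by auto
  then have Z: "real ?Z < 4 * D * real n" using \<omega>(2) by (simp add: B2_def)
  have "card ?X \<le> (\<Sum>p\<in>?P. card {fst p, snd p})"
    by (intro card_UN_le) simp
  also have "\<dots> \<le> (\<Sum>p\<in>?P. 2)"
    by (intro sum_mono) (simp add: card_insert_if)
  finally have "card ?X \<le> card ?P * 2" by simp
  then have "real (card ?X) \<le> real (card ?P * 2)" by (simp only: of_nat_le_iff)
  then have X: "real (card ?X) \<le> 2 * (\<eta> * real n)" using \<omega>(2) by (simp add: B1_def)
  have "c / 2 \<le> real (C1 n (G_rel n \<omega> t k)) / real n"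
    using \<omega>(2) unfolding B3_def c_def[symmetric] by (simp add: abs_if split: if_splits)
  then have C1: "c / 2 * real n \<le> real (C1 n (G_rel n \<omega> t k))"
    using n by (simp add: field_simps)
  have "L * C1 n (G_rel n \<omega> t k) \<le> ?Z + L * (L * (card ?X + 1))"
    using C1_glue_bound[OF n(1) sym_late_rel G_rel_cover[OF \<omega>(1) n(1) a(1,2)]] by simp
  then have "real (L * C1 n (G_rel n \<omega> t k)) \<le> real (?Z + L * (L * (card ?X + 1)))"
    by (simp only: of_nat_le_iff)
  then have main: "real L * real (C1 n (G_rel n \<omega> t k)) \<le> real ?Z + real L * (real L * (real (card ?X) + 1))"
    by (simp add: algebra_simps)
  have "real L * (c / 2 * real n) \<le> real L * real (C1 n (G_rel n \<omega> t k))"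
    using C1 by (intro mult_left_mono) auto
  also note main
  also have "real ?Z + real L * (real L * (real (card ?X) + 1)) <
      real L * c / 8 * real n + real L * (real L * (2 * (\<eta> * real n) + 1))"
  proof (rule add_less_le_mono)
    have "4 * D * real n \<le> real L * c / 8 * real n"
      using LD by (intro mult_right_mono) auto
    then show "real ?Z < real L * c / 8 * real n" using Z by simp
    show "real L * (real L * (real (card ?X) + 1)) \<le> real L * (real L * (2 * (\<eta> * real n) + 1))"
      using X by (intro mult_left_mono) auto
  qed
  also have "\<dots> = real L * (c / 4 * real n + real L)"
    using L0 by (simp add: \<eta>_def field_simps)
  also have "\<dots> \<le> real L * (c / 4 * real n + c * real n / 8)"
    using Ln by (intro mult_left_mono) auto
  also have "\<dots> \<le> real L * (c / 2 * real n)"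
    using c by (intro mult_left_mono) (auto simp: field_simps)
  finally show False by simp
qed

subsection \<open>Uniqueness of the giant component\<close>

text \<open>Sizes are read off at the earlier time \<open>s\<close> and separation at the later time
  \<open>t\<close>; in between, large components have time to be joined. The predicate is applied to
  true and to killed samples.\<close>

definition separated :: "nat \<Rightarrow> real \<Rightarrow> real \<Rightarrow> real \<Rightarrow> nat \<Rightarrow> nat \<times> nat \<Rightarrow> sample \<Rightarrow> bool" where
  "separated n d s t k p \<omega> \<longleftrightarrow>
     d * real n \<le> real (card (component n (G_rel n \<omega> s k) (fst p))) \<and>
     d * real n \<le> real (card (component n (G_rel n \<omega> s k) (snd p))) \<and>
     p \<notin> (G_rel n \<omega> t k)\<^sup>*"

text \<open>Requiring the second inter-arrival time to exceed \<open>t\<close> is stronger than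
  having no second arrival by \<open>t\<close>, but makes this a product event in two independent
  clocks.\<close>

definition single_arrival :: "nat \<Rightarrow> real \<Rightarrow> real \<Rightarrow> nat \<times> nat \<Rightarrow> sample \<Rightarrow> bool" where
  "single_arrival n s t p \<omega> \<longleftrightarrow>
     (s < real n * \<omega> (fst p, snd p, 0) \<and> real n * \<omega> (fst p, snd p, 0) \<le> t) \<and>
     t < real n * \<omega> (fst p, snd p, Suc 0)"

lemma separated_measurable [measurable]: "Measurable.pred Omega (separated n d s t k p)"
proof -
  have 1: "Measurable.pred Omega (\<lambda>\<omega>. d * real n \<le> real (card (component n (G_rel n \<omega> s k) (fst p))) \<and>
     d * real n \<le> real (card (component n (G_rel n \<omega> s k) (snd p))))"
    using G_rel_pred[of "\<lambda>R. d * real n \<le> real (card (component n R (fst p))) \<and> d * real n \<le> real (card (component n R (snd p)))"] .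
  have 2: "Measurable.pred Omega (\<lambda>\<omega>. p \<notin> (G_rel n \<omega> t k)\<^sup>*)"
    using G_rel_pred[of "\<lambda>R. p \<notin> R\<^sup>*"] .
  show ?thesis
    using pred_intros_logic(3)[OF 1 2] by (simp add: separated_def[abs_def] conj_assoc)
qed

lemma single_arrival_measurable [measurable]: "Measurable.pred Omega (single_arrival n s t p)"
  unfolding single_arrival_def[abs_def] by measurable

lemma split_two_elements:
  assumes "pre @ x # post = pre' @ x' # post'" "x \<noteq> x'"
  shows "x \<in> set pre' \<or> x' \<in> set pre"
  using assms by (auto simp: append_eq_append_conv2 append_eq_Cons_conv Cons_eq_append_conv)

text \<open>Translates the killed event into facts about the true process. The prefix before the
  arrival is common to both; as the pair stays apart in the killed graph up to \<open>t\<close>, it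
  is apart on the prefix, which bounds the level by \<open>k\<close>.\<close>

lemma separated_edge:
  assumes g: "good \<omega>" and n: "0 < n" and st: "0 \<le> s" "s < t" and k: "1 \<le> k"
    and p: "p \<in> pairs n" "single_arrival n s t p \<omega>" "separated n d s t k p (kill (t + 1) {p} \<omega>)"
  defines "x \<equiv> (fst p, snd p, 0)"
  defines "pre \<equiv> takeWhile (\<lambda>y. y \<noteq> x) (elist n \<omega> t)"
  shows "\<exists>post. elist n \<omega> t = pre @ x # post" "\<exists>mid. pre = elist n \<omega> s @ mid"
    "1 \<le> new_level (lab pre) x" "new_level (lab pre) x \<le> k"
    "d * real n \<le> real (card (component n (G_rel n \<omega> s k) (fst p)))"
    "d * real n \<le> real (card (component n (G_rel n \<omega> s k) (snd p)))"
proof -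
  obtain u v where p': "p = (u, v)" by (cases p)
  have x: "x = (u, v, 0)" by (simp add: x_def p')
  have uv: "u < v" "v < n" using p(1) by (auto simp: pairs_def p')
  have arr: "s < real n * \<omega> (u, v, 0)" "real n * \<omega> (u, v, 0) \<le> t" "t < real n * \<omega> (u, v, Suc 0)"
    using p(2) by (auto simp: single_arrival_def p')
  have t: "0 \<le> t" using st by simp
  have b: "0 < t + 1" "t < real n * (t + 1)" "s < real n * (t + 1)"
    using less_times_Suc[OF n t] st by auto
  have "arrival n \<omega> (u, v, 0) \<le> t" using arr by (simp add: arrival_0)
  moreover have "t < arrival n \<omega> (u, v, Suc 0)"
    using arr(1,3) st(1) by (simp add: arrival_1 distrib_left)
  ultimately obtain pr post where split: "elist n \<omega> t = pr @ x # post"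
    and kill: "elist n (kill (t + 1) {(u, v)} \<omega>) t = pr @ post"
    unfolding x by (rule elist_split_single[OF g b(1,2) uv])
  have "y \<noteq> x" if "y \<in> set pr" for y
    using distinct_elist[OF finite_edges_upto[OF g], of n t] that unfolding split by auto
  then have pre: "pre = pr"
    unfolding pre_def split by (subst takeWhile_append2) auto
  show "\<exists>post. elist n \<omega> t = pre @ x # post" using split pre by blast
  obtain rest where rest: "elist n \<omega> t = elist n \<omega> s @ rest"
    using elist_prefix[OF g less_imp_le[OF st(2)]] by blast
  have "x \<notin> set (elist n \<omega> s)"
    using arr(1) set_elist_subset[of n \<omega> s] by (auto simp: x edges_upto_def arrival_0)
  then show "\<exists>mid. pre = elist n \<omega> s @ mid"
    using rest unfolding split pre
    by (auto simp: append_eq_append_conv2 append_eq_Cons_conv Cons_eq_append_conv) (metis in_set_conv_decomp)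
  have xne: "fst x \<noteq> fst (snd x)" using uv by (simp add: x)
  show "1 \<le> new_level (lab pre) x" by (rule new_level_notin(1)[OF xne])
  have "(u, v) \<notin> (level_rel (lab (pr @ post)) k)\<^sup>*"
    using p(3) kill by (simp add: separated_def p' G_rel_eq)
  then have "epair x \<notin> (level_rel (lab pre) k)\<^sup>*"
    using rtrancl_level_lab_mono[of u v pr k k post] by (auto simp: pre x)
  then show "new_level (lab pre) x \<le> k"
    using less_new_level_iff[OF xne k, of "lab pre"] by simp
  \<comment> \<open>The pair is still empty at time \<open>s\<close>, so component sizes at
    \<open>s\<close> agree in the killed and the true graph.\<close>
  have "G_rel n (kill (t + 1) {(u, v)} \<omega>) s k = G_rel n \<omega> s k"
    using arr(1) by (intro G_rel_kill_eq[OF g b(1,3)]) auto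
  then show "d * real n \<le> real (card (component n (G_rel n \<omega> s k) (fst p)))"
    "d * real n \<le> real (card (component n (G_rel n \<omega> s k) (snd p)))"
    using p(3) by (auto simp: separated_def p')
qed

lemma card_large_components:
  assumes "sym R" "0 < d" "0 < n"
  shows "real (card ((\<lambda>v. component n R v) ` {v. v < n \<and> d * real n \<le> real (card (component n R v))})) \<le> 1 / d"
proof -
  let ?S = "(\<lambda>v. component n R v) ` {v. v < n \<and> d * real n \<le> real (card (component n R v))}"
  have fin: "finite ?S" by simp
  have disj: "A \<inter> B = {}" if "A \<in> ?S" "B \<in> ?S" "A \<noteq> B" for A B
  proof (rule ccontr)
    assume "A \<inter> B \<noteq> {}"
    then obtain w a b where w: "A = component n R a" "B = component n R b" "(a, w) \<in> R\<^sup>*" "(b, w) \<in> R\<^sup>*"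
      using \<open>A \<in> ?S\<close> \<open>B \<in> ?S\<close> by (auto simp: component_def)
    then show False
      using comp_eq[OF assms(1)] \<open>A \<noteq> B\<close> by metis
  qed
  have "real (card ?S) * (d * real n) = (\<Sum>A\<in>?S. d * real n)" by simp
  also have "\<dots> \<le> (\<Sum>A\<in>?S. real (card A))"
    by (intro sum_mono) auto
  also have "\<dots> = real (card (\<Union>?S))"
    using disj by (subst card_Union_disjoint) (auto simp: pairwise_def disjnt_def)
  also have "\<dots> \<le> real (card {..<n})"
    by (intro of_nat_mono card_mono) (auto simp: component_def)
  finally have "real (card ?S) * d * real n \<le> 1 * real n" by simp
  then have "real (card ?S) * d \<le> 1" using assms(3) by (simp add: mult_le_cancel_right)
  then show ?thesis using assms(2) by (simp add: field_simps)
qed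

text \<open>Edges crossing between two fixed components of \<open>G\<^sub>k(s)\<close> have distinct levels as long as these
  are at most \<open>k\<close>.\<close>

lemma card_separated_edges:
  assumes g: "good \<omega>" and n: "0 < n" and st: "0 \<le> s" "s < t" and k: "1 \<le> k" and d: "0 < d"
  shows "real (card {p \<in> pairs n. single_arrival n s t p \<omega> \<and> separated n d s t k p (kill (t + 1) {p} \<omega>)})
    \<le> real k / d\<^sup>2"
proof -
  let ?T = "{p \<in> pairs n. single_arrival n s t p \<omega> \<and> separated n d s t k p (kill (t + 1) {p} \<omega>)}"
  let ?R = "G_rel n \<omega> s k"
  let ?S = "(\<lambda>v. component n ?R v) ` {v. v < n \<and> d * real n \<le> real (card (component n ?R v))}"
  define x where "x p = (fst p, snd p, 0 :: nat)" for p :: "nat \<times> nat"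
  define pre where "pre p = takeWhile (\<lambda>y. y \<noteq> x p) (elist n \<omega> t)" for p
  \<comment> \<open>Injective by \<open>less\<close> below: of two edges with the same ordered pair
    of components, the later one has the larger level. At most 1 / d choices for each component and
    \<open>k\<close> for the level give the bound.\<close>
  define f where "f p = (component n ?R (fst p), component n ?R (snd p), new_level (lab (pre p)) (x p))" for p
  have E: "\<exists>post. elist n \<omega> t = pre p @ x p # post" "\<exists>mid. pre p = elist n \<omega> s @ mid"
    "1 \<le> new_level (lab (pre p)) (x p)" "new_level (lab (pre p)) (x p) \<le> k"
    "d * real n \<le> real (card (component n (G_rel n \<omega> s k) (fst p)))"
    "d * real n \<le> real (card (component n (G_rel n \<omega> s k) (snd p)))" if "p \<in> ?T" for p
    using separated_edge[OF g n st k, of p d] that unfolding x_def pre_def by auto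
  have less: "new_level (lab (pre p)) (x p) < new_level (lab (pre q)) (x q)"
    if T: "p \<in> ?T" "q \<in> ?T" and c: "component n ?R (fst p) = component n ?R (fst q)" "component n ?R (snd p) = component n ?R (snd q)"
      and mem: "x p \<in> set (pre q)" for p q
  proof -
    let ?l = "new_level (lab (pre p)) (x p)"
    obtain a b where pq: "pre q = a @ x p # b" by (meson mem split_list)
    obtain post where post: "elist n \<omega> t = pre q @ x q # post" using E(1)[OF T(2)] by blast
    obtain post' where post': "elist n \<omega> t = pre p @ x p # post'" using E(1)[OF T(1)] by blast
    have "distinct (elist n \<omega> t)" by (rule distinct_elist[OF finite_edges_upto[OF g]])
    then have "a = pre p"
      using post post' unfolding pq by (metis append.assoc append_Cons append_Cons_eq_iff distinct.simps(2) distinct_append not_distinct_conv_prefix)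
    then have xl: "(x p, ?l) \<in> set (lab (pre q))"
      using lab_split unfolding pq by metis
    obtain mid where mid: "pre q = elist n \<omega> s @ mid" using E(2)[OF T(2)] by blast
    have "(fst p, fst q) \<in> ?R\<^sup>*" "(snd p, snd q) \<in> ?R\<^sup>*"
    proof -
      have "fst q < n" "snd q < n" using T(2) by (auto simp: pairs_def)
      then have "fst q \<in> component n ?R (fst q)" "snd q \<in> component n ?R (snd q)" by (auto simp: component_def)
      then have "fst q \<in> component n ?R (fst p)" "snd q \<in> component n ?R (snd p)" unfolding c .
      then show "(fst p, fst q) \<in> ?R\<^sup>*" "(snd p, snd q) \<in> ?R\<^sup>*" by (simp_all add: component_def)
    qed
    then have conn: "(fst p, fst q) \<in> (level_rel (lab (pre q)) ?l)\<^sup>*" "(snd p, snd q) \<in> (level_rel (lab (pre q)) ?l)\<^sup>*"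
      unfolding mid G_rel_eq using rtrancl_level_lab_mono[OF _ E(4)[OF T(1)]] by auto
    show ?thesis
      using T conn by (intro crossing_level_less[OF _ xl E(3)[OF T(1)]]) (auto simp: x_def pairs_def)
  qed
  have inj: "inj_on f ?T"
  proof (rule inj_onI, rule ccontr)
    fix p q assume T: "p \<in> ?T" "q \<in> ?T" and eq: "f p = f q" and ne: "p \<noteq> q"
    have "x p \<noteq> x q" using ne by (auto simp: x_def prod_eq_iff)
    then have "x p \<in> set (pre q) \<or> x q \<in> set (pre p)"
      using E(1)[OF T(1)] E(1)[OF T(2)] split_two_elements by metis
    then show False
      using less[OF T] less[OF T(2,1)] eq by (auto simp: f_def)
  qed
  have "f ` ?T \<subseteq> ?S \<times> ?S \<times> {1..k}"
    using E(3-6) by (fastforce simp: f_def pairs_def)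
  then have "card ?T \<le> card (?S \<times> ?S \<times> {1..k})"
    using inj by (intro card_inj_on_le[of f]) auto
  then have "real (card ?T) \<le> real (card (?S \<times> ?S \<times> {1..k}))" by (rule of_nat_mono)
  also have "\<dots> = real (card ?S) * (real (card ?S) * real k)"
    by (simp add: card_cartesian_product)
  also have "\<dots> \<le> 1 / d * (1 / d * real k)"
    using card_large_components[OF sym_G_rel d n, of n \<omega> s k] d by (intro mult_mono) auto
  finally show ?thesis by (simp add: power2_eq_square)
qed

lemma exp_diff_ge:
  fixes c d :: real
  shows "(d - c) * exp (- d) \<le> exp (- c) - exp (- d)"
proof -
  have "(d - c) * exp (- d) \<le> (exp (d - c) - 1) * exp (- d)"
    using exp_ge_add_one_self[of "d - c"] by (intro mult_right_mono) (simp_all add: le_diff_eq add.commute)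
  also have "\<dots> = exp (- c) - exp (- d)"
    by (simp add: left_diff_distrib mult_exp_exp)
  finally show ?thesis .
qed

text \<open>One factor exp (- t) bounds the decay in the law of the first clock, the other the
  survival of the second; both absorb \<open>t / n\<close> into \<open>t\<close> to be uniform in
  \<open>n\<close>.\<close>

lemma prob_single_arrival:
  assumes n: "0 < n" and st: "0 \<le> s" "s \<le> t"
  shows "(t - s) / real n * exp (- (2 * t)) \<le> Om.prob {\<omega>. single_arrival n s t p \<omega>}"
proof -
  let ?e = "exp (- (t / real n))"
  have "Om.prob {\<omega>. single_arrival n s t p \<omega>} = (exp (- (s / real n)) - ?e) * ?e"
  proof -
    have "Om.prob {\<omega>. single_arrival n s t p \<omega>} =
      Om.prob {\<omega>. s < real n * \<omega> (fst p, snd p, 0) \<and> real n * \<omega> (fst p, snd p, 0) \<le> t} *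
      Om.prob {\<omega>. t < real n * \<omega> (fst p, snd p, Suc 0)}"
      unfolding single_arrival_def
      by (rule prob_indep2[where ?K1.0 = "{(fst p, snd p, 0)}" and ?K2.0 = "{(fst p, snd p, Suc 0)}"])
         (auto simp: depends_on_def)
    then show ?thesis
      using prob_first_between[OF st n] prob_first_gt[of t n] st n by simp
  qed
  moreover have "(t - s) / real n * exp (- (2 * t)) \<le> (exp (- (s / real n)) - ?e) * ?e"
  proof -
    have "t / real n \<le> t"
      using n st mult_left_mono[of 1 "real n" t] by (simp add: field_simps)
    then have e: "exp (- t) \<le> ?e" by simp
    have "(t - s) / real n * exp (- (2 * t)) = (t - s) / real n * exp (- t) * exp (- t)"
      by (simp add: mult_exp_exp)
    also have "\<dots> \<le> (t - s) / real n * ?e * ?e"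
      using e st by (intro mult_mono) auto
    also have "\<dots> = (t / real n - s / real n) * ?e * ?e"
      by (simp add: diff_divide_distrib)
    also have "\<dots> \<le> (exp (- (s / real n)) - ?e) * ?e"
      by (intro mult_right_mono exp_diff_ge) simp
    finally show ?thesis .
  qed
  ultimately show ?thesis by simp
qed

text \<open>By independence each killed pair counts with weight at least (t - s) exp (- 2 t) / n in
  the expectation bounded through \<open>card_separated_edges\<close>. Returning to the true sample
  costs t / n per pair, hence at most t n.\<close>

lemma sum_prob_separated:
  assumes n: "0 < n" and st: "0 \<le> s" "s < t" and k: "1 \<le> k" and d: "0 < d"
  shows "(\<Sum>p\<in>pairs n. Om.prob {\<omega>. separated n d s t k p \<omega>})
    \<le> (real k / d\<^sup>2 * exp (2 * t) / (t - s) + t) * real n"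
proof -
  let ?Q = "\<lambda>p \<omega>. separated n d s t k p (kill (t + 1) {p} \<omega>)"
  have Q: "Measurable.pred Omega (?Q p)" for p
    by (rule measurable_compose[OF kill_measurable separated_measurable])
  have [measurable]: "Measurable.pred Omega (?Q p)" for p by (rule Q)
  define c where "c = (t - s) / real n * exp (- (2 * t))"
  have c: "0 < c" using st n by (simp add: c_def)
  have t: "0 \<le> t" using st by simp
  have "c * (\<Sum>p\<in>pairs n. Om.prob {\<omega>. ?Q p \<omega>}) = (\<Sum>p\<in>pairs n. c * Om.prob {\<omega>. ?Q p \<omega>})"
    by (rule sum_distrib_left)
  also have "\<dots> \<le> (\<Sum>p\<in>pairs n. Om.prob {\<omega>. single_arrival n s t p \<omega> \<and> ?Q p \<omega>})"
  proof (rule sum_mono)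
    fix p
    have "Om.prob {\<omega>. single_arrival n s t p \<omega> \<and> ?Q p \<omega>} = Om.prob {\<omega>. single_arrival n s t p \<omega>} * Om.prob {\<omega>. ?Q p \<omega>}"
    proof (rule prob_indep2)
      show "depends_on {e. epair e \<in> {p}} (single_arrival n s t p)"
        by (auto simp: depends_on_def single_arrival_def)
      show "depends_on {e. epair e \<notin> {p}} (?Q p)" by (rule depends_on_kill)
    qed auto
    then show "c * Om.prob {\<omega>. ?Q p \<omega>} \<le> Om.prob {\<omega>. single_arrival n s t p \<omega> \<and> ?Q p \<omega>}"
      using prob_single_arrival[OF n st(1) less_imp_le[OF st(2)], of p]
      by (simp only: c_def[symmetric]) (rule mult_right_mono, simp_all)
  qed
  also have "\<dots> \<le> real k / d\<^sup>2"
  proof (rule sum_prob_le_bound)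
    show "AE \<omega> in Omega. real (card {p \<in> pairs n. single_arrival n s t p \<omega> \<and> ?Q p \<omega>}) \<le> real k / d\<^sup>2"
      using AE_good by eventually_elim (rule card_separated_edges[OF _ n st k d])
  qed auto
  finally have "(\<Sum>p\<in>pairs n. Om.prob {\<omega>. ?Q p \<omega>}) \<le> real k / d\<^sup>2 / c"
    using c by (simp only: pos_le_divide_eq mult.commute)
  also have "\<dots> = real k / d\<^sup>2 * exp (2 * t) / (t - s) * real n"
    using n st by (simp add: c_def exp_minus field_simps)
  finally have killed: "(\<Sum>p\<in>pairs n. Om.prob {\<omega>. ?Q p \<omega>}) \<le> real k / d\<^sup>2 * exp (2 * t) / (t - s) * real n" .
  have "(\<Sum>p\<in>pairs n. Om.prob {\<omega>. separated n d s t k p \<omega>}) \<le> (\<Sum>p\<in>pairs n. Om.prob {\<omega>. ?Q p \<omega>} + t / real n)"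
  proof (rule sum_mono)
    fix p :: "nat \<times> nat"
    let ?F = "\<lambda>\<omega>. real n * \<omega> (fst p, snd p, 0) \<le> t"
    have "Om.prob {\<omega>. separated n d s t k p \<omega>} \<le> Om.prob {\<omega>. ?Q p \<omega> \<or> ?F \<omega>}"
    proof (rule prob_mono_AE)
      fix \<omega> assume g: "good \<omega>" and sep: "separated n d s t k p \<omega>"
      show "?Q p \<omega> \<or> ?F \<omega>"
      proof (cases "?F \<omega>")
        case False
        have "s < real n * (t + 1)" using less_times_Suc[OF n t] st by simp
        then have "G_rel n (kill (t + 1) {p} \<omega>) s k = G_rel n \<omega> s k" "G_rel n (kill (t + 1) {p} \<omega>) t k = G_rel n \<omega> t k"
          using False st less_times_Suc[OF n t] by - (rule G_rel_kill_eq[OF g]; force)+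
        then show ?thesis using sep by (simp add: separated_def)
      qed simp
    qed auto
    also have "{\<omega>. ?Q p \<omega> \<or> ?F \<omega>} = {\<omega>. ?Q p \<omega>} \<union> {\<omega>. ?F \<omega>}" by auto
    also have "Om.prob \<dots> \<le> Om.prob {\<omega>. ?Q p \<omega>} + Om.prob {\<omega>. ?F \<omega>}"
      by (intro measure_Un_le pred_Omega_sets; measurable)
    also have "Om.prob {\<omega>. ?F \<omega>} \<le> t / real n" by (rule prob_first_le[OF t n])
    finally show "Om.prob {\<omega>. separated n d s t k p \<omega>} \<le> Om.prob {\<omega>. ?Q p \<omega>} + t / real n" by simp
  qed
  also have "\<dots> = (\<Sum>p\<in>pairs n. Om.prob {\<omega>. ?Q p \<omega>}) + real (card (pairs n)) * (t / real n)"
    by (simp add: sum.distrib)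
  also have "real (card (pairs n)) * (t / real n) \<le> real (n * n) * (t / real n)"
    using card_pairs_le[of n] t by (intro mult_right_mono) (auto simp del: of_nat_mult)
  also have "real (n * n) * (t / real n) = t * real n" using n by simp
  finally show ?thesis using killed by (simp add: algebra_simps)
qed

text \<open>Markov: a mean of order \<open>n\<close> against a threshold of order n^2.\<close>

lemma prob_two_large_components:
  assumes st: "0 \<le> s" "s < t" and k: "1 \<le> k" and d: "0 < d"
  obtains C where "\<And>n. 0 < n \<Longrightarrow>
    Om.prob {\<omega>. d\<^sup>2 * (real n)\<^sup>2 / 2 \<le> real (card {p \<in> pairs n. separated n d s t k p \<omega>})} \<le> C / real n"
proof -
  define K where "K = real k / d\<^sup>2 * exp (2 * t) / (t - s) + t"
  have "Om.prob {\<omega>. d\<^sup>2 * (real n)\<^sup>2 / 2 \<le> real (card {p \<in> pairs n. separated n d s t k p \<omega>})} \<le> 2 * K / d\<^sup>2 / real n"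
    if n: "0 < n" for n
  proof -
    have "Om.prob {\<omega>. d\<^sup>2 * (real n)\<^sup>2 / 2 \<le> real (card {p \<in> pairs n. separated n d s t k p \<omega>})}
      \<le> (\<Sum>p\<in>pairs n. Om.prob {\<omega>. separated n d s t k p \<omega>}) / (d\<^sup>2 * (real n)\<^sup>2 / 2)"
      using n d by (intro prob_card_ge_le) auto
    also have "\<dots> \<le> K * real n / (d\<^sup>2 * (real n)\<^sup>2 / 2)"
      unfolding K_def using n by (intro divide_right_mono sum_prob_separated[OF _ st k d]) auto
    also have "\<dots> = 2 * K / d\<^sup>2 / real n"
      using n d by (simp add: power2_eq_square field_simps)
    finally show ?thesis .
  qed
  then show thesis by (rule that)
qed

lemma large_components_joined:
  assumes g: "good \<omega>" and n: "0 < n" and st: "s \<le> t" and d: "0 \<le> d"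
    and few: "real (card {p \<in> pairs n. separated n d s t k p \<omega>}) < d\<^sup>2 * (real n)\<^sup>2 / 2"
    and u: "u < n" "d * real n \<le> real (card (component n (G_rel n \<omega> s k) u))"
    and v: "v < n" "d * real n \<le> real (card (component n (G_rel n \<omega> s k) v))"
  shows "(u, v) \<in> (G_rel n \<omega> t k)\<^sup>*"
proof (rule ccontr)
  assume nconn: "(u, v) \<notin> (G_rel n \<omega> t k)\<^sup>*"
  let ?R = "G_rel n \<omega> s k" and ?R' = "G_rel n \<omega> t k"
  let ?S = "{p \<in> pairs n. separated n d s t k p \<omega>}"
  have sub: "?R\<^sup>* \<subseteq> ?R'\<^sup>*" by (rule rtrancl_mono[OF G_rel_mono_time[OF g st]])
  have sy: "(b, a) \<in> ?R'\<^sup>*" if "(a, b) \<in> ?R'\<^sup>*" for a b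
    using that sym_rtrancl[OF sym_G_rel, of n \<omega> t k] by (auto dest: symD)
  \<comment> \<open>\<open>pairs n\<close> lists each unordered pair once; the swapped copy covers
    \<open>a > b\<close> and accounts for the 2 in \<open>few\<close>.\<close>
  have "component n ?R u \<times> component n ?R v \<subseteq> ?S \<union> prod.swap ` ?S"
  proof safe
    fix a b assume ab: "a \<in> component n ?R u" "b \<in> component n ?R v" and "(a, b) \<notin> prod.swap ` ?S"
    have ca: "component n ?R a = component n ?R u" "component n ?R b = component n ?R v"
      using ab comp_eq[OF sym_G_rel, of u a n \<omega> s k n] comp_eq[OF sym_G_rel, of v b n \<omega> s k n]
      by (auto simp: component_def)
    have "(u, a) \<in> ?R'\<^sup>*" "(v, b) \<in> ?R'\<^sup>*" using ab sub by (auto simp: component_def)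
    then have nc: "(a, b) \<notin> ?R'\<^sup>*" "(b, a) \<notin> ?R'\<^sup>*"
      using nconn sy by (meson rtrancl_trans)+
    then have "a \<noteq> b" by auto
    moreover have "a < n" "b < n" using ab by (auto simp: component_def)
    moreover have "separated n d s t k (a, b) \<omega>" "separated n d s t k (b, a) \<omega>"
      using u(2) v(2) ca nc by (auto simp: separated_def)
    moreover have "(b, a) \<notin> ?S" using \<open>(a, b) \<notin> prod.swap ` ?S\<close> by force
    ultimately show "(a, b) \<in> pairs n" "separated n d s t k (a, b) \<omega>"
      by (auto simp: pairs_def)
  qed
  then have "card (component n ?R u \<times> component n ?R v) \<le> card (?S \<union> prod.swap ` ?S)"
    by (intro card_mono) auto
  also have "\<dots> \<le> card ?S + card (prod.swap ` ?S)" by (rule card_Un_le)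
  also have "\<dots> \<le> card ?S + card ?S" by (intro add_mono card_image_le) auto
  finally have "card (component n ?R u) * card (component n ?R v) \<le> 2 * card ?S"
    by (simp add: card_cartesian_product)
  then have "real (card (component n ?R u) * card (component n ?R v)) \<le> real (2 * card ?S)"
    by (simp only: of_nat_le_iff)
  moreover have "(d * real n) * (d * real n) \<le> real (card (component n ?R u)) * real (card (component n ?R v))"
    using u(2) v(2) d by (intro mult_mono) auto
  ultimately show False
    using few by (simp add: power2_eq_square mult_ac)
qed

subsection \<open>Vertices that enter the giant component late\<close>

lemma prob_disjoint_ex:
  assumes "finite F" "\<And>i. i \<in> F \<Longrightarrow> Measurable.pred Omega (Q i)"
    and "\<And>i j \<omega>. i \<in> F \<Longrightarrow> j \<in> F \<Longrightarrow> Q i \<omega> \<Longrightarrow> Q j \<omega> \<Longrightarrow> i = j"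
  shows "Om.prob {\<omega>. \<exists>i\<in>F. Q i \<omega>} = (\<Sum>i\<in>F. Om.prob {\<omega>. Q i \<omega>})"
proof -
  have "{\<omega>. \<exists>i\<in>F. Q i \<omega>} = (\<Union>i\<in>F. {\<omega>. Q i \<omega>})" by auto
  also have "Om.prob \<dots> = (\<Sum>i\<in>F. Om.prob {\<omega>. Q i \<omega>})"
    using assms(3) by (intro Om.finite_measure_finite_Union assms(1))
      (auto simp: disjoint_family_on_def intro!: pred_Omega_sets assms(2))
  finally show ?thesis .
qed

definition vpair :: "nat \<Rightarrow> nat \<Rightarrow> nat \<times> nat" where
  "vpair v w = (min v w, max v w)"

lemma vpair_inj: "vpair v w = vpair v w' \<Longrightarrow> w = w'"
  by (auto simp: vpair_def min_def max_def split: if_splits)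

definition star_pairs :: "nat \<Rightarrow> (nat \<times> nat) set" where
  "star_pairs v = {p. fst p = v \<or> snd p = v}"

lemma vpair_star: "vpair v w \<in> star_pairs v"
  by (auto simp: vpair_def star_pairs_def min_def max_def)

definition first_time :: "nat \<Rightarrow> sample \<Rightarrow> nat \<times> nat \<Rightarrow> real" where
  "first_time n \<omega> p = real n * \<omega> (fst p, snd p, 0)"

lemma first_time_measurable [measurable]: "(\<lambda>\<omega>. first_time n \<omega> p) \<in> borel_measurable Omega"
  unfolding first_time_def by measurable

text \<open>\<open>W\<close> is the exact set of neighbours of \<open>v\<close> in G_1(t) for good
  samples. Forbidding all other arrivals makes the events for different \<open>W\<close> disjoint,
  so that their probabilities add.\<close>

definition star_at :: "nat \<Rightarrow> real \<Rightarrow> real \<Rightarrow> nat \<Rightarrow> nat set \<Rightarrow> sample \<Rightarrow> bool" where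
  "star_at n s t v W \<omega> \<longleftrightarrow> (\<forall>w\<in>{..<n} - {v}.
     if w \<in> W then single_arrival n s t (vpair v w) \<omega> else t < first_time n \<omega> (vpair v w))"

lemma star_at_measurable [measurable]: "Measurable.pred Omega (star_at n s t v W)"
  unfolding star_at_def[abs_def] by (intro pred_intros_finite) auto

lemma disjoint_vpair_blocks: "disjoint_family_on (\<lambda>w. {e. epair e = vpair v w}) L"
  using vpair_inj by (auto simp: disjoint_family_on_def)

lemma prob_star_at:
  assumes n: "0 < n" and st: "0 \<le> s" "s < t" and W: "W \<subseteq> {..<n} - {v}"
  shows "((t - s) / real n * exp (- (2 * t))) ^ card W * exp (- t) \<le> Om.prob {\<omega>. star_at n s t v W \<omega>}"
proof -
  let ?a = "(t - s) / real n * exp (- (2 * t))"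
  let ?L = "{..<n} - {v}"
  let ?Q = "\<lambda>w \<omega>. if w \<in> W then single_arrival n s t (vpair v w) \<omega> else t < first_time n \<omega> (vpair v w)"
  have t: "0 \<le> t" using st by simp
  have a: "0 \<le> ?a" using st by simp
  have fin: "finite W" using W finite_subset by blast
  have "exp (- t) \<le> exp (- (t / real n)) ^ card (?L - W)"
  proof -
    have "card (?L - W) \<le> card {..<n}" by (intro card_mono) auto
    then have "real (card (?L - W)) * (t / real n) \<le> real n * (t / real n)"
      using t by (intro mult_right_mono) auto
    then show ?thesis using n by (simp add: exp_of_nat_mult[symmetric])
  qed
  then have "?a ^ card W * exp (- t) \<le> ?a ^ card W * exp (- (t / real n)) ^ card (?L - W)"
    using a by (intro mult_left_mono) auto
  also have "\<dots> = (\<Prod>w\<in>W. ?a) * (\<Prod>w\<in>?L - W. exp (- (t / real n)))" by simp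
  also have "\<dots> \<le> (\<Prod>w\<in>W. Om.prob {\<omega>. ?Q w \<omega>}) * (\<Prod>w\<in>?L - W. Om.prob {\<omega>. ?Q w \<omega>})"
  proof (rule mult_mono)
    show "(\<Prod>w\<in>W. ?a) \<le> (\<Prod>w\<in>W. Om.prob {\<omega>. ?Q w \<omega>})"
    proof (rule prod_mono)
      fix w assume "w \<in> W"
      then show "0 \<le> ?a \<and> ?a \<le> Om.prob {\<omega>. ?Q w \<omega>}"
        using a prob_single_arrival[OF n st(1) less_imp_le[OF st(2)]] by simp
    qed
    show "(\<Prod>w\<in>?L - W. exp (- (t / real n))) \<le> (\<Prod>w\<in>?L - W. Om.prob {\<omega>. ?Q w \<omega>})"
      using prob_first_gt[OF t n] by (intro prod_mono) (simp add: first_time_def)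
  qed (auto intro!: prod_nonneg)
  also have "\<dots> = (\<Prod>w\<in>?L. Om.prob {\<omega>. ?Q w \<omega>})"
    using W by (subst prod.subset_diff[of W ?L]) (auto simp: mult.commute)
  also have "\<dots> = Om.prob {\<omega>. star_at n s t v W \<omega>}"
    unfolding star_at_def
  proof (rule prob_indep_blocks[OF _ disjoint_vpair_blocks, symmetric])
    fix w
    show "depends_on {e. epair e = vpair v w} (?Q w)"
      by (auto simp: depends_on_def single_arrival_def first_time_def)
    show "Measurable.pred Omega (?Q w)" by auto
  qed simp
  finally show ?thesis .
qed

lemma star_at_unique:
  assumes "star_at n s t v W \<omega>" "star_at n s t v W' \<omega>" "W \<subseteq> {..<n} - {v}" "W' \<subseteq> {..<n} - {v}"
  shows "W = W'"
proof -
  have "w \<in> V \<longleftrightarrow> first_time n \<omega> (vpair v w) \<le> t"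
    if "star_at n s t v V \<omega>" "w \<in> {..<n} - {v}" for w V
    using bspec[OF that(1)[unfolded star_at_def] that(2)]
    by (cases "w \<in> V") (simp_all add: single_arrival_def first_time_def)
  then have "w \<in> W \<longleftrightarrow> w \<in> W'" if "w \<in> {..<n} - {v}" for w
    using assms(1,2) that by simp
  then show ?thesis using assms(3,4) by blast
qed

text \<open>A definite choice among the largest components, so that its possible values partition
  the sample space.\<close>

definition big_comp :: "nat \<Rightarrow> (nat \<times> nat) set \<Rightarrow> nat set" where
  "big_comp n R = component n R (LEAST r. r < n \<and> card (component n R r) = C1 n R)"

lemma big_comp:
  assumes "0 < n"
  obtains r where "r < n" "big_comp n R = component n R r" "card (big_comp n R) = C1 n R"
proof -
  obtain v where "v < n \<and> card (component n R v) = C1 n R"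
    using C1_attained[OF assms] by blast
  then have "(LEAST r. r < n \<and> card (component n R r) = C1 n R) < n \<and>
      card (component n R (LEAST r. r < n \<and> card (component n R r) = C1 n R)) = C1 n R"
    by (rule LeastI)
  then show thesis using that by (auto simp: big_comp_def)
qed

text \<open>The giant is taken in the graph without the pairs at \<open>v\<close>, hence independent
  of the star. The finite disjunction over its value \<open>K\<close> allows conditioning on
  it.\<close>

definition star_vertex :: "nat \<Rightarrow> real \<Rightarrow> real \<Rightarrow> real \<Rightarrow> nat \<Rightarrow> nat \<Rightarrow> sample \<Rightarrow> bool" where
  "star_vertex n d s t k v \<omega> \<longleftrightarrow>
     (\<exists>K\<in>{K \<in> Pow {..<n}. d * real n \<le> real (card K)}.
        big_comp n (G_rel n (kill (t + 1) (star_pairs v) \<omega>) s k) = K \<and>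
        (\<exists>W\<in>{W. W \<subseteq> K - {v} \<and> card W = k}. star_at n s t v W \<omega>))"

lemma finite_subsets_card [simp]: "finite K \<Longrightarrow> finite {W. W \<subseteq> K - {v} \<and> card W = k}"
  by (rule finite_subset[of _ "Pow K"]) auto

lemma star_choice_measurable:
  assumes "finite K"
  shows "Measurable.pred Omega (\<lambda>\<omega>. \<exists>W\<in>{W. W \<subseteq> K - {v} \<and> card W = k}. star_at n s t v W \<omega>)"
  using assms by (intro pred_intros_finite) auto

lemma big_comp_kill_measurable:
  "Measurable.pred Omega (\<lambda>\<omega>. big_comp n (G_rel n (kill b P \<omega>) s k) = K)"
  using G_rel_kill_pred[of "\<lambda>R. big_comp n R = K"] .

lemma star_vertex_measurable [measurable]: "Measurable.pred Omega (star_vertex n d s t k v)"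
  unfolding star_vertex_def[abs_def]
proof (intro pred_intros_finite)
  fix K assume "K \<in> {K \<in> Pow {..<n}. d * real n \<le> real (card K)}"
  then have "finite K" using finite_subset by blast
  then show "Measurable.pred Omega (\<lambda>\<omega>. big_comp n (G_rel n (kill (t + 1) (star_pairs v) \<omega>) s k) = K \<and>
        (\<exists>W\<in>{W. W \<subseteq> K - {v} \<and> card W = k}. star_at n s t v W \<omega>))"
    by (intro pred_intros_logic star_choice_measurable big_comp_kill_measurable)
qed simp

lemma length_filter_mono:
  "(\<And>x. x \<in> set xs \<Longrightarrow> P x \<Longrightarrow> Q x) \<Longrightarrow> length (filter P xs) \<le> length (filter Q xs)"
  by (induction xs) (auto intro: le_SucI)

text \<open>All edges at \<open>v\<close> arrive after \<open>s\<close>, so killing them does not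
  change G_k(s). There are exactly \<open>k\<close> of them: too few for level \<open>k + 1\<close>,
  and enough crossings into the giant to join it in level \<open>k\<close>.\<close>

lemma star_vertex_props:
  assumes g: "good \<omega>" and n: "0 < n" and st: "0 \<le> s" "s < t" and k: "1 \<le> k"
    and vn: "v < n" and star: "star_vertex n d s t k v \<omega>"
  shows "(v, w) \<notin> G_rel n \<omega> t (Suc k)"
    and "\<exists>r<n. d * real n \<le> real (card (component n (G_rel n \<omega> s k) r)) \<and> (v, r) \<in> (G_rel n \<omega> t k)\<^sup>*"
proof -
  have t: "0 \<le> t" using st by simp
  let ?R = "G_rel n \<omega> s k"
  obtain W where W: "W \<subseteq> big_comp n (G_rel n (kill (t + 1) (star_pairs v) \<omega>) s k) - {v}" "card W = k"
    and sW: "star_at n s t v W \<omega>"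
    and dK: "d * real n \<le> real (card (big_comp n (G_rel n (kill (t + 1) (star_pairs v) \<omega>) s k)))"
    using star by (auto simp: star_vertex_def)
  have vp: "(a, b) = vpair v (if a = v then b else a)" if "a < b" "a = v \<or> b = v" for a b
    using that by (auto simp: vpair_def min_def max_def)
  have late: "s < first_time n \<omega> (vpair v w)" if "w < n" "w \<noteq> v" for w
    using sW that st by (auto simp: star_at_def single_arrival_def first_time_def split: if_splits)
  have Req: "G_rel n (kill (t + 1) (star_pairs v) \<omega>) s k = ?R"
  proof (rule G_rel_kill_eq[OF g])
    show "0 < t + 1" "s < real n * (t + 1)" using t st less_times_Suc[OF n t] by auto
    fix a b assume ab: "(a, b) \<in> star_pairs v" "a < b" "b < n"
    have "s < first_time n \<omega> (vpair v (if a = v then b else a))"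
      using ab by (intro late) (auto simp: star_pairs_def)
    then have "s < first_time n \<omega> (a, b)" using vp[of a b] ab by (simp add: star_pairs_def)
    then show "s < real n * \<omega> (a, b, 0)" by (simp add: first_time_def)
  qed
  obtain r where r: "r < n" "big_comp n ?R = component n ?R r"
    using big_comp[OF n, of ?R] by blast
  let ?K = "component n ?R r"
  have W': "W \<subseteq> ?K - {v}" "d * real n \<le> real (card ?K)"
    using W(1) dK by (auto simp: Req r(2))
  define ed where "ed w = (min v w, max v w, 0 :: nat)" for w
  have inj: "inj_on ed W"
  proof (rule inj_onI)
    fix w w' assume "ed w = ed w'"
    then have "vpair v w = vpair v w'" by (simp add: ed_def vpair_def)
    then show "w = w'" by (rule vpair_inj)
  qed
  have Wn: "w < n \<and> w \<noteq> v" if "w \<in> W" for w using that W'(1) by (auto simp: component_def)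
  have set_inc: "set (filter (incident v) (elist n \<omega> t)) = ed ` W"
  proof (intro equalityI subsetI)
    fix x assume x: "x \<in> set (filter (incident v) (elist n \<omega> t))"
    obtain a b i where xe: "x = (a, b, i)" by (cases x)
    have mem: "(a, b, i) \<in> edges_upto n \<omega> t" and inc: "a = v \<or> b = v"
      using x set_elist_subset by (auto simp: incident_def xe)
    have ab: "a < b" "b < n" "arrival n \<omega> (a, b, i) \<le> t" using mem by (auto simp: edges_upto_def)
    define w where "w = (if a = v then b else a)"
    have w: "w < n" "w \<noteq> v" "(a, b) = vpair v w"
      using ab inc vp[OF ab(1) inc] by (auto simp: w_def)
    have "arrival n \<omega> (a, b, 0) \<le> arrival n \<omega> (a, b, i)"
      using g by (intro arrival_mono good_pos) auto
    then have "first_time n \<omega> (vpair v w) \<le> t"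
      using ab(3) unfolding w(3)[symmetric] by (simp add: first_time_def arrival_0)
    then have wW: "w \<in> W" and sa: "single_arrival n s t (a, b) \<omega>"
      using sW w unfolding star_at_def by (auto split: if_splits)
    have "i = 0"
    proof (rule ccontr)
      assume "i \<noteq> 0"
      then have "arrival n \<omega> (a, b, Suc 0) \<le> arrival n \<omega> (a, b, i)"
        using g by (intro arrival_mono good_pos) auto
      moreover have "t < arrival n \<omega> (a, b, Suc 0)"
        using sa st(1) by (simp add: single_arrival_def arrival_1 distrib_left)
      ultimately show False using ab(3) by simp
    qed
    then have "(a, b, i) = ed w" using w(3) by (simp add: ed_def vpair_def)
    then show "x \<in> ed ` W" using wW xe by blast
  next
    fix x assume "x \<in> ed ` W"
    then obtain w where x: "x = ed w" and w: "w \<in> W" by blast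
    have "single_arrival n s t (vpair v w) \<omega>"
      using sW w Wn[OF w] by (auto simp: star_at_def)
    then have "arrival n \<omega> (ed w) \<le> t"
      by (simp add: ed_def arrival_0 single_arrival_def vpair_def)
    then have "ed w \<in> edges_upto n \<omega> t"
      using Wn[OF w] vn by (auto simp: ed_def edges_upto_def min_def max_def)
    then show "x \<in> set (filter (incident v) (elist n \<omega> t))"
      unfolding x using set_elist[OF finite_edges_upto[OF g]]
      by (auto simp: incident_def ed_def min_def max_def)
  qed
  have len: "length (filter (incident v) (elist n \<omega> t)) = k"
  proof -
    have "distinct (filter (incident v) (elist n \<omega> t))"
      using distinct_elist[OF finite_edges_upto[OF g]] by simp
    then have "length (filter (incident v) (elist n \<omega> t)) = card (ed ` W)"
      using set_inc distinct_card by metis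
    then show ?thesis using inj W(2) by (simp add: card_image)
  qed
  show "(v, w) \<notin> G_rel n \<omega> t (Suc k)"
    unfolding G_rel_eq by (rule isolated_above_degree[OF elist_ne]) (simp add: len)
  obtain rest where rest: "elist n \<omega> t = elist n \<omega> s @ rest"
    using elist_prefix[OF g less_imp_le[OF st(2)]] by blast
  have notinc: "\<not> incident v x" if "x \<in> set (elist n \<omega> s)" for x
  proof
    assume "incident v x"
    then have "x \<in> ed ` W" using set_inc that rest by auto
    then obtain w where w: "x = ed w" "w \<in> W" by blast
    have "s < arrival n \<omega> x"
      using late[of w] Wn[OF w(2)] by (simp add: w(1) ed_def arrival_0 first_time_def vpair_def)
    then show False using that set_elist_subset[of n \<omega> s] by (auto simp: edges_upto_def)
  qed
  have "(v, r) \<in> (level_rel (lab (elist n \<omega> s @ rest)) k)\<^sup>*"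
  proof (rule crossing_connected[where A = "{v}" and B = ?K])
    fix b b' assume "b \<in> ?K" "b' \<in> ?K"
    then have "(r, b) \<in> ?R\<^sup>*" "(r, b') \<in> ?R\<^sup>*" by (auto simp: component_def)
    then show "(b, b') \<in> (level_rel (lab (elist n \<omega> s)) k)\<^sup>*"
      unfolding G_rel_eq by (meson rtrancl_level_sym rtrancl_trans)
  next
    show "\<forall>x\<in>set rest. fst x \<noteq> fst (snd x)"
      using elist_ne[of n \<omega> t] rest by auto
    have "filter (incident v) (elist n \<omega> s) = []"
      using notinc by (simp add: filter_empty_conv)
    then have "k = length (filter (incident v) rest)" using len rest by simp
    also have "\<dots> \<le> length (filter (crossing {v} ?K) rest)"
    proof (rule length_filter_mono)
      fix x assume x: "x \<in> set rest" "incident v x"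
      then have "x \<in> ed ` W" using set_inc rest by auto
      then obtain w where w: "x = ed w" "w \<in> ?K" using W'(1) by blast
      then show "crossing {v} ?K x"
        by (cases "v \<le> w") (simp_all add: ed_def crossing_def)
    qed
    finally show "k \<le> length (filter (crossing {v} ?K) rest)" .
  qed (use k r(1) in \<open>auto simp: component_def\<close>)
  then have "(v, r) \<in> (G_rel n \<omega> t k)\<^sup>*" by (simp add: G_rel_eq rest)
  then show "\<exists>r<n. d * real n \<le> real (card (component n (G_rel n \<omega> s k) r)) \<and> (v, r) \<in> (G_rel n \<omega> t k)\<^sup>*"
    using r(1) W'(2) by blast
qed

lemma prob_star_choice:
  assumes n: "0 < n" and st: "0 \<le> s" "s < t" and k: "1 \<le> k" and d: "0 < d"
    and large: "real k + 1 \<le> d * real n / 2" and K: "K \<subseteq> {..<n}" "d * real n \<le> real (card K)"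
  shows "(d * (t - s) * exp (- (2 * t)) / (2 * real k)) ^ k * exp (- t) \<le>
    Om.prob {\<omega>. \<exists>W\<in>{W. W \<subseteq> K - {v} \<and> card W = k}. star_at n s t v W \<omega>}"
proof -
  let ?a = "(t - s) / real n * exp (- (2 * t))"
  let ?F = "{W. W \<subseteq> K - {v} \<and> card W = k}"
  have fin: "finite K" using K(1) finite_subset by blast
  define m where "m = card (K - {v})"
  have "card K \<le> m + 1"
    unfolding m_def using fin by (cases "v \<in> K") (auto simp: card_Diff_singleton)
  then have "real (card K) \<le> real m + 1" by (metis of_nat_1 of_nat_add of_nat_mono)
  then have m: "d * real n / 2 \<le> real m" "real k \<le> real m" using large K(2) by linarith+
  have a: "0 \<le> ?a" using st by simp
  \<comment> \<open>There are at least (m / k)^k choices of \<open>W\<close> with m >= d n / 2,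
    which cancels the factor n^(-k) of a single star. The hypothesis \<open>large\<close> pays for
    removing \<open>v\<close> from \<open>K\<close> and ensures m >= k.\<close>
  have "(d * (t - s) * exp (- (2 * t)) / (2 * real k)) ^ k * exp (- t) =
      (d * real n / 2 / real k) ^ k * (?a ^ k * exp (- t))"
    using n by (simp add: power_mult_distrib[symmetric] mult.assoc[symmetric])
  also have "\<dots> \<le> (real m / real k) ^ k * (?a ^ k * exp (- t))"
    using m(1) a d by (intro mult_right_mono power_mono divide_right_mono) auto
  also have "\<dots> \<le> real (m choose k) * (?a ^ k * exp (- t))"
    using m(2) a by (intro mult_right_mono binomial_ge_n_over_k_pow_k) auto
  also have "\<dots> = (\<Sum>W\<in>?F. ?a ^ card W * exp (- t))"
    using n_subsets[of "K - {v}" k] fin by (simp add: m_def)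
  also have "\<dots> \<le> (\<Sum>W\<in>?F. Om.prob {\<omega>. star_at n s t v W \<omega>})"
    using K(1) by (intro sum_mono prob_star_at[OF n st]) auto
  also have "\<dots> = Om.prob {\<omega>. \<exists>W\<in>?F. star_at n s t v W \<omega>}"
  proof (rule prob_disjoint_ex[symmetric])
    fix W W' \<omega> assume "W \<in> ?F" "W' \<in> ?F" "star_at n s t v W \<omega>" "star_at n s t v W' \<omega>"
    then show "W = W'" using K(1) by (intro star_at_unique[of n s t v W \<omega> W']) auto
  qed (use fin in auto)
  finally show ?thesis .
qed

lemma prob_isolated_ge:
  assumes "0 < n" "0 \<le> s"
  shows "exp (- s) \<le> Om.prob {\<omega>. \<forall>w\<in>{..<n} - {v}. s < first_time n \<omega> (vpair v w)}"
proof -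
  have "card ({..<n} - {v}) \<le> card {..<n}" by (intro card_mono) auto
  then have "real (card ({..<n} - {v})) * (s / real n) \<le> real n * (s / real n)"
    using assms by (intro mult_right_mono) auto
  then have "exp (- s) \<le> exp (- (s / real n)) ^ card ({..<n} - {v})"
    using assms by (simp add: exp_of_nat_mult[symmetric])
  also have "\<dots> = (\<Prod>w\<in>{..<n} - {v}. Om.prob {\<omega>. s < first_time n \<omega> (vpair v w)})"
    using prob_first_gt[OF assms(2,1)] by (simp add: first_time_def)
  also have "\<dots> = Om.prob {\<omega>. \<forall>w\<in>{..<n} - {v}. s < first_time n \<omega> (vpair v w)}"
    by (rule prob_indep_blocks[OF _ disjoint_vpair_blocks[of v], symmetric])
       (auto simp: depends_on_def first_time_def)
  finally show ?thesis .
qed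

text \<open>Summing over the value \<open>K\<close> of the killed giant, each term is a product: the
  giant uses no clock at \<open>v\<close>, the star uses only those.\<close>

lemma prob_star_vertex:
  assumes n: "0 < n" and st: "0 \<le> s" "s < t" and k: "1 \<le> k" and d: "0 < d"
    and large: "real k + 1 \<le> d * real n / 2"
    and giant: "Om.prob {\<omega>. real (C1 n (G_rel n \<omega> s k)) < d * real n} \<le> exp (- s) / 2"
  shows "exp (- s) / 2 * ((d * (t - s) * exp (- (2 * t)) / (2 * real k)) ^ k * exp (- t)) \<le>
    Om.prob {\<omega>. star_vertex n d s t k v \<omega>}"
proof -
  let ?c = "(d * (t - s) * exp (- (2 * t)) / (2 * real k)) ^ k * exp (- t)"
  let ?G = "\<lambda>\<omega>. G_rel n (kill (t + 1) (star_pairs v) \<omega>) s k"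
  let ?F = "{K \<in> Pow {..<n}. d * real n \<le> real (card K)}"
  let ?S = "\<lambda>K \<omega>. \<exists>W\<in>{W. W \<subseteq> K - {v} \<and> card W = k}. star_at n s t v W \<omega>"
  have t: "0 \<le> t" using st by simp
  have c: "0 \<le> ?c" using d st by simp
  have finK: "finite K" if "K \<in> ?F" for K using that finite_subset by blast
  have dep: "depends_on {e. epair e \<in> star_pairs v} (?S K)" for K
  proof -
    have "star_at n s t v W \<omega> = star_at n s t v W \<omega>'"
      if eq: "\<forall>e\<in>{e. epair e \<in> star_pairs v}. \<omega> e = \<omega>' e" for W \<omega> \<omega>'
    proof -
      have "\<omega> (fst (vpair v w), snd (vpair v w), i) = \<omega>' (fst (vpair v w), snd (vpair v w), i)" for w i
        using eq vpair_star[of v w] by simp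
      then show ?thesis by (simp add: star_at_def single_arrival_def first_time_def)
    qed
    then show ?thesis unfolding depends_on_def by blast
  qed
  \<comment> \<open>Killed and true graph are compared only when \<open>v\<close> has no edge by
    time \<open>s\<close>, of probability at least exp (- s). Hence the assumed failure bound exp (-
    s) / 2 in \<open>giant\<close>.\<close>
  have "exp (- s) - exp (- s) / 2 \<le> Om.prob {\<omega>. d * real n \<le> real (C1 n (?G \<omega>))}"
  proof -
    let ?I = "\<lambda>\<omega>. \<forall>w\<in>{..<n} - {v}. s < first_time n \<omega> (vpair v w)"
    let ?B = "\<lambda>\<omega>. real (C1 n (G_rel n \<omega> s k)) < d * real n"
    have mG: "Measurable.pred Omega (\<lambda>\<omega>. d * real n \<le> real (C1 n (?G \<omega>)))"
      using G_rel_kill_pred[of "\<lambda>R. d * real n \<le> real (C1 n R)"] .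
    have mB: "Measurable.pred Omega ?B"
      using G_rel_pred[of "\<lambda>R. real (C1 n R) < d * real n"] .
    have mI: "Measurable.pred Omega ?I" by (intro pred_intros_finite) auto
    have "Om.prob {\<omega>. ?I \<omega>} \<le> Om.prob {\<omega>. d * real n \<le> real (C1 n (?G \<omega>)) \<or> ?B \<omega>}"
    proof (rule prob_mono_AE[OF mI])
      show "Measurable.pred Omega (\<lambda>\<omega>. d * real n \<le> real (C1 n (?G \<omega>)) \<or> ?B \<omega>)"
        by (intro pred_intros_logic mG mB)
    next
      fix \<omega> assume g: "good \<omega>" and I: "?I \<omega>"
      have "?G \<omega> = G_rel n \<omega> s k"
      proof (rule G_rel_kill_eq[OF g])
        show "0 < t + 1" "s < real n * (t + 1)" using t st less_times_Suc[OF n t] by auto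
        fix a b assume ab: "(a, b) \<in> star_pairs v" "a < b" "b < n"
        define w where "w = (if a = v then b else a)"
        have w: "(a, b) = vpair v w" "w \<in> {..<n} - {v}"
          using ab by (auto simp: w_def vpair_def star_pairs_def min_def max_def)
        have "s < first_time n \<omega> (vpair v w)" using I w(2) by blast
        then show "s < real n * \<omega> (a, b, 0)"
          unfolding w(1)[symmetric] by (simp add: first_time_def)
      qed
      then show "d * real n \<le> real (C1 n (?G \<omega>)) \<or> ?B \<omega>" by auto
    qed
    also have "{\<omega>. d * real n \<le> real (C1 n (?G \<omega>)) \<or> ?B \<omega>} = {\<omega>. d * real n \<le> real (C1 n (?G \<omega>))} \<union> {\<omega>. ?B \<omega>}"
      by auto
    also have "Om.prob \<dots> \<le> Om.prob {\<omega>. d * real n \<le> real (C1 n (?G \<omega>))} + Om.prob {\<omega>. ?B \<omega>}"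
      by (intro measure_Un_le pred_Omega_sets mG mB)
    finally show ?thesis using prob_isolated_ge[OF n st(1), of v] giant by linarith
  qed
  also have "{\<omega>. d * real n \<le> real (C1 n (?G \<omega>))} = {\<omega>. \<exists>K\<in>?F. big_comp n (?G \<omega>) = K}"
  proof -
    have sub: "big_comp n R \<in> Pow {..<n}" for R
      by (auto simp: big_comp_def component_def)
    have card: "C1 n R = card (big_comp n R)" for R
      by (rule big_comp[OF n, of R]) simp
    show ?thesis
      unfolding card using sub by blast
  qed
  also have "Om.prob \<dots> = (\<Sum>K\<in>?F. Om.prob {\<omega>. big_comp n (?G \<omega>) = K})"
    by (rule prob_disjoint_ex) (auto intro: big_comp_kill_measurable)
  finally have giant': "exp (- s) / 2 \<le> (\<Sum>K\<in>?F. Om.prob {\<omega>. big_comp n (?G \<omega>) = K})" by simp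
  have "exp (- s) / 2 * ?c \<le> (\<Sum>K\<in>?F. Om.prob {\<omega>. big_comp n (?G \<omega>) = K}) * ?c"
    using giant' c by (rule mult_right_mono)
  also have "\<dots> = (\<Sum>K\<in>?F. Om.prob {\<omega>. big_comp n (?G \<omega>) = K} * ?c)"
    by (rule sum_distrib_right)
  also have "\<dots> \<le> (\<Sum>K\<in>?F. Om.prob {\<omega>. big_comp n (?G \<omega>) = K \<and> ?S K \<omega>})"
  proof (rule sum_mono)
    fix K assume K: "K \<in> ?F"
    have "Om.prob {\<omega>. big_comp n (?G \<omega>) = K \<and> ?S K \<omega>} =
        Om.prob {\<omega>. big_comp n (?G \<omega>) = K} * Om.prob {\<omega>. ?S K \<omega>}"
      by (rule prob_indep2[OF big_comp_kill_measurable star_choice_measurable[OF finK[OF K]]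
            depends_on_kill[of "star_pairs v" "\<lambda>\<omega>. big_comp n (G_rel n \<omega> s k) = K"] dep]) auto
    moreover have "?c \<le> Om.prob {\<omega>. ?S K \<omega>}"
      using K by (intro prob_star_choice[OF n st k d large]) auto
    ultimately show "Om.prob {\<omega>. big_comp n (?G \<omega>) = K} * ?c \<le> Om.prob {\<omega>. big_comp n (?G \<omega>) = K \<and> ?S K \<omega>}"
      by (simp only:) (intro mult_left_mono measure_nonneg)
  qed
  also have "\<dots> = Om.prob {\<omega>. star_vertex n d s t k v \<omega>}"
    unfolding star_vertex_def
  proof (rule prob_disjoint_ex[symmetric])
    fix K assume K: "K \<in> ?F"
    show "Measurable.pred Omega (\<lambda>\<omega>. big_comp n (?G \<omega>) = K \<and> ?S K \<omega>)"
      by (intro pred_intros_logic big_comp_kill_measurable star_choice_measurable finK[OF K])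
  qed auto
  finally show ?thesis .
qed

subsection \<open>Comparison of consecutive levels\<close>

lemma abs_dev_sets:
  "{\<omega>. \<epsilon> < \<bar>real (C1 n (G_rel n \<omega> t k)) / real n - y\<bar>} \<in> sets Omega"
  using pred_Omega_sets[OF G_rel_pred[of "\<lambda>R. \<epsilon> < \<bar>real (C1 n R) / real n - y\<bar>"]] .

lemma limit_antimono_level:
  assumes f: "conv_unif_prob k f" and g: "conv_unif_prob (Suc k) g" and t: "0 \<le> t"
  shows "g t \<le> f t"
proof (rule ccontr)
  assume "\<not> g t \<le> f t"
  define \<epsilon> where "\<epsilon> = (g t - f t) / 3"
  have eps: "0 < \<epsilon>" using \<open>\<not> g t \<le> f t\<close> by (simp add: \<epsilon>_def)
  obtain N1 where N1: "\<And>n. N1 \<le> n \<Longrightarrow>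
      Om.prob {\<omega>. \<epsilon> < \<bar>real (C1 n (G_rel n \<omega> t k)) / real n - f t\<bar>} < 1 / 4"
    using conv_unif_probD[OF f t eps, of "1 / 4"] by auto
  obtain N2 where N2: "\<And>n. N2 \<le> n \<Longrightarrow>
      Om.prob {\<omega>. \<epsilon> < \<bar>real (C1 n (G_rel n \<omega> t (Suc k))) / real n - g t\<bar>} < 1 / 4"
    using conv_unif_probD[OF g t eps, of "1 / 4"] by auto
  define n where "n = Suc (max N1 N2)"
  have n: "0 < n" "N1 \<le> n" "N2 \<le> n" by (auto simp: n_def)
  let ?B1 = "{\<omega>. \<epsilon> < \<bar>real (C1 n (G_rel n \<omega> t k)) / real n - f t\<bar>}"
  let ?B2 = "{\<omega>. \<epsilon> < \<bar>real (C1 n (G_rel n \<omega> t (Suc k))) / real n - g t\<bar>}"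
  have "Om.prob (?B1 \<union> ?B2) \<le> Om.prob ?B1 + Om.prob ?B2"
    by (intro measure_Un_le abs_dev_sets)
  also have "\<dots> < 1" using N1[OF n(2)] N2[OF n(3)] by linarith
  finally obtain \<omega> where \<omega>: "good \<omega>" "\<omega> \<notin> ?B1 \<union> ?B2"
    by (rule exists_good[OF sets.Un[OF abs_dev_sets abs_dev_sets]])
  have "C1 n (G_rel n \<omega> t (Suc k)) \<le> C1 n (G_rel n \<omega> t k)"
    by (intro C1_mono G_rel_antimono_level n) simp
  then have "real (C1 n (G_rel n \<omega> t (Suc k))) / real n \<le> real (C1 n (G_rel n \<omega> t k)) / real n"
    by (intro divide_right_mono) auto
  moreover have "\<bar>real (C1 n (G_rel n \<omega> t k)) / real n - f t\<bar> \<le> \<epsilon>"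
    "\<bar>real (C1 n (G_rel n \<omega> t (Suc k))) / real n - g t\<bar> \<le> \<epsilon>"
    using \<omega>(2) by auto
  ultimately have "g t - f t \<le> 2 * \<epsilon>" by linarith
  then show False using eps by (simp add: \<epsilon>_def)
qed

lemma isolated_not_in_comp:
  assumes "sym R" "\<And>w. (v, w) \<notin> R" "v \<in> component n R m"
  shows "v = m"
proof -
  have "(v, m) \<in> R\<^sup>*"
    using assms(1,3) sym_rtrancl[OF assms(1)] by (auto simp: component_def dest: symD)
  then show ?thesis using isolated_rtrancl[of v R m] assms(2) by blast
qed

text \<open>Strictness below the constant 1 of level 0: a positive fraction of the vertices is
  isolated in G_1(t).\<close>

lemma first_limit_less_1:
  assumes g: "conv_unif_prob 1 g" and t: "0 \<le> t" and le: "g t \<le> 1"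
  shows "g t < 1"
proof (rule ccontr)
  assume "\<not> g t < 1"
  then have gt: "g t = 1" using le by simp
  define c where "c = exp (- t)"
  have c: "0 < c" by (simp add: c_def)
  obtain N where N: "\<And>n. N \<le> n \<Longrightarrow>
      Om.prob {\<omega>. c / 8 < \<bar>real (C1 n (G_rel n \<omega> t 1)) / real n - g t\<bar>} < c / 2"
    using conv_unif_probD[OF g t, of "c / 8" "c / 2"] c by auto
  obtain N' :: nat where N': "8 / c \<le> real N'" using real_arch_simple by blast
  define n where "n = Suc (max N N')"
  have n: "0 < n" "N \<le> n" "N' \<le> n" by (auto simp: n_def)
  have n8: "1 \<le> c / 8 * real n"
  proof -
    have "8 / c \<le> real n" using N' n(3) by (meson of_nat_mono order_trans)
    then show ?thesis using c by (simp add: field_simps)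
  qed
  let ?I = "\<lambda>v \<omega>. \<forall>w\<in>{..<n} - {v}. t < first_time n \<omega> (vpair v w)"
  have mI: "Measurable.pred Omega (?I v)" for v by (intro pred_intros_finite) auto
  define E where "E = {\<omega>. c / 2 * real (card {..<n}) \<le> real (card {v \<in> {..<n}. ?I v \<omega>})}"
  have pE: "c / 2 \<le> Om.prob E"
    unfolding E_def using n(1) c by (intro prob_card_ge mI) (auto simp: c_def intro: prob_isolated_ge[OF n(1) t])
  have [measurable]: "(\<lambda>\<omega>. real (card {v \<in> {..<n}. ?I v \<omega>})) \<in> borel_measurable Omega"
    by (intro card_pred mI) auto
  have E: "E \<in> sets Omega" unfolding E_def by (rule pred_Omega_sets) measurable
  let ?B = "{\<omega>. c / 8 < \<bar>real (C1 n (G_rel n \<omega> t 1)) / real n - g t\<bar>}"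
  have "Om.prob (- E) = 1 - Om.prob E" using Om.prob_compl[OF E] by (simp add: Compl_eq_Diff_UNIV)
  then have "Om.prob (- E) + Om.prob ?B < 1" using N[OF n(2)] pE by linarith
  moreover have cE: "- E \<in> sets Omega" using sets.compl_sets[OF E] by (simp add: Compl_eq_Diff_UNIV)
  ultimately have "Om.prob (- E \<union> ?B) < 1"
    using measure_Un_le[OF cE abs_dev_sets[of "c / 8" n t 1 "g t"]] by linarith
  then obtain \<omega> where \<omega>: "good \<omega>" "\<omega> \<notin> - E \<union> ?B"
    by (rule exists_good[OF sets.Un[OF cE abs_dev_sets]])
  let ?S = "{v \<in> {..<n}. ?I v \<omega>}" and ?R = "G_rel n \<omega> t 1"
  obtain m where m: "m < n" "card (component n ?R m) = C1 n ?R" using C1_attained[OF n(1)] by blast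
  have iso: "(v, w) \<notin> ?R" if v: "v \<in> ?S" for v w
  proof -
    have "\<not> incident v x" if x: "x \<in> set (elist n \<omega> t)" for x
    proof
      assume inc: "incident v x"
      obtain a b i where xe: "x = (a, b, i)" by (cases x)
      have ab: "a < b" "b < n" "arrival n \<omega> (a, b, i) \<le> t"
        using subsetD[OF set_elist_subset x] by (auto simp: edges_upto_def xe)
      define w where "w = (if a = v then b else a)"
      have w: "(a, b) = vpair v w" "w \<in> {..<n} - {v}"
        using ab inc by (auto simp: w_def vpair_def xe incident_def min_def max_def)
      have "t < first_time n \<omega> (vpair v w)" using v w(2) by blast
      then have "t < arrival n \<omega> (a, b, 0)"
        unfolding w(1)[symmetric] by (simp add: first_time_def arrival_0)
      moreover have "arrival n \<omega> (a, b, 0) \<le> arrival n \<omega> (a, b, i)"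
        using \<omega>(1) by (intro arrival_mono good_pos) auto
      ultimately show False using ab(3) by simp
    qed
    then show ?thesis
      unfolding G_rel_eq by (intro isolated_above_degree[OF elist_ne]) (simp add: filter_empty_conv)
  qed
  \<comment> \<open>The root \<open>m\<close> may itself be isolated and form its own component;
    excluding it produces the \<open>+ 1\<close> that \<open>n8\<close> absorbs.\<close>
  have "component n ?R m \<inter> (?S - {m}) = {}"
    using isolated_not_in_comp[OF sym_G_rel iso] by blast
  then have "card (component n ?R m) + card (?S - {m}) = card (component n ?R m \<union> (?S - {m}))"
    by (intro card_Un_disjoint[symmetric]) auto
  also have "\<dots> \<le> card {..<n}" by (intro card_mono) (auto simp: component_def)
  finally have "C1 n ?R + card ?S \<le> n + 1"
    unfolding m(2) using card_Diff1_le[of ?S m] card_Diff_singleton_if[of ?S m] by (auto split: if_splits)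
  then have "real (C1 n ?R + card ?S) \<le> real (n + 1)"
    by (rule of_nat_mono)
  then have "real (C1 n ?R) + real (card ?S) \<le> real n + 1"
    by simp
  moreover have "c / 2 * real n \<le> real (card ?S)" using \<omega>(2) by (simp add: E_def)
  moreover have "(1 - c / 8) * real n \<le> real (C1 n ?R)"
  proof -
    have "\<bar>real (C1 n ?R) / real n - 1\<bar> \<le> c / 8" using \<omega>(2) gt by auto
    then have "1 - c / 8 \<le> real (C1 n ?R) / real n" by linarith
    then show ?thesis using n(1) by (simp add: pos_le_divide_eq)
  qed
  ultimately have "c / 4 * real n \<le> 0" using n8 by (simp add: algebra_simps)
  then show False using c n(1) by (simp add: mult_le_0_iff)
qed

text \<open>If the limits agreed at \<open>t\<close>, the largest component of G_{k+1}(t) would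
  nearly fill the giant of G_k(t), but linearly many star vertices belong to the latter and not to
  the former. The bound on \<open>f t2\<close> excludes a second giant at time
  \<open>t\<close>.\<close>

lemma limit_strict_level:
  assumes f: "conv_unif_prob k f" and g: "conv_unif_prob (Suc k) g" and k: "1 \<le> k"
    and st: "0 \<le> s" "s < t" "t < t2" and fs: "0 < f s" "f s \<le> f t" "f t2 < f t + f s / 4"
  shows "g t < f t"
proof (rule ccontr)
  assume "\<not> g t < f t"
  define d where "d = f s / 2"
  have d: "0 < d" using fs by (simp add: d_def)
  have t: "0 \<le> t" "0 \<le> t2" using st by auto
  have p: "g t = f t" using limit_antimono_level[OF f g t(1)] \<open>\<not> g t < f t\<close> by simp
  define c where "c = exp (- s) / 2 * ((d * (t - s) * exp (- (2 * t)) / (2 * real k)) ^ k * exp (- t))"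
  have c: "0 < c" using d st k by (simp add: c_def)
  \<comment> \<open>The bound c / 8 leaves c n / 4 of the c n / 2 star vertices after two
    deviations; d / 8 keeps d / 2 + 2 \<epsilon> below \<open>d\<close> when a second giant is
    excluded.\<close>
  define \<epsilon> where "\<epsilon> = min (c / 8) (d / 8)"
  have eps: "0 < \<epsilon>" "\<epsilon> \<le> c / 8" "\<epsilon> \<le> d / 8" using c d by (auto simp: \<epsilon>_def)
  obtain N0 where N0: "\<And>n. N0 \<le> n \<Longrightarrow>
      Om.prob {\<omega>. d / 2 < \<bar>real (C1 n (G_rel n \<omega> s k)) / real n - f s\<bar>} < exp (- s) / 2"
    using conv_unif_probD[OF f st(1), of "d / 2" "exp (- s) / 2"] d by auto
  obtain N1 where N1: "\<And>n. N1 \<le> n \<Longrightarrow>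
      Om.prob {\<omega>. \<epsilon> < \<bar>real (C1 n (G_rel n \<omega> t k)) / real n - f t\<bar>} < c / 16"
    using conv_unif_probD[OF f t(1) eps(1), of "c / 16"] c by auto
  obtain N2 where N2: "\<And>n. N2 \<le> n \<Longrightarrow>
      Om.prob {\<omega>. \<epsilon> < \<bar>real (C1 n (G_rel n \<omega> t (Suc k))) / real n - g t\<bar>} < c / 16"
    using conv_unif_probD[OF g t(1) eps(1), of "c / 16"] c by auto
  obtain N3 where N3: "\<And>n. N3 \<le> n \<Longrightarrow>
      Om.prob {\<omega>. \<epsilon> < \<bar>real (C1 n (G_rel n \<omega> t2 k)) / real n - f t2\<bar>} < c / 16"
    using conv_unif_probD[OF f t(2) eps(1), of "c / 16"] c by auto
  obtain C where C: "\<And>n. 0 < n \<Longrightarrow>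
    Om.prob {\<omega>. d\<^sup>2 * (real n)\<^sup>2 / 2 \<le> real (card {p \<in> pairs n. separated n d t t2 k p \<omega>})} \<le> C / real n"
    using prob_two_large_components[OF t(1) st(3) k d] by blast
  obtain N4 :: nat where N4: "max (8 / c) (max (2 * (real k + 1) / d) (16 * C / c)) \<le> real N4"
    using real_arch_simple by blast
  define n where "n = Suc (max N0 (max N1 (max N2 (max N3 N4))))"
  have n: "0 < n" "N0 \<le> n" "N1 \<le> n" "N2 \<le> n" "N3 \<le> n" "N4 \<le> n" by (auto simp: n_def)
  have "real N4 \<le> real n" using n(6) by simp
  then have nn: "8 / c \<le> real n" "2 * (real k + 1) / d \<le> real n" "16 * C / c \<le> real n"
    using N4 by auto
  have n8: "1 \<le> c / 8 * real n" using nn(1) c by (simp add: field_simps)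
  have large: "real k + 1 \<le> d * real n / 2" using nn(2) d by (simp add: field_simps)
  have Cn: "C / real n \<le> c / 16" using nn(3) c n(1) by (simp add: field_simps)
  have giant: "Om.prob {\<omega>. real (C1 n (G_rel n \<omega> s k)) < d * real n} \<le> exp (- s) / 2"
  proof -
    have "{\<omega>. real (C1 n (G_rel n \<omega> s k)) < d * real n} \<subseteq>
        {\<omega>. d / 2 < \<bar>real (C1 n (G_rel n \<omega> s k)) / real n - f s\<bar>}"
    proof safe
      fix \<omega> assume "real (C1 n (G_rel n \<omega> s k)) < d * real n"
      then have "real (C1 n (G_rel n \<omega> s k)) / real n < d" using n(1) by (simp add: pos_divide_less_eq)
      moreover have "f s = 2 * d" by (simp add: d_def)
      ultimately show "d / 2 < \<bar>real (C1 n (G_rel n \<omega> s k)) / real n - f s\<bar>" using d by linarith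
    qed
    then have "Om.prob {\<omega>. real (C1 n (G_rel n \<omega> s k)) < d * real n} \<le>
        Om.prob {\<omega>. d / 2 < \<bar>real (C1 n (G_rel n \<omega> s k)) / real n - f s\<bar>}"
      by (intro Om.finite_measure_mono abs_dev_sets)
    then show ?thesis using N0[OF n(2)] by linarith
  qed
  define E where "E = {\<omega>. c / 2 * real (card {..<n}) \<le> real (card {v \<in> {..<n}. star_vertex n d s t k v \<omega>})}"
  have pE: "c / 2 \<le> Om.prob E"
    unfolding E_def
  proof (rule prob_card_ge)
    show "c \<le> Om.prob {\<omega>. star_vertex n d s t k v \<omega>}" for v
      unfolding c_def by (rule prob_star_vertex[OF n(1) st(1,2) k d large giant])
  qed (use n(1) c in auto)
  have [measurable]: "(\<lambda>\<omega>. real (card {v \<in> {..<n}. star_vertex n d s t k v \<omega>})) \<in> borel_measurable Omega"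
    by (intro card_pred) auto
  have E: "E \<in> sets Omega" unfolding E_def by (rule pred_Omega_sets) measurable
  define B0 where "B0 = {\<omega>. d\<^sup>2 * (real n)\<^sup>2 / 2 \<le> real (card {p \<in> pairs n. separated n d t t2 k p \<omega>})}"
  have [measurable]: "(\<lambda>\<omega>. real (card {p \<in> pairs n. separated n d t t2 k p \<omega>})) \<in> borel_measurable Omega"
    by (intro card_pred) auto
  have B0: "B0 \<in> sets Omega" unfolding B0_def by (rule pred_Omega_sets) measurable
  define B1 where "B1 = {\<omega>. \<epsilon> < \<bar>real (C1 n (G_rel n \<omega> t k)) / real n - f t\<bar>}"
  define B2 where "B2 = {\<omega>. \<epsilon> < \<bar>real (C1 n (G_rel n \<omega> t (Suc k))) / real n - g t\<bar>}"
  define B3 where "B3 = {\<omega>. \<epsilon> < \<bar>real (C1 n (G_rel n \<omega> t2 k)) / real n - f t2\<bar>}"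
  have B: "B1 \<in> sets Omega" "B2 \<in> sets Omega" "B3 \<in> sets Omega"
    unfolding B1_def B2_def B3_def by (rule abs_dev_sets)+
  have cE: "- E \<in> sets Omega" using sets.compl_sets[OF E] by (simp add: Compl_eq_Diff_UNIV)
  have "Om.prob (- E) = 1 - Om.prob E" using Om.prob_compl[OF E] by (simp add: Compl_eq_Diff_UNIV)
  \<comment> \<open>The four error events have total probability at most c / 4, below the c / 2
    guaranteed for \<open>E\<close>.\<close>
  then have "Om.prob (- E) + (Om.prob B0 + (Om.prob B1 + (Om.prob B2 + Om.prob B3))) < 1"
    using pE C[OF n(1)] Cn N1[OF n(3)] N2[OF n(4)] N3[OF n(5)] c
    unfolding B0_def[symmetric] B1_def[symmetric] B2_def[symmetric] B3_def[symmetric] by linarith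
  moreover have "Om.prob (- E \<union> (B0 \<union> (B1 \<union> (B2 \<union> B3)))) \<le>
      Om.prob (- E) + (Om.prob B0 + (Om.prob B1 + (Om.prob B2 + Om.prob B3)))"
    using measure_Un_le[OF B(2,3)] measure_Un_le[OF B(1) sets.Un[OF B(2,3)]]
      measure_Un_le[OF B0 sets.Un[OF B(1) sets.Un[OF B(2,3)]]]
      measure_Un_le[OF cE sets.Un[OF B0 sets.Un[OF B(1) sets.Un[OF B(2,3)]]]] by linarith
  ultimately have "Om.prob (- E \<union> (B0 \<union> (B1 \<union> (B2 \<union> B3)))) < 1" by linarith
  then obtain \<omega> where \<omega>: "good \<omega>" "\<omega> \<notin> - E \<union> (B0 \<union> (B1 \<union> (B2 \<union> B3)))"
    by (rule exists_good[OF sets.Un[OF cE sets.Un[OF B0 sets.Un[OF B(1) sets.Un[OF B(2,3)]]]]])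
  let ?R = "G_rel n \<omega> t k" and ?R' = "G_rel n \<omega> t (Suc k)" and ?R2 = "G_rel n \<omega> t2 k"
  let ?S = "{v \<in> {..<n}. star_vertex n d s t k v \<omega>}"
  have dev: "y \<le> x + \<epsilon> * real n \<and> x \<le> y + \<epsilon> * real n"
    if "\<bar>x / real n - z\<bar> \<le> \<epsilon>" "y = z * real n" for x y z :: real
  proof -
    have "x / real n \<le> z + \<epsilon>" "z - \<epsilon> \<le> x / real n" using that(1) by linarith+
    then have "x \<le> (z + \<epsilon>) * real n" "(z - \<epsilon>) * real n \<le> x"
      using n(1) by (simp_all add: pos_divide_le_eq pos_le_divide_eq)
    then show ?thesis using that(2) by (simp add: algebra_simps)
  qed
  have c1: "real (C1 n ?R) \<le> f t * real n + \<epsilon> * real n"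
    using dev[of "real (C1 n ?R)" "f t"] \<omega>(2) by (auto simp: B1_def)
  have c2: "f t * real n \<le> real (C1 n ?R') + \<epsilon> * real n"
    using dev[of "real (C1 n ?R')" "g t"] \<omega>(2) p by (auto simp: B2_def)
  have c3: "real (C1 n ?R2) \<le> f t2 * real n + \<epsilon> * real n"
    using dev[of "real (C1 n ?R2)" "f t2"] \<omega>(2) by (auto simp: B3_def)
  have few: "real (card {p \<in> pairs n. separated n d t t2 k p \<omega>}) < d\<^sup>2 * (real n)\<^sup>2 / 2"
    using \<omega>(2) by (simp add: B0_def)
  have cS: "c / 2 * real n \<le> real (card ?S)" using \<omega>(2) by (simp add: E_def)
  have en: "\<epsilon> * real n \<le> c / 8 * real n" "\<epsilon> * real n \<le> d / 8 * real n"
    by (rule mult_right_mono[OF eps(2)], simp, rule mult_right_mono[OF eps(3)], simp)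
  obtain m where m: "m < n" "card (component n ?R' m) = C1 n ?R'" using C1_attained[OF n(1)] by blast
  \<comment> \<open>\<open>?D\<close> is the component of G_k(t) around the largest component of
    G_{k+1}(t); it is nearly a giant by size, without being assumed largest in G_k(t).\<close>
  let ?M = "component n ?R' m" and ?D = "component n ?R m"
  have MD: "?M \<subseteq> ?D" by (intro comp_mono G_rel_antimono_level) simp
  have cMD: "real (C1 n ?R') \<le> real (card ?D)"
    unfolding m(2)[symmetric] using MD by (intro of_nat_mono card_mono) auto
  have ft: "2 * d * real n \<le> f t * real n"
    using fs(2) by (intro mult_right_mono) (auto simp: d_def)
  have ft2: "f t2 * real n \<le> f t * real n + d / 2 * real n"
  proof -
    have "f t2 * real n \<le> (f t + d / 2) * real n"
      using fs(3) by (intro mult_right_mono) (auto simp: d_def)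
    then show ?thesis by (simp add: algebra_simps)
  qed
  have dn: "0 < d * real n" using d n(1) by simp
  have cD: "d * real n \<le> real (card ?D)" using cMD c2 ft en(2) dn by linarith
  have SD: "v \<in> ?D" if v: "v \<in> ?S" for v
  proof -
    have vn: "v < n" "star_vertex n d s t k v \<omega>" using v by auto
    obtain r where r: "r < n" "d * real n \<le> real (card (component n (G_rel n \<omega> s k) r))" "(v, r) \<in> ?R\<^sup>*"
      using star_vertex_props(2)[OF \<omega>(1) n(1) st(1,2) k vn] by blast
    have "real (card (component n (G_rel n \<omega> s k) r)) \<le> real (card (component n ?R r))"
      using st by (intro of_nat_mono card_mono comp_mono G_rel_mono_time[OF \<omega>(1)]) auto
    then have cr: "d * real n \<le> real (card (component n ?R r))" using r(2) by linarith
    have join: "(m, r) \<in> ?R2\<^sup>*"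
      using large_components_joined[OF \<omega>(1) n(1) less_imp_le[OF st(3)] less_imp_le[OF d] few m(1) cD r(1) cr] .
    \<comment> \<open>Otherwise two disjoint components at \<open>t\<close>, of about f t n and at
      least d n vertices, have merged by \<open>t2\<close>, forcing \<open>f t2\<close> above the
      assumed bound.\<close>
    have "(m, r) \<in> ?R\<^sup>*"
    proof (rule ccontr)
      assume no: "(m, r) \<notin> ?R\<^sup>*"
      have disj: "?D \<inter> component n ?R r = {}"
      proof (rule ccontr)
        assume "?D \<inter> component n ?R r \<noteq> {}"
        then obtain w where "(m, w) \<in> ?R\<^sup>*" "(r, w) \<in> ?R\<^sup>*" by (auto simp: component_def)
        then have "(m, r) \<in> ?R\<^sup>*"
          unfolding G_rel_eq by (meson rtrancl_level_sym rtrancl_trans)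
        then show False using no by simp
      qed
      have "component n ?R r \<subseteq> component n ?R2 r" "?D \<subseteq> component n ?R2 m"
        using st by (intro comp_mono G_rel_mono_time[OF \<omega>(1)]; simp)+
      moreover have "component n ?R2 r = component n ?R2 m"
        using comp_eq[OF sym_G_rel join] by simp
      ultimately have "card (?D \<union> component n ?R r) \<le> card (component n ?R2 m)"
        by (intro card_mono) auto
      also have "\<dots> \<le> C1 n ?R2" by (rule card_comp_le_C1[OF m(1)])
      finally have "real (card ?D + card (component n ?R r)) \<le> real (C1 n ?R2)"
        using disj by (subst (asm) card_Un_disjoint) auto
      then show False using cMD cr c2 c3 ft2 en(2) dn by simp
    qed
    then have "(m, v) \<in> ?R\<^sup>*"
      using r(3) unfolding G_rel_eq by (meson rtrancl_level_sym rtrancl_trans)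
    then show ?thesis using vn(1) by (simp add: component_def)
  qed
  have "?M \<inter> (?S - {m}) = {}"
    using isolated_not_in_comp[OF sym_G_rel] star_vertex_props(1)[OF \<omega>(1) n(1) st(1,2) k] by blast
  then have "card ?M + card (?S - {m}) = card (?M \<union> (?S - {m}))"
    by (intro card_Un_disjoint[symmetric]) auto
  also have "\<dots> \<le> card ?D" using MD SD by (intro card_mono) auto
  also have "\<dots> \<le> C1 n ?R" by (rule card_comp_le_C1[OF m(1)])
  finally have "C1 n ?R' + card ?S \<le> C1 n ?R + 1"
    unfolding m(2) using card_Diff_singleton_if[of ?S m] by (auto split: if_splits)
  then have "real (C1 n ?R' + card ?S) \<le> real (C1 n ?R + 1)"
    by (rule of_nat_mono)
  then have "real (C1 n ?R') + real (card ?S) \<le> real (C1 n ?R) + 1"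
    by simp
  then have "c / 4 * real n \<le> 1" using c1 c2 cS en(1) by simp
  moreover have "0 < c / 8 * real n" using c n(1) by simp
  ultimately show False using n8 by simp
qed

theorem theorem2p3:
  fixes \<rho> :: "nat \<Rightarrow> real \<Rightarrow> real" and \<sigma> :: "nat \<Rightarrow> real"
  assumes rho0: "\<And>t. \<rho> 0 t = 1"
    and sigma0: "\<sigma> 0 = 0"
    and rho_conv: "\<And>k. 1 \<le> k \<Longrightarrow> conv_unif_prob k (\<rho> k)"
    and rho_cont: "\<And>k. 1 \<le> k \<Longrightarrow> continuous_on {0..} (\<rho> k)"
    and rho_mono: "\<And>k. 1 \<le> k \<Longrightarrow> mono_on {0..} (\<rho> k)"
    and rho_range: "\<And>k t. 1 \<le> k \<Longrightarrow> 0 \<le> t \<Longrightarrow> 0 \<le> \<rho> k t \<and> \<rho> k t \<le> 1"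
    and sigma_pos: "\<And>k. 1 \<le> k \<Longrightarrow> 0 < \<sigma> k"
    and sigma_zero: "\<And>k t. 1 \<le> k \<Longrightarrow> 0 \<le> t \<Longrightarrow> t \<le> \<sigma> k \<Longrightarrow> \<rho> k t = 0"
    and sigma_posr: "\<And>k t. 1 \<le> k \<Longrightarrow> \<sigma> k < t \<Longrightarrow> 0 < \<rho> k t"
  shows "\<forall>k\<ge>1. (\<forall>t\<ge>0. \<rho> k t \<le> \<rho> (k - 1) t \<and> (0 < \<rho> (k - 1) t \<longrightarrow> \<rho> k t < \<rho> (k - 1) t))
               \<and> \<sigma> (k - 1) + 1 \<le> \<sigma> k"
proof (intro allI impI conjI)
  fix k :: nat and t :: real assume k: "1 \<le> k" and t: "0 \<le> t"
  show "\<rho> k t \<le> \<rho> (k - 1) t"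
  proof (cases "k = 1")
    case True
    then show ?thesis using rho0 rho_range[of 1 t] t by simp
  next
    case False
    then have "1 \<le> k - 1" "k = Suc (k - 1)" using k by auto
    then show ?thesis
      using limit_antimono_level[OF rho_conv[of "k - 1"] _ t, of "\<rho> k"] rho_conv[of k] k by simp
  qed
next
  fix k :: nat and t :: real assume k: "1 \<le> k" and t: "0 \<le> t" and pos: "0 < \<rho> (k - 1) t"
  show "\<rho> k t < \<rho> (k - 1) t"
  proof (cases "k = 1")
    case True
    then show ?thesis using rho0 first_limit_less_1[OF rho_conv[of 1] t] rho_range[of 1 t] t by simp
  next
    case False
    define j where "j = k - 1"
    have j: "1 \<le> j" "k = Suc j" using False k by (auto simp: j_def)
    have "\<sigma> j < t" using sigma_zero[OF j(1) t] pos j_def by force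
    \<comment> \<open>Any time strictly between the threshold and \<open>t\<close> would do: a giant
      of level \<open>j\<close> exists at \<open>s\<close>, and there is time left before
      \<open>t\<close>.\<close>
    define s where "s = (\<sigma> j + t) / 2"
    have s: "0 \<le> s" "s < t" "0 < \<rho> j s"
      using \<open>\<sigma> j < t\<close> sigma_pos[OF j(1)] sigma_posr[OF j(1), of s] by (auto simp: s_def)
    have st: "\<rho> j s \<le> \<rho> j t"
      using mono_onD[OF rho_mono[OF j(1)], of s t] s t by simp
    \<comment> \<open>Continuity at \<open>t\<close> provides the later time
      \<open>t + e / 2\<close> by which two giants would merge without room for the resulting
      jump.\<close>
    obtain e where e: "0 < e" "\<forall>x\<in>{0..}. dist x t < e \<longrightarrow> dist (\<rho> j x) (\<rho> j t) < \<rho> j s / 4"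
      using rho_cont[OF j(1)] s(3) t unfolding continuous_on_iff
      by (metis atLeast_iff zero_less_divide_iff zero_less_numeral)
    have "dist (\<rho> j (t + e / 2)) (\<rho> j t) < \<rho> j s / 4"
      using e t by (auto simp: dist_real_def)
    then have "\<rho> j (t + e / 2) < \<rho> j t + \<rho> j s / 4"
      unfolding dist_real_def by linarith
    then have "\<rho> (Suc j) t < \<rho> j t"
      using limit_strict_level[OF rho_conv[OF j(1)] rho_conv[of "Suc j"] j(1) s(1,2), of "t + e / 2"] e(1) s(3) st
      by simp
    then show ?thesis using j by simp
  qed
next
  fix k :: nat assume k: "1 \<le> k"
  show "\<sigma> (k - 1) + 1 \<le> \<sigma> k"
  proof (rule ccontr)
    assume less: "\<not> \<sigma> (k - 1) + 1 \<le> \<sigma> k"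
    define a where "a = \<sigma> (k - 1)"
    \<comment> \<open>Lies above \<open>\<sigma> k\<close> and in the subcritical window from
      \<open>a\<close> to \<open>a + 1\<close>; the \<open>max\<close> also covers the case
      \<open>\<sigma> k < a\<close>.\<close>
    define t where "t = (max (\<sigma> k) a + (a + 1)) / 2"
    have t: "\<sigma> k < t" "a \<le> t" "t < a + 1"
      using less by (auto simp: t_def a_def max_def)
    have start: "(k = 1 \<and> a = 0) \<or> (2 \<le> k \<and> conv_unif_prob (k - 1) (\<rho> (k - 1)) \<and> \<rho> (k - 1) a = 0)"
    proof (cases "k = 1")
      case True
      then show ?thesis using sigma0 by (simp add: a_def)
    next
      case False
      then have "1 \<le> k - 1" using k by simp
      then show ?thesis
        using rho_conv sigma_zero[of "k - 1" a] sigma_pos[of "k - 1"] by (simp add: a_def)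
    qed
    have "k = 1 \<or> 1 \<le> k - 1" using k by linarith
    then have "0 \<le> a"
      using sigma0 sigma_pos[of "k - 1"] unfolding a_def by auto
    then have "\<rho> k t \<le> 0"
      using subcritical_limit_le_0[OF _ t(2,3) start rho_conv[OF k]] by simp
    then show False using sigma_posr[OF k t(1)] by simp
  qed
qed

end
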